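(* Let $(D,A,b,g,B,q)$ be admissible PDE data (defined in the context), let $y_d\in L^2(D)$, $\alpha>0$, let $\psi:L^2(D)\to(-\infty,\infty]$ be proper, convex and lower semicontinuous, and let $r_{\mathrm{ad}}\in(0,\infty)$ be such that $\|u\|_{L^2(D)}\le r_{\mathrm{ad}}$ for all $u\in L^2(D)$ with $\psi(u)<\infty$. Define $$\mathfrak D=\tfrac{C_D}{\kappa_{\min}}b_{\max}+\tfrac{C_D^2}{\kappa_{\min}}g_{\max}r_{\mathrm{ad}}+\|y_d\|_{L^2(D)},\qquad R_{\mathrm{ad}}=(C_D+1)^2\tfrac{C_D}{\kappa_{\min}}g_{\max}\mathfrak D .$$ Then for each $N\in\mathbb N$, $\hat{\mathscr D}_N\subset V_{\mathrm{ad}}$, where $$\hat{\mathscr D}_N=\{v\in L^2(D):v=-\tfrac1\alpha\nabla\hat F_N(\mathrm{prox}_{\psi/\alpha}(v))\},\qquad V_{\mathrm{ad}}=\{u\in H^1(D):\|u\|_{H^1(D)}\le\tfrac1\alpha R_{\mathrm{ad}}\}.$$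
   Context: Function spaces. $H_0^1(D)$ is normed by $\|v\|_{H_0^1(D)}=\|\,\|\nabla v\|_2\,\|_{L^2(D)}$, $H^1(D)$ by $\|v\|_{H^1(D)}=(\|v\|_{L^2(D)}^2+\|\,\|\nabla v\|_2\,\|_{L^2(D)}^2)^{1/2}$; $H^{-1}(D)=H_0^1(D)^*$ with pairing $\langle\cdot,\cdot\rangle$; $L^2(D)$ is identified with its dual. $\iota:H_0^1(D)\to L^2(D)$ is the embedding and $C_D$ its operator norm. $C^{0,1}(\bar D)$ is the space of Lipschitz functions on $\bar D$ with norm $\|g\|_{C^{0,1}(\bar D)}=\sup|g|+\sup_{x\ne y}|g(x)-g(y)|/\|x-y\|_2$. Probability. $\Xi$ is a complete separable metric space which is the sample space of a complete probability space; $\xi$ is a $\Xi$-valued random element (the symbol $\xi$ also denotes points of $\Xi$). $\xi^1,\xi^2,\dots$ are i.i.d. $\Xi$-valued random elements with the law of $\xi$, defined on a complete probability space $(\Omega,\mathcal F,P)$. A map into a Banach space (resp. a space of bounded operators with operator norm) is strongly (resp. uniformly) measurable if it is an everywhere pointwise norm limit of simple functions. Admissible PDE data $(D,A,b,g,B,q)$: (a) $D\subset\mathbb R^d$ is a bounded Lipschitz domain, $d\in\{2,3\}$. (b) $A:\Xi\to\mathscr L(H_0^1(D),H^{-1}(D))$ is uniformly measurable, each $A(\xi)$ is self-adjoint, and for some $\kappa_{\min}>0$, $\langle A(\xi)y,y\rangle\ge\kappa_{\min}\|y\|_{H_0^1(D)}^2$ for all $y\in H_0^1(D)$, $\xi\in\Xi$.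 (c) $b:\Xi\to H^{-1}(D)$ and $g:\Xi\to C^{0,1}(\bar D)$ are strongly measurable and for constants $b_{\max},g_{\max}>0$, $\|b(\xi)\|_{H^{-1}(D)}\le b_{\max}$, $\|g(\xi)\|_{C^{0,1}(\bar D)}\le g_{\max}$ for all $\xi\in\Xi$. (d) $B(\xi)\in\mathscr L(L^2(D),H^{-1}(D))$, $\langle B(\xi)u,v\rangle=(g(\xi)u,v)_{L^2(D)}$. (e) $q:\mathbb R\to\mathbb R$ is nondecreasing, twice continuously differentiable, $q(0)=0$, $|q''(t)|\le c_q+d_q|t|^{p-3}$ for all $t$, where $c_q,d_q\ge0$ and $p\in(3,\infty)$ if $d=2$, $p\in(3,6]$ if $d=3$; $Q:H_0^1(D)\to H^{-1}(D)$ is $\langle Q(y),v\rangle=(q(y),v)_{L^2(D)}$. For $(u,\xi)\in L^2(D)\times\Xi$, $S(u,\xi)\in H_0^1(D)$ is the unique solution $y$ of $A(\xi)y+Q(y)=b(\xi)+B(\xi)u$. Set $\hat F_N(u)=\frac1{2N}\sum_{i=1}^N\|\iota S(u,\xi^i)-y_d\|_{L^2(D)}^2$; it is Fréchet differentiable on $L^2(D)$ with $L^2(D)$-gradient $\nabla\hat F_N$. The set $\hat{\mathscr D}_N$ depends on $\omega\in\Omega$ through the samples. The proximity operator is $\mathrm{prox}_{\psi/\alpha}(v)=\arg\min_{w\in L^2(D)}\psi(w)/\alpha+\tfrac12\|v-w\|_{L^2(D)}^2$. *)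

theory Defs
  imports "HOL-Probability.Probability"
begin

section \<open>The Hilbert space of square-integrable functions modulo null sets\<close>

definition sq_int :: "('a::euclidean_space \<Rightarrow> 'b::euclidean_space) \<Rightarrow> bool" where
  "sq_int f \<longleftrightarrow> f \<in> borel_measurable borel \<and> integrable lborel (\<lambda>x. (norm (f x))\<^sup>2)"

definition L2_rel :: "('a::euclidean_space \<Rightarrow> 'b::euclidean_space) \<Rightarrow> ('a \<Rightarrow> 'b) \<Rightarrow> bool" where
  "L2_rel f g \<longleftrightarrow> sq_int f \<and> sq_int g \<and> (AE x in lborel. f x = g x)"

lemma sq_int_zero: "sq_int (\<lambda>x. 0)"
  by (simp add: sq_int_def)

lemma sq_int_scale: "sq_int f \<Longrightarrow> sq_int (\<lambda>x. c *\<^sub>R f x)"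
  by (auto simp: sq_int_def power_mult_distrib)

lemma sq_int_add:
  assumes "sq_int f" "sq_int g"
  shows "sq_int (\<lambda>x. f x + g x)"
proof -
  have [measurable]: "f \<in> borel_measurable borel" "g \<in> borel_measurable borel"
    using assms by (auto simp: sq_int_def)
  have "integrable lborel (\<lambda>x. (norm (f x + g x))\<^sup>2)"
  proof (rule Bochner_Integration.integrable_bound)
    show "integrable lborel (\<lambda>x. 2 * (norm (f x))\<^sup>2 + 2 * (norm (g x))\<^sup>2)"
      using assms by (auto simp: sq_int_def)
    show "(\<lambda>x. (norm (f x + g x))\<^sup>2) \<in> borel_measurable lborel"
      by measurable
    have "(norm (f x + g x))\<^sup>2 \<le> 2 * (norm (f x))\<^sup>2 + 2 * (norm (g x))\<^sup>2" for x
    proof -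
      have "(norm (f x + g x))\<^sup>2 \<le> (norm (f x) + norm (g x))\<^sup>2"
        by (intro power_mono norm_triangle_ineq) simp
      also have "\<dots> \<le> 2 * (norm (f x))\<^sup>2 + 2 * (norm (g x))\<^sup>2"
        using sum_squares_bound[of "norm (f x)" "norm (g x)"] by (simp add: power2_sum)
      finally show ?thesis .
    qed
    then show "AE x in lborel. norm ((norm (f x + g x))\<^sup>2)
        \<le> norm (2 * (norm (f x))\<^sup>2 + 2 * (norm (g x))\<^sup>2)"
      by (auto intro!: AE_I2)
  qed
  then show ?thesis by (auto simp: sq_int_def)
qed

lemma sq_int_uminus: "sq_int f \<Longrightarrow> sq_int (\<lambda>x. - f x)"
  using sq_int_scale[of f "-1"] by simp

lemma sq_int_diff: "sq_int f \<Longrightarrow> sq_int g \<Longrightarrow> sq_int (\<lambda>x. f x - g x)"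
  using sq_int_add[of f "\<lambda>x. - g x"] sq_int_uminus[of g] by simp

lemma sq_int_inner:
  assumes "sq_int f" "sq_int g"
  shows "integrable lborel (\<lambda>x. f x \<bullet> g x)"
proof -
  have [measurable]: "f \<in> borel_measurable borel" "g \<in> borel_measurable borel"
    using assms by (auto simp: sq_int_def)
  show ?thesis
  proof (rule Bochner_Integration.integrable_bound)
    show "integrable lborel (\<lambda>x. (norm (f x))\<^sup>2 + (norm (g x))\<^sup>2)"
      using assms by (auto simp: sq_int_def)
    show "(\<lambda>x. f x \<bullet> g x) \<in> borel_measurable lborel"
      by measurable
    have "\<bar>f x \<bullet> g x\<bar> \<le> (norm (f x))\<^sup>2 + (norm (g x))\<^sup>2" for x
    proof -
      have "0 \<le> norm (f x) * norm (g x)" by simp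
      then show ?thesis
        using Cauchy_Schwarz_ineq2[of "f x" "g x"]
          sum_squares_bound[of "norm (f x)" "norm (g x)"] by linarith
    qed
    then show "AE x in lborel. norm (f x \<bullet> g x) \<le> norm ((norm (f x))\<^sup>2 + (norm (g x))\<^sup>2)"
      by (auto intro!: AE_I2)
  qed
qed

lemma part_equivp_L2_rel: "part_equivp (L2_rel :: ('a::euclidean_space \<Rightarrow> 'b::euclidean_space) \<Rightarrow> _)"
proof (rule part_equivpI)
  show "\<exists>f::'a \<Rightarrow> 'b. L2_rel f f"
    using sq_int_zero by (auto simp: L2_rel_def)
  show "symp (L2_rel :: ('a \<Rightarrow> 'b) \<Rightarrow> _)"
    by (auto intro!: sympI simp: L2_rel_def elim: AE_mp)
  show "transp (L2_rel :: ('a \<Rightarrow> 'b) \<Rightarrow> _)"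
  proof (rule transpI)
    fix f g h :: "'a \<Rightarrow> 'b"
    assume "L2_rel f g" "L2_rel g h"
    then have "AE x in lborel. f x = g x" "AE x in lborel. g x = h x" "sq_int f" "sq_int h"
      by (auto simp: L2_rel_def)
    moreover from this(1,2) have "AE x in lborel. f x = h x"
      by eventually_elim simp
    ultimately show "L2_rel f h"
      by (simp add: L2_rel_def)
  qed
qed

quotient_type (overloaded) ('a, 'b) L2 = "'a::euclidean_space \<Rightarrow> 'b::euclidean_space"
  / partial: L2_rel
  by (rule part_equivp_L2_rel)

instantiation L2 :: (euclidean_space, euclidean_space) real_inner
begin

lift_definition zero_L2 :: "('a, 'b) L2" is "\<lambda>x. 0"
  by (simp add: L2_rel_def sq_int_zero)

lift_definition plus_L2 :: "('a, 'b) L2 \<Rightarrow> ('a, 'b) L2 \<Rightarrow> ('a, 'b) L2"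
  is "\<lambda>f g x. f x + g x"
  unfolding L2_rel_def by (auto intro!: sq_int_add)

lift_definition uminus_L2 :: "('a, 'b) L2 \<Rightarrow> ('a, 'b) L2"
  is "\<lambda>f x. - f x"
  unfolding L2_rel_def by (auto intro!: sq_int_uminus)

lift_definition minus_L2 :: "('a, 'b) L2 \<Rightarrow> ('a, 'b) L2 \<Rightarrow> ('a, 'b) L2"
  is "\<lambda>f g x. f x - g x"
  unfolding L2_rel_def by (auto intro!: sq_int_diff)

lift_definition scaleR_L2 :: "real \<Rightarrow> ('a, 'b) L2 \<Rightarrow> ('a, 'b) L2"
  is "\<lambda>c f x. c *\<^sub>R f x"
  unfolding L2_rel_def by (auto intro!: sq_int_scale)

lift_definition inner_L2 :: "('a, 'b) L2 \<Rightarrow> ('a, 'b) L2 \<Rightarrow> real"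
  is "\<lambda>f g. \<integral>x. f x \<bullet> g x \<partial>lborel"
proof -
  fix f1 f2 g1 g2 :: "'a \<Rightarrow> 'b"
  assume a: "L2_rel f1 f2" "L2_rel g1 g2"
  then have [measurable]: "f1 \<in> borel_measurable borel" "f2 \<in> borel_measurable borel"
      "g1 \<in> borel_measurable borel" "g2 \<in> borel_measurable borel"
    by (auto simp: L2_rel_def sq_int_def)
  show "(\<integral>x. f1 x \<bullet> g1 x \<partial>lborel) = (\<integral>x. f2 x \<bullet> g2 x \<partial>lborel)"
    using a by (intro integral_cong_AE) (auto simp: L2_rel_def)
qed

definition norm_L2 :: "('a, 'b) L2 \<Rightarrow> real" where
  "norm_L2 f = sqrt (f \<bullet> f)"

definition sgn_L2 :: "('a, 'b) L2 \<Rightarrow> ('a, 'b) L2" where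
  "sgn_L2 f = inverse (norm f) *\<^sub>R f"

definition dist_L2 :: "('a, 'b) L2 \<Rightarrow> ('a, 'b) L2 \<Rightarrow> real" where
  "dist_L2 f g = norm (f - g)"

definition uniformity_L2 :: "(('a, 'b) L2 \<times> ('a, 'b) L2) filter" where
  "uniformity_L2 = (INF e\<in>{0<..}. principal {(f, g). dist f g < e})"

definition open_L2 :: "('a, 'b) L2 set \<Rightarrow> bool" where
  "open_L2 U \<longleftrightarrow> (\<forall>f\<in>U. eventually (\<lambda>(f', g). f' = f \<longrightarrow> g \<in> U) uniformity)"

instance
proof
  fix f g h :: "('a, 'b) L2" and a b :: real
  show "f + g + h = f + (g + h)"
    by transfer (auto simp: L2_rel_def add.assoc intro!: sq_int_add)
  show "f + g = g + f"
    by transfer (auto simp: L2_rel_def add.commute intro!: sq_int_add)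
  show "0 + f = f"
    by transfer (auto simp: L2_rel_def)
  show "- f + f = 0"
    by transfer (auto simp: L2_rel_def sq_int_zero)
  show "f - g = f + - g"
    by transfer (auto simp: L2_rel_def intro!: sq_int_diff)
  show "a *\<^sub>R (f + g) = a *\<^sub>R f + a *\<^sub>R g"
    by transfer (auto simp: L2_rel_def scaleR_add_right intro!: sq_int_add sq_int_scale)
  show "(a + b) *\<^sub>R f = a *\<^sub>R f + b *\<^sub>R f"
    by transfer (auto simp: L2_rel_def scaleR_add_left intro!: sq_int_add sq_int_scale)
  show "a *\<^sub>R b *\<^sub>R f = (a * b) *\<^sub>R f"
    by transfer (auto simp: L2_rel_def intro!: sq_int_scale)
  show "1 *\<^sub>R f = f"
    by transfer (auto simp: L2_rel_def)
  show "sgn f = inverse (norm f) *\<^sub>R f"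
    by (simp add: sgn_L2_def)
  show "dist f g = norm (f - g)"
    by (simp add: dist_L2_def)
  show "(uniformity :: (('a, 'b) L2 \<times> ('a, 'b) L2) filter) = (INF e\<in>{0<..}. principal {(x, y). dist x y < e})"
    by (rule uniformity_L2_def)
  show "open U \<longleftrightarrow> (\<forall>f\<in>U. \<forall>\<^sub>F (f', g) in uniformity. f' = f \<longrightarrow> g \<in> U)" for U :: "('a, 'b) L2 set"
    by (rule open_L2_def)
  show "f \<bullet> g = g \<bullet> f"
    by transfer (simp add: inner_commute)
  show "(f + g) \<bullet> h = f \<bullet> h + g \<bullet> h"
    by transfer (auto simp: L2_rel_def inner_add_left sq_int_inner)
  show "(a *\<^sub>R f) \<bullet> g = a * (f \<bullet> g)"
    by transfer simp
  show "0 \<le> f \<bullet> f"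
    by transfer (simp add: integral_nonneg_AE)
  show "f \<bullet> f = 0 \<longleftrightarrow> f = 0"
  proof transfer
    fix f :: "'a \<Rightarrow> 'b"
    assume "L2_rel f f"
    then have f: "sq_int f" by (simp add: L2_rel_def)
    have "(\<integral>x. f x \<bullet> f x \<partial>lborel) = 0 \<longleftrightarrow> (AE x in lborel. f x \<bullet> f x = 0)"
      using sq_int_inner[OF f f] by (intro integral_nonneg_eq_0_iff_AE) auto
    then show "(\<integral>x. f x \<bullet> f x \<partial>lborel) = 0 \<longleftrightarrow> L2_rel f (\<lambda>x. 0)"
      using f by (simp add: L2_rel_def sq_int_zero)
  qed
  show "norm f = sqrt (f \<bullet> f)"
    by (rule norm_L2_def)
qed

end

text \<open>For \<^term>\<open>u\<close> of type \<open>('a, 'b) L2\<close>, \<open>rep_L2 u\<close> is one (arbitrarily chosen) function in the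
  class \<open>u\<close>, and \<open>abs_L2 f\<close> is the class of a square-integrable function \<open>f\<close>. The space
  \<open>L\<^sup>2(D)\<close> is the closed subspace of those classes that vanish almost everywhere off \<open>D\<close>
  (extension by zero), with the inherited inner product and norm.\<close>

definition L2_on :: "'a set \<Rightarrow> ('a::euclidean_space, 'b::euclidean_space) L2 set" where
  "L2_on D = {u. AE x in lborel. x \<notin> D \<longrightarrow> rep_L2 u x = 0}"


section \<open>Sobolev spaces\<close>

text \<open>In finite dimension, \<open>f\<close> is \<open>C\<^sup>k\<^sup>+\<^sup>1\<close> iff it is differentiable and each of its directional
  derivatives is \<open>C\<^sup>k\<close>.\<close>

primrec C_k :: "nat \<Rightarrow> ('a::euclidean_space \<Rightarrow> real) \<Rightarrow> bool" where
  "C_k 0 f \<longleftrightarrow> continuous_on UNIV f"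
| "C_k (Suc k) f \<longleftrightarrow>
     (\<forall>x. f differentiable (at x)) \<and> (\<forall>e. C_k k (\<lambda>x. frechet_derivative f (at x) e))"

definition test_functions :: "'a::euclidean_space set \<Rightarrow> ('a \<Rightarrow> real) set" where
  "test_functions D = {\<phi>. (\<forall>k. C_k k \<phi>) \<and> compact (closure {x. \<phi> x \<noteq> 0})
     \<and> closure {x. \<phi> x \<noteq> 0} \<subseteq> D}"

definition is_weak_gradient ::
    "'a::euclidean_space set \<Rightarrow> ('a, real) L2 \<Rightarrow> ('a, 'a) L2 \<Rightarrow> bool" where
  "is_weak_gradient D u G \<longleftrightarrow> G \<in> L2_on D \<and>
     (\<forall>\<phi>\<in>test_functions D. \<forall>i\<in>Basis.
        (LINT x:D|lborel. rep_L2 u x * frechet_derivative \<phi> (at x) i)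
          = - (LINT x:D|lborel. (rep_L2 G x \<bullet> i) * \<phi> x))"

definition weak_gradient :: "'a::euclidean_space set \<Rightarrow> ('a, real) L2 \<Rightarrow> ('a, 'a) L2" where
  "weak_gradient D u = (THE G. is_weak_gradient D u G)"

definition H1 :: "'a::euclidean_space set \<Rightarrow> ('a, real) L2 set" where
  "H1 D = {u \<in> L2_on D. \<exists>G. is_weak_gradient D u G}"

definition H1_norm :: "'a::euclidean_space set \<Rightarrow> ('a, real) L2 \<Rightarrow> real" where
  "H1_norm D u = sqrt ((norm u)\<^sup>2 + (norm (weak_gradient D u))\<^sup>2)"

definition H10 :: "'a::euclidean_space set \<Rightarrow> ('a, real) L2 set" where
  "H10 D = {u \<in> H1 D. \<exists>\<phi>. (\<forall>n. \<phi> n \<in> test_functions D)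
     \<and> (\<lambda>n. H1_norm D (u - abs_L2 (\<phi> n))) \<longlonglongrightarrow> 0}"

text \<open>The norm of a vector-valued class \<open>G\<close> is the \<open>L\<^sup>2\<close>-norm of \<open>x \<mapsto> \<parallel>G(x)\<parallel>\<^sub>2\<close>.\<close>

definition H10_norm :: "'a::euclidean_space set \<Rightarrow> ('a, real) L2 \<Rightarrow> real" where
  "H10_norm D v = norm (weak_gradient D v)"


section \<open>Bounded functionals and operators\<close>

text \<open>\<^const>\<open>onorm\<close> relative to a subspace \<open>V\<close> and to explicitly given norms on domain and range
  (the zero vector contributes \<open>0 / 0 = 0\<close>).\<close>

definition onorm_on :: "'v set \<Rightarrow> ('v \<Rightarrow> real) \<Rightarrow> ('w \<Rightarrow> real) \<Rightarrow> ('v \<Rightarrow> 'w) \<Rightarrow> real" where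
  "onorm_on V nV nW T = (SUP v\<in>V. nW (T v) / nV v)"

definition embedding_const :: "'a::euclidean_space set \<Rightarrow> real" where
  "embedding_const D = onorm_on (H10 D) (H10_norm D) norm (\<lambda>v. v)"

text \<open>An element \<open>l\<close> of the dual space \<open>H\<^sup>-\<^sup>1(D)\<close> is a total function of which only the values on
  \<open>H10 D\<close> matter; the pairing of \<open>l\<close> with \<open>v\<close> is the application \<open>l v\<close>.\<close>

definition Hm1 :: "'a::euclidean_space set \<Rightarrow> (('a, real) L2 \<Rightarrow> real) set" where
  "Hm1 D = {l. (\<forall>v\<in>H10 D. \<forall>w\<in>H10 D. l (v + w) = l v + l w)
     \<and> (\<forall>v\<in>H10 D. \<forall>c. l (c *\<^sub>R v) = c * l v)
     \<and> (\<exists>C. \<forall>v\<in>H10 D. \<bar>l v\<bar> \<le> C * H10_norm D v)}"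

definition Hm1_norm :: "'a::euclidean_space set \<Rightarrow> (('a, real) L2 \<Rightarrow> real) \<Rightarrow> real" where
  "Hm1_norm D l = onorm_on (H10 D) (H10_norm D) abs l"

definition bounded_ops_Hm1 ::
    "('v::real_vector) set \<Rightarrow> ('v \<Rightarrow> real) \<Rightarrow> 'a::euclidean_space set
      \<Rightarrow> ('v \<Rightarrow> ('a, real) L2 \<Rightarrow> real) set" where
  "bounded_ops_Hm1 V nV D = {T. (\<forall>y\<in>V. T y \<in> Hm1 D)
     \<and> (\<forall>y\<in>V. \<forall>z\<in>V. \<forall>v\<in>H10 D. T (y + z) v = T y v + T z v)
     \<and> (\<forall>y\<in>V. \<forall>c. \<forall>v\<in>H10 D. T (c *\<^sub>R y) v = c * T y v)
     \<and> (\<exists>C. \<forall>y\<in>V. Hm1_norm D (T y) \<le> C * nV y)}"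

text \<open>Everywhere pointwise limit of simple functions with values in the space \<open>X\<close> normed by \<open>nX\<close>.
  With \<open>nX\<close> an operator norm this is uniform measurability. The subtraction is used at function
  types, where it is pointwise.\<close>

definition strongly_measurable ::
    "'x measure \<Rightarrow> ('w::minus) set \<Rightarrow> ('w \<Rightarrow> real) \<Rightarrow> ('x \<Rightarrow> 'w) \<Rightarrow> bool" where
  "strongly_measurable M X nX f \<longleftrightarrow> (\<exists>s. (\<forall>n. simple_function M (s n))
     \<and> (\<forall>n. \<forall>x\<in>space M. s n x \<in> X)
     \<and> (\<forall>x\<in>space M. (\<lambda>n. nX (s n x - f x)) \<longlonglongrightarrow> 0))"


section \<open>Lipschitz functions and Lipschitz domains\<close>

definition C01 :: "'a::euclidean_space set \<Rightarrow> ('a \<Rightarrow> real) set" where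
  "C01 K = {g. \<exists>L. L-lipschitz_on K g}"

definition C01_norm :: "'a::euclidean_space set \<Rightarrow> ('a \<Rightarrow> real) \<Rightarrow> real" where
  "C01_norm K g = (SUP x\<in>K. \<bar>g x\<bar>)
     + (SUP (x, y)\<in>{(x, y). x \<in> K \<and> y \<in> K \<and> x \<noteq> y}. \<bar>g x - g y\<bar> / norm (x - y))"

text \<open>Near each boundary point, \<open>D\<close> is the strict subgraph of a Lipschitz function over a hyperplane
  with unit normal \<open>e\<close>; \<open>y - (y \<bullet> e) *\<^sub>R e\<close> is the projection of \<open>y\<close> to that hyperplane.\<close>

definition bounded_Lipschitz_domain :: "'a::euclidean_space set \<Rightarrow> bool" where
  "bounded_Lipschitz_domain D \<longleftrightarrow> D \<noteq> {} \<and> open D \<and> connected D \<and> bounded D \<and>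
     (\<forall>x\<in>frontier D. \<exists>r>0. \<exists>e \<gamma> L. norm e = 1 \<and> L-lipschitz_on {z. z \<bullet> e = 0} \<gamma> \<and>
        D \<inter> ball x r = {y \<in> ball x r. y \<bullet> e < \<gamma> (y - (y \<bullet> e) *\<^sub>R e)})"


section \<open>The state equation and the sample average objective\<close>

definition admissible_nonlinearity :: "nat \<Rightarrow> (real \<Rightarrow> real) \<Rightarrow> bool" where
  "admissible_nonlinearity d q \<longleftrightarrow>
     mono q \<and> q differentiable_on UNIV \<and> deriv q differentiable_on UNIV
     \<and> continuous_on UNIV (deriv (deriv q)) \<and> q 0 = 0
     \<and> (\<exists>c p e::real. 0 \<le> c \<and> 0 \<le> e \<and> 3 < p \<and> (d = 3 \<longrightarrow> p \<le> 6)
          \<and> (\<forall>t. \<bar>deriv (deriv q) t\<bar> \<le> c + e * \<bar>t\<bar> powr (p - 3)))"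

definition admissible_pde_data ::
    "'a::euclidean_space set \<Rightarrow> 'x measure
      \<Rightarrow> ('x \<Rightarrow> ('a, real) L2 \<Rightarrow> ('a, real) L2 \<Rightarrow> real) \<Rightarrow> real
      \<Rightarrow> ('x \<Rightarrow> ('a, real) L2 \<Rightarrow> real) \<Rightarrow> real
      \<Rightarrow> ('x \<Rightarrow> 'a \<Rightarrow> real) \<Rightarrow> real
      \<Rightarrow> ('x \<Rightarrow> ('a, real) L2 \<Rightarrow> ('a, real) L2 \<Rightarrow> real) \<Rightarrow> (real \<Rightarrow> real) \<Rightarrow> bool" where
  "admissible_pde_data D M A \<kappa> b bmax g gmax B q \<longleftrightarrow>
     (DIM('a) = 2 \<or> DIM('a) = 3) \<and> bounded_Lipschitz_domain D
     \<and> (\<forall>\<xi>\<in>space M. A \<xi> \<in> bounded_ops_Hm1 (H10 D) (H10_norm D) D)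
     \<and> strongly_measurable M (bounded_ops_Hm1 (H10 D) (H10_norm D) D)
         (onorm_on (H10 D) (H10_norm D) (Hm1_norm D)) A
     \<and> (\<forall>\<xi>\<in>space M. \<forall>y\<in>H10 D. \<forall>v\<in>H10 D. A \<xi> y v = A \<xi> v y)
     \<and> 0 < \<kappa> \<and> (\<forall>\<xi>\<in>space M. \<forall>y\<in>H10 D. \<kappa> * (H10_norm D y)\<^sup>2 \<le> A \<xi> y y)
     \<and> (\<forall>\<xi>\<in>space M. b \<xi> \<in> Hm1 D) \<and> strongly_measurable M (Hm1 D) (Hm1_norm D) b
     \<and> 0 < bmax \<and> (\<forall>\<xi>\<in>space M. Hm1_norm D (b \<xi>) \<le> bmax)
     \<and> (\<forall>\<xi>\<in>space M. g \<xi> \<in> C01 (closure D))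
     \<and> strongly_measurable M (C01 (closure D)) (C01_norm (closure D)) g
     \<and> 0 < gmax \<and> (\<forall>\<xi>\<in>space M. C01_norm (closure D) (g \<xi>) \<le> gmax)
     \<and> (\<forall>\<xi>\<in>space M. B \<xi> \<in> bounded_ops_Hm1 (L2_on D) norm D)
     \<and> (\<forall>\<xi>\<in>space M. \<forall>u\<in>L2_on D. \<forall>v\<in>H10 D.
          B \<xi> u v = (LINT x:D|lborel. (g \<xi> x * rep_L2 u x) * rep_L2 v x))
     \<and> admissible_nonlinearity DIM('a) q"

definition superposition_op ::
    "'a::euclidean_space set \<Rightarrow> (real \<Rightarrow> real) \<Rightarrow> ('a, real) L2 \<Rightarrow> ('a, real) L2 \<Rightarrow> real" where
  "superposition_op D q y v = (LINT x:D|lborel. q (rep_L2 y x) * rep_L2 v x)"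

definition solves_state_eq ::
    "'a::euclidean_space set \<Rightarrow> (('a, real) L2 \<Rightarrow> ('a, real) L2 \<Rightarrow> real) \<Rightarrow> (real \<Rightarrow> real)
      \<Rightarrow> (('a, real) L2 \<Rightarrow> real) \<Rightarrow> (('a, real) L2 \<Rightarrow> ('a, real) L2 \<Rightarrow> real)
      \<Rightarrow> ('a, real) L2 \<Rightarrow> ('a, real) L2 \<Rightarrow> bool" where
  "solves_state_eq D A\<xi> q b\<xi> B\<xi> u y \<longleftrightarrow>
     y \<in> H10 D \<and> (\<forall>v\<in>H10 D. A\<xi> y v + superposition_op D q y v = b\<xi> v + B\<xi> u v)"

definition solution_op ::
    "'a::euclidean_space set \<Rightarrow> ('x \<Rightarrow> ('a, real) L2 \<Rightarrow> ('a, real) L2 \<Rightarrow> real) \<Rightarrow> (real \<Rightarrow> real)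
      \<Rightarrow> ('x \<Rightarrow> ('a, real) L2 \<Rightarrow> real) \<Rightarrow> ('x \<Rightarrow> ('a, real) L2 \<Rightarrow> ('a, real) L2 \<Rightarrow> real)
      \<Rightarrow> ('a, real) L2 \<Rightarrow> 'x \<Rightarrow> ('a, real) L2" where
  "solution_op D A q b B u \<xi> = (THE y. solves_state_eq D (A \<xi>) q (b \<xi>) (B \<xi>) u y)"

definition sample_objective ::
    "(('a::euclidean_space, real) L2 \<Rightarrow> 'x \<Rightarrow> ('a, real) L2) \<Rightarrow> ('a, real) L2
      \<Rightarrow> (nat \<Rightarrow> 'x) \<Rightarrow> nat \<Rightarrow> ('a, real) L2 \<Rightarrow> real" where
  "sample_objective S yd \<xi>s N u = 1 / (2 * real N) * (\<Sum>i=1..N. (norm (S u (\<xi>s i) - yd))\<^sup>2)"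

definition L2_gradient ::
    "'a::euclidean_space set \<Rightarrow> (('a, real) L2 \<Rightarrow> real) \<Rightarrow> ('a, real) L2 \<Rightarrow> ('a, real) L2" where
  "L2_gradient D F u =
     (THE G. G \<in> L2_on D \<and> (F has_derivative (\<lambda>h. G \<bullet> h)) (at u within L2_on D))"


section \<open>Extended-valued convex functions and proximity operator\<close>

definition proper_on :: "'v set \<Rightarrow> ('v \<Rightarrow> ereal) \<Rightarrow> bool" where
  "proper_on V \<psi> \<longleftrightarrow> (\<forall>u\<in>V. \<psi> u \<noteq> -\<infinity>) \<and> (\<exists>u\<in>V. \<psi> u < \<infinity>)"

definition convex_ereal_on :: "('v::real_vector) set \<Rightarrow> ('v \<Rightarrow> ereal) \<Rightarrow> bool" where
  "convex_ereal_on V \<psi> \<longleftrightarrow> (\<forall>u\<in>V. \<forall>w\<in>V. \<forall>t\<in>{0..1}.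
     \<psi> ((1 - t) *\<^sub>R u + t *\<^sub>R w) \<le> ereal (1 - t) * \<psi> u + ereal t * \<psi> w)"

definition lsc_on :: "('v::topological_space) set \<Rightarrow> ('v \<Rightarrow> ereal) \<Rightarrow> bool" where
  "lsc_on V \<psi> \<longleftrightarrow> (\<forall>u\<in>V. \<psi> u \<le> Liminf (at u within V) \<psi>)"

definition prox_on :: "('v::real_normed_vector) set \<Rightarrow> ('v \<Rightarrow> ereal) \<Rightarrow> real \<Rightarrow> 'v \<Rightarrow> 'v" where
  "prox_on V \<psi> \<alpha> v =
     arg_min (\<lambda>w. \<psi> w / ereal \<alpha> + ereal (1 / 2 * (norm (v - w))\<^sup>2)) (\<lambda>w. w \<in> V)"

end

theory Submission
  imports Defs
begin

text \<open>Let \<open>y = S(u, \<xi>)\<close> be the state at \<open>u = prox(v)\<close> and let the adjoint state \<open>z\<close> solve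
  \<open>A z + q'(y) z = y - y\<^sub>d\<close>. Testing the state equations at \<open>u\<close> and \<open>u + h\<close> with \<open>z\<close>, and the adjoint
  equation with \<open>S(u + h, \<xi>) - y\<close>, shows that one summand of the objective changes by the inner
  product of \<open>g z\<close> and \<open>h\<close> up to \<open>O(\<parallel>h\<parallel>\<^sup>2)\<close>; the growth of \<open>q''\<close> is controlled by the Sobolev embedding.
  Hence the gradient is the average of the \<open>g z\<close>, and a point \<open>v\<close> of the set in question is
  \<open>-1/\<alpha>\<close> times this average. Coercivity bounds \<open>y\<close> and then \<open>z\<close> in \<open>H\<^sub>0\<^sup>1\<close>, and multiplication by a
  Lipschitz function maps \<open>H\<^sub>0\<^sup>1\<close> boundedly into \<open>H\<^sup>1\<close>. States and adjoint states are obtained as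
  minimisers of strongly convex functionals, so only completeness of \<open>L\<^sup>2\<close> is needed for existence.\<close>

section \<open>The space \<open>L\<^sup>2\<close>\<close>

text \<open>\<open>solution_op\<close>, \<open>L2_gradient\<close> and \<open>prox_on\<close> are
  choice terms, so nothing can be said about them before existence is established, together with
  uniqueness for the first two. In particular \<open>r_ad\<close> bounds the control only because
  the proximity problem has a minimiser and \<psi> is finite there.

  The nonlinearity is handled with a single even exponent n = 2k for which H^1_0 embeds into L^n: n
  = 6 in space, any even n in the plane. The nonlinear integrands are then dominated by n-th powers
  of one function, and the embedding itself only has to be proved for integer powers of test
  functions.

  In \<open>R_ad\<close> the factor (C_D / \<kappa>min) * DD bounds the adjoint state in H^1_0, DD
  being a bound for the residual S(u, \<xi>) - y_d, while (C_D + 1)^2 * gmax bounds multiplication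
  by g from H^1_0 to H^1. The square leaves room, and this room absorbs the constant lost by
  estimating the product without an almost everywhere gradient of g.\<close>

lemma sq_int_rep_L2: "sq_int (rep_L2 u)"
  using Quotient_rep_reflp[OF Quotient_L2, of u] by (simp add: L2_rel_def)

lemma abs_rep_L2: "abs_L2 (rep_L2 u) = u"
  by (rule Quotient_abs_rep[OF Quotient_L2])

lemma rep_L2_borel [measurable]: "rep_L2 u \<in> borel_measurable borel"
  using sq_int_rep_L2[of u] by (simp add: sq_int_def)

lemma rep_L2_norm_integrable: "integrable lborel (\<lambda>x. (norm (rep_L2 u x))\<^sup>2)"
  using sq_int_rep_L2[of u] by (simp add: sq_int_def)

lemma rep_abs_L2: "sq_int f \<Longrightarrow> AE x in lborel. rep_L2 (abs_L2 f) x = f x"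
  using Quotient_rep_abs[OF Quotient_L2, of f] by (simp add: L2_rel_def)

lemma L2_eq_iff: "u = v \<longleftrightarrow> (AE x in lborel. rep_L2 u x = rep_L2 v x)"
  using Quotient_rel_rep[OF Quotient_L2, of u v] by (auto simp: L2_rel_def sq_int_rep_L2)

lemma abs_L2_eq_iff: "sq_int f \<Longrightarrow> sq_int g \<Longrightarrow> abs_L2 f = abs_L2 g \<longleftrightarrow> (AE x in lborel. f x = g x)"
  using Quotient_rel[OF Quotient_L2, of f g] by (auto simp: L2_rel_def)

lemma plus_abs_L2: "sq_int f \<Longrightarrow> sq_int g \<Longrightarrow> abs_L2 f + abs_L2 g = abs_L2 (\<lambda>x. f x + g x)"
  by (rule plus_L2.abs_eq) (auto simp: L2_rel_def)

lemma minus_abs_L2: "sq_int f \<Longrightarrow> sq_int g \<Longrightarrow> abs_L2 f - abs_L2 g = abs_L2 (\<lambda>x. f x - g x)"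
  by (rule minus_L2.abs_eq) (auto simp: L2_rel_def)

lemma scaleR_abs_L2: "sq_int f \<Longrightarrow> c *\<^sub>R abs_L2 f = abs_L2 (\<lambda>x. c *\<^sub>R f x)"
  by (rule scaleR_L2.abs_eq) (auto simp: L2_rel_def)

lemma inner_abs_L2: "sq_int f \<Longrightarrow> sq_int g \<Longrightarrow> abs_L2 f \<bullet> abs_L2 g = (\<integral>x. f x \<bullet> g x \<partial>lborel)"
  by (rule inner_L2.abs_eq) (auto simp: L2_rel_def)

lemma rep_plus_L2: "AE x in lborel. rep_L2 (u + v) x = rep_L2 u x + rep_L2 v x"
  using rep_abs_L2[OF sq_int_add[OF sq_int_rep_L2 sq_int_rep_L2], of u v]
  by (simp add: plus_abs_L2[symmetric] sq_int_rep_L2 abs_rep_L2)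

lemma rep_minus_L2: "AE x in lborel. rep_L2 (u - v) x = rep_L2 u x - rep_L2 v x"
  using rep_abs_L2[OF sq_int_diff[OF sq_int_rep_L2 sq_int_rep_L2], of u v]
  by (simp add: minus_abs_L2[symmetric] sq_int_rep_L2 abs_rep_L2)

lemma rep_scaleR_L2: "AE x in lborel. rep_L2 (c *\<^sub>R u) x = c *\<^sub>R rep_L2 u x"
  using rep_abs_L2[OF sq_int_scale[OF sq_int_rep_L2], of c u]
  by (simp add: scaleR_abs_L2[symmetric] sq_int_rep_L2 abs_rep_L2)

lemma rep_zero_L2: "AE x in lborel. rep_L2 0 x = 0"
  using rep_abs_L2[OF sq_int_zero] by (simp add: zero_L2.abs_eq)

lemma inner_L2_eq: "u \<bullet> v = (\<integral>x. rep_L2 u x \<bullet> rep_L2 v x \<partial>lborel)"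
  using inner_abs_L2[OF sq_int_rep_L2 sq_int_rep_L2, of u v] by (simp add: abs_rep_L2)

lemma inner_L2_abs:
  assumes "sq_int f"
  shows "u \<bullet> abs_L2 f = (\<integral>x. rep_L2 u x \<bullet> f x \<partial>lborel)"
  using inner_abs_L2[OF sq_int_rep_L2 assms, of u] by (simp add: abs_rep_L2)

lemma norm_L2_sq: "(norm u)\<^sup>2 = (\<integral>x. (norm (rep_L2 u x))\<^sup>2 \<partial>lborel)"
  by (simp add: power2_norm_eq_inner inner_L2_eq)

lemma norm_abs_L2_sq: "sq_int f \<Longrightarrow> (norm (abs_L2 f))\<^sup>2 = (\<integral>x. (norm (f x))\<^sup>2 \<partial>lborel)"
  by (simp add: power2_norm_eq_inner inner_abs_L2)

lemma nn_norm_L2: "(\<integral>\<^sup>+x. ennreal ((norm (rep_L2 u x))\<^sup>2) \<partial>lborel) = ennreal ((norm u)\<^sup>2)"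
  unfolding norm_L2_sq by (rule nn_integral_eq_integral[OF rep_L2_norm_integrable]) simp

lemma sq_intI_nn:
  assumes [measurable]: "f \<in> borel_measurable borel"
    and "(\<integral>\<^sup>+x. ennreal ((norm (f x))\<^sup>2) \<partial>lborel) < \<infinity>"
  shows "sq_int f"
  using assms unfolding sq_int_def by (auto intro!: integrableI_nonneg)

lemma norm_abs_L2_le:
  assumes f: "sq_int f" and "0 \<le> c" "(\<integral>\<^sup>+x. ennreal ((norm (f x))\<^sup>2) \<partial>lborel) \<le> ennreal (c\<^sup>2)"
  shows "norm (abs_L2 f) \<le> c"
proof -
  have "ennreal ((norm (abs_L2 f))\<^sup>2) \<le> ennreal (c\<^sup>2)"
    using assms nn_integral_eq_integral[of lborel "\<lambda>x. (norm (f x))\<^sup>2"]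
    by (simp add: norm_abs_L2_sq[OF f] sq_int_def)
  then show ?thesis
    using assms(2) by (simp add: power_mono_iff)
qed

lemma sq_int_bound:
  fixes f :: "'a::euclidean_space \<Rightarrow> 'b::euclidean_space" and g :: "'a \<Rightarrow> 'c::euclidean_space"
  assumes "sq_int f" "g \<in> borel_measurable borel" "\<And>x. norm (g x) \<le> C * norm (f x)"
  shows "sq_int g"
  unfolding sq_int_def
proof
  show "integrable lborel (\<lambda>x. (norm (g x))\<^sup>2)"
  proof (rule Bochner_Integration.integrable_bound)
    show "integrable lborel (\<lambda>x. C\<^sup>2 * (norm (f x))\<^sup>2)"
      using assms(1) by (simp add: sq_int_def)
    show "(\<lambda>x. (norm (g x))\<^sup>2) \<in> borel_measurable lborel"
      using assms(2) by measurable
    show "AE x in lborel. norm ((norm (g x))\<^sup>2) \<le> norm (C\<^sup>2 * (norm (f x))\<^sup>2)"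
      using assms(3) by (auto simp: power_mult_distrib[symmetric] intro!: power_mono)
  qed
qed (rule assms(2))

text \<open>Fatou's lemma with an almost everywhere limit on the left. No measurability of
  \<open>g\<close> has to be assumed, because \<open>g\<close> is replaced by the liminf before
  Fatou's lemma is applied.\<close>

lemma nn_integral_le_liminf_AE:
  fixes f :: "nat \<Rightarrow> 'a \<Rightarrow> ennreal"
  assumes "\<And>n. f n \<in> borel_measurable M" "AE x in M. (\<lambda>n. f n x) \<longlonglongrightarrow> g x"
  shows "(\<integral>\<^sup>+x. g x \<partial>M) \<le> liminf (\<lambda>n. \<integral>\<^sup>+x. f n x \<partial>M)"
proof -
  have "(\<integral>\<^sup>+x. g x \<partial>M) = (\<integral>\<^sup>+x. liminf (\<lambda>n. f n x) \<partial>M)"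
  proof (rule nn_integral_cong_AE)
    show "AE x in M. g x = liminf (\<lambda>n. f n x)"
      using assms(2) by eventually_elim (simp add: lim_imp_Liminf)
  qed
  also have "\<dots> \<le> liminf (\<lambda>n. \<integral>\<^sup>+x. f n x \<partial>M)"
    by (rule nn_integral_liminf[OF assms(1)])
  finally show ?thesis .
qed

text \<open>Norm convergence is L^1 convergence of the squared differences, which yields an almost
  everywhere convergent subsequence. Pointwise information passes to norm limits through this: the
  closedness of \<open>L2_on\<close>, the Sobolev bound, and the lower semicontinuity of convex
  integral functionals.\<close>

lemma L2_subseq_AE:
  fixes u :: "nat \<Rightarrow> ('a::euclidean_space, 'b::euclidean_space) L2"
  assumes "u \<longlonglongrightarrow> v"
  obtains r where "strict_mono r" "AE x in lborel. (\<lambda>n. rep_L2 (u (r n)) x) \<longlonglongrightarrow> rep_L2 v x"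
proof -
  let ?f = "\<lambda>n x. (norm (rep_L2 (u n - v) x))\<^sup>2"
  have "(\<lambda>n. (norm (u n - v))\<^sup>2) \<longlonglongrightarrow> 0\<^sup>2"
    using assms by (intro tendsto_power) (simp add: LIM_zero_iff tendsto_norm_zero_iff)
  then have "(\<lambda>n. \<integral>x. norm (?f n x) \<partial>lborel) \<longlonglongrightarrow> 0"
    by (simp add: norm_L2_sq)
  from tendsto_L1_AE_subseq[OF rep_L2_norm_integrable this]
  obtain r where r: "strict_mono r" "AE x in lborel. (\<lambda>n. ?f (r n) x) \<longlonglongrightarrow> 0"
    by blast
  have "AE x in lborel. \<forall>n. rep_L2 (u n - v) x = rep_L2 (u n) x - rep_L2 v x"
    by (simp add: AE_all_countable rep_minus_L2)
  with r(2) have "AE x in lborel. (\<lambda>n. rep_L2 (u (r n)) x) \<longlonglongrightarrow> rep_L2 v x"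
  proof eventually_elim
    case (elim x)
    then have "(\<lambda>n. sqrt (?f (r n) x)) \<longlonglongrightarrow> sqrt 0"
      by (intro tendsto_real_sqrt)
    then show ?case
      using elim(2) by (simp add: tendsto_norm_zero_iff LIM_zero_iff)
  qed
  with r(1) show ?thesis by (rule that)
qed

text \<open>The increments \<open>d\<close> satisfy \<open>|d\<^sub>k| \<le> 2\<^sup>-\<^sup>k + 2\<^sup>k |d\<^sub>k|\<^sup>2\<close>, so their pointwise sums converge almost
  everywhere.\<close>

lemma L2_rapidly_Cauchy_convergent:
  fixes X :: "nat \<Rightarrow> ('a::euclidean_space, 'b::euclidean_space) L2"
  assumes X: "\<And>m n. m \<le> n \<Longrightarrow> norm (X n - X m) \<le> (1/2)^m"
  shows "convergent X"
proof -
  define d where "d k = X (Suc k) - X k" for k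
  let ?g = "\<lambda>k x. ennreal (2^k * (norm (rep_L2 (d k) x))\<^sup>2)"
  have "(\<integral>\<^sup>+x. (\<Sum>k. ?g k x) \<partial>lborel) = (\<Sum>k. \<integral>\<^sup>+x. ?g k x \<partial>lborel)"
    by (rule nn_integral_suminf) measurable
  also have "\<dots> \<le> (\<Sum>k. ennreal ((1/2)^k))"
  proof (intro suminf_le allI)
    fix k
    have "(\<integral>\<^sup>+x. ?g k x \<partial>lborel) = ennreal (2^k * (norm (d k))\<^sup>2)"
      by (simp add: ennreal_mult nn_integral_cmult nn_norm_L2)
    also have "\<dots> \<le> ennreal ((1/2)^k)"
    proof (rule ennreal_leI)
      have "(norm (d k))\<^sup>2 \<le> ((1/2)^k)\<^sup>2"
        using X[of k "Suc k"] by (intro power_mono) (auto simp: d_def)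
      then have "2^k * (norm (d k))\<^sup>2 \<le> 2^k * ((1/2)^k)\<^sup>2"
        by simp
      also have "\<dots> = (1/2)^k"
        by (simp add: power2_eq_square power_divide)
      finally show "2^k * (norm (d k))\<^sup>2 \<le> (1/2)^k" .
    qed
    finally show "(\<integral>\<^sup>+x. ?g k x \<partial>lborel) \<le> ennreal ((1/2)^k)" .
  qed auto
  also have "\<dots> = ennreal (\<Sum>k. (1/2)^k)"
    by (rule suminf_ennreal2) (auto intro!: summable_geometric)
  also have "\<dots> < \<infinity>" by simp
  finally have "AE x in lborel. (\<Sum>k. ?g k x) \<noteq> \<infinity>"
    by (intro nn_integral_PInf_AE) auto
  moreover have "AE x in lborel. \<forall>k. rep_L2 (d k) x = rep_L2 (X (Suc k)) x - rep_L2 (X k) x"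
    by (simp add: AE_all_countable d_def rep_minus_L2)
  ultimately have conv: "AE x in lborel. convergent (\<lambda>n. rep_L2 (X n) x)"
  proof eventually_elim
    case (elim x)
    have s1: "summable (\<lambda>k. 2^k * (norm (rep_L2 (d k) x))\<^sup>2)"
      using elim(1) by (intro summable_suminf_not_top) auto
    have "summable (\<lambda>k. (1/2)^k + 2^k * (norm (rep_L2 (d k) x))\<^sup>2)"
      by (intro summable_add s1) (simp add: summable_geometric)
    moreover have "norm (rep_L2 (d k) x) \<le> (1/2)^k + 2^k * (norm (rep_L2 (d k) x))\<^sup>2" for k
    proof -
      let ?t = "norm (rep_L2 (d k) x)" and ?c = "(2::real)^k"
      have "t \<le> 1 / c + c * t\<^sup>2" if "c > 0" "t \<ge> 0" for c t :: real
      proof -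
        have "0 \<le> (1 - c * t)\<^sup>2 + c * t" using that by simp
        then have "c * t \<le> 1 + (c * t)\<^sup>2"
          by (simp add: power2_eq_square algebra_simps)
        with that(1) show ?thesis by (simp add: field_simps power2_eq_square)
      qed
      from this[of ?c ?t] show ?thesis by (simp add: power_divide)
    qed
    ultimately have "summable (\<lambda>k. rep_L2 (d k) x)"
      by (rule summable_comparison_test'[of _ 0])
    then have "summable (\<lambda>k. rep_L2 (X (Suc k)) x - rep_L2 (X k) x)"
      using elim(2) by simp
    then have "convergent (\<lambda>n. \<Sum>k<n. rep_L2 (X (Suc k)) x - rep_L2 (X k) x)"
      by (rule summable_iff_convergent[THEN iffD1])
    then have "convergent (\<lambda>n. rep_L2 (X n) x - rep_L2 (X 0) x)"
      by (simp only: sum_lessThan_telescope[of "\<lambda>n. rep_L2 (X n) x"])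
    from convergent_add[OF this convergent_const[of "rep_L2 (X 0) x"]] show ?case by simp
  qed
  \<comment> \<open>Where the sequence diverges, \<open>lim\<close> has an unspecified value. This
    happens on a null set only, and \<open>f\<close> is measurable all the same.\<close>
  define f where "f x = lim (\<lambda>n. rep_L2 (X n) x)" for x
  have f_meas [measurable]: "f \<in> borel_measurable borel"
    unfolding f_def by measurable
  have lim: "AE x in lborel. (\<lambda>n. rep_L2 (X n) x) \<longlonglongrightarrow> f x"
    using conv by eventually_elim (simp add: f_def convergent_LIMSEQ_iff)
  \<comment> \<open>Fatou's lemma in the second index gives two things at once: square integrability
    of \<open>f\<close> and the rate at which \<open>X m\<close> approaches it.\<close>
  have bd: "(\<integral>\<^sup>+x. ennreal ((norm (f x - rep_L2 (X m) x))\<^sup>2) \<partial>lborel) \<le> ennreal (((1/2)^m)\<^sup>2)" for m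
  proof -
    have "(\<integral>\<^sup>+x. ennreal ((norm (f x - rep_L2 (X m) x))\<^sup>2) \<partial>lborel)
        \<le> liminf (\<lambda>n. \<integral>\<^sup>+x. ennreal ((norm (rep_L2 (X n) x - rep_L2 (X m) x))\<^sup>2) \<partial>lborel)"
    proof (rule nn_integral_le_liminf_AE)
      show "AE x in lborel. (\<lambda>n. ennreal ((norm (rep_L2 (X n) x - rep_L2 (X m) x))\<^sup>2))
            \<longlonglongrightarrow> ennreal ((norm (f x - rep_L2 (X m) x))\<^sup>2)"
        using lim by eventually_elim (intro tendsto_intros)
    qed measurable
    also have "\<dots> \<le> ennreal (((1/2)^m)\<^sup>2)"
    proof (rule Liminf_le)
      show "\<forall>\<^sub>F n in sequentially. (\<integral>\<^sup>+x. ennreal ((norm (rep_L2 (X n) x - rep_L2 (X m) x))\<^sup>2) \<partial>lborel)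
          \<le> ennreal (((1/2)^m)\<^sup>2)"
        using eventually_ge_at_top[of m]
      proof eventually_elim
        case (elim n)
        have "(\<integral>\<^sup>+x. ennreal ((norm (rep_L2 (X n) x - rep_L2 (X m) x))\<^sup>2) \<partial>lborel)
          = (\<integral>\<^sup>+x. ennreal ((norm (rep_L2 (X n - X m) x))\<^sup>2) \<partial>lborel)"
          using rep_minus_L2[of "X n" "X m"] by (intro nn_integral_cong_AE) auto
        also have "\<dots> \<le> ennreal (((1/2)^m)\<^sup>2)"
          unfolding nn_norm_L2 by (intro ennreal_leI power_mono X[OF elim]) auto
        finally show ?case .
      qed
    qed auto
    finally show ?thesis .
  qed
  have sqd: "sq_int (\<lambda>x. f x - rep_L2 (X m) x)" for m
    using bd[of m] by (intro sq_intI_nn) (auto intro: le_less_trans)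
  have sqf: "sq_int f"
    using sq_int_add[OF sqd[of 0] sq_int_rep_L2[of "X 0"]] by simp
  have nm: "norm (abs_L2 f - X m) \<le> (1/2)^m" for m
    using norm_abs_L2_le[OF sqd _ bd, of m] minus_abs_L2[OF sqf sq_int_rep_L2[of "X m"]]
    by (simp add: abs_rep_L2)
  have "(\<lambda>m. norm (X m - abs_L2 f)) \<longlonglongrightarrow> 0"
  proof (rule tendsto_sandwich[OF _ _ tendsto_const])
    show "(\<lambda>m. (1/2)^m) \<longlonglongrightarrow> (0::real)" by (rule LIMSEQ_power_zero) simp
  qed (auto simp: nm norm_minus_commute)
  then have "X \<longlonglongrightarrow> abs_L2 f"
    by (simp add: tendsto_norm_zero_iff LIM_zero_iff)
  then show ?thesis by (rule convergentI)
qed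

lemma L2_Cauchy_convergent:
  fixes X :: "nat \<Rightarrow> ('a::euclidean_space, 'b::euclidean_space) L2"
  assumes "Cauchy X"
  shows "convergent X"
proof -
  have "\<forall>k. \<exists>M. \<forall>m\<ge>M. \<forall>n\<ge>M. norm (X m - X n) < (1/2)^k"
    using assms by (simp add: Cauchy_iff)
  then obtain M where M: "\<And>k m n. m \<ge> M k \<Longrightarrow> n \<ge> M k \<Longrightarrow> norm (X m - X n) < (1/2)^k"
    by metis
  \<comment> \<open>The summand \<open>k\<close> makes \<open>r\<close> strictly increasing, and the
    sum of all earlier thresholds gives \<open>r k \<ge> M k\<close> without \<open>M\<close> being
    monotone.\<close>
  define r where "r k = k + (\<Sum>j\<le>k. M j)" for k
  have r: "strict_mono r"
    by (intro strict_mono_Suc_iff[THEN iffD2]) (simp add: r_def)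
  have rM: "r k \<ge> M k" for k
    unfolding r_def using member_le_sum[of k "{..k}" M] by simp
  have "norm ((X \<circ> r) n - (X \<circ> r) m) \<le> (1/2)^m" if "m \<le> n" for m n
    using M[of m "r n" "r m"] rM[of m] strict_mono_leD[OF r that] by simp
  from L2_rapidly_Cauchy_convergent[OF this]
  obtain L where "(X \<circ> r) \<longlonglongrightarrow> L" unfolding convergent_def by blast
  from Cauchy_converges_subseq[OF assms r this] show ?thesis by (rule convergentI)
qed

section \<open>Classes that vanish off a set\<close>

lemma L2_on_iff: "u \<in> L2_on D \<longleftrightarrow> (AE x in lborel. x \<notin> D \<longrightarrow> rep_L2 u x = 0)"
  by (simp add: L2_on_def)

lemma add_in_L2_on:
  assumes "u \<in> L2_on D" "v \<in> L2_on D"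
  shows "u + v \<in> L2_on D"
  using assms rep_plus_L2[of u v] unfolding L2_on_iff by eventually_elim simp

lemma scaleR_in_L2_on:
  assumes "u \<in> L2_on D"
  shows "c *\<^sub>R u \<in> L2_on D"
  using assms rep_scaleR_L2[of c u] unfolding L2_on_iff by eventually_elim simp

lemma diff_in_L2_on: "u \<in> L2_on D \<Longrightarrow> v \<in> L2_on D \<Longrightarrow> u - v \<in> L2_on D"
  using add_in_L2_on[of u D "(-1) *\<^sub>R v"] scaleR_in_L2_on[of v D "-1"] by simp

lemma abs_in_L2_on: "sq_int f \<Longrightarrow> (\<And>x. x \<notin> D \<Longrightarrow> f x = 0) \<Longrightarrow> abs_L2 f \<in> L2_on D"
  unfolding L2_on_iff using rep_abs_L2[of f] by auto

lemma L2_on_limit: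
  assumes "\<And>n. u n \<in> L2_on D" "u \<longlonglongrightarrow> v"
  shows "v \<in> L2_on D"
proof -
  from assms(2) obtain r where r: "AE x in lborel. (\<lambda>n. rep_L2 (u (r n)) x) \<longlonglongrightarrow> rep_L2 v x"
    by (rule L2_subseq_AE)
  have "AE x in lborel. \<forall>n. x \<notin> D \<longrightarrow> rep_L2 (u n) x = 0"
    using assms(1) unfolding L2_on_iff by (subst AE_all_countable) blast
  with r show ?thesis
    unfolding L2_on_iff
  proof eventually_elim
    case (elim x)
    show ?case
    proof
      assume "x \<notin> D"
      with elim have "(\<lambda>n. 0) \<longlonglongrightarrow> rep_L2 v x" by simp
      then show "rep_L2 v x = 0" by (metis LIMSEQ_unique tendsto_const)
    qed
  qed
qed

section \<open>Test functions\<close>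

text \<open>\<open>C_k\<close> is formulated with the choice term \<open>frechet_derivative\<close>.
  This rule replaces it by any explicitly known derivative.\<close>

lemma C_k_SucI:
  assumes "\<And>x. (f has_derivative f' x) (at x)" "\<And>e. C_k k (\<lambda>x. f' x e)"
  shows "C_k (Suc k) f"
proof -
  have "frechet_derivative f (at x) = f' x" for x
    using frechet_derivative_at[OF assms(1)] by simp
  with assms show ?thesis
    by (auto simp: differentiable_def)
qed

lemma C_k_Suc_has_derivative:
  "C_k (Suc k) f \<Longrightarrow> (f has_derivative frechet_derivative f (at x)) (at x)"
  by (simp add: frechet_derivative_works)

lemma C_k_SucD: "C_k (Suc k) f \<Longrightarrow> C_k k f"
proof (induction k arbitrary: f)
  case 0
  then show ?case
    by (auto intro!: differentiable_imp_continuous_on simp: differentiable_on_def)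
next
  case (Suc k)
  then show ?case by simp
qed

lemma C_k_const: "C_k k (\<lambda>x::'a::euclidean_space. c)"
proof (induction k arbitrary: c)
  case (Suc k)
  show ?case by (rule C_k_SucI[where f' = "\<lambda>_ _. 0"]) (auto intro: Suc)
qed simp

lemma C_k_inner: "C_k k (\<lambda>x. x \<bullet> e)"
proof (cases k)
  case (Suc m)
  show ?thesis unfolding Suc
    by (rule C_k_SucI[where f' = "\<lambda>_ h. h \<bullet> e"]) (auto intro!: derivative_eq_intros C_k_const)
qed (auto intro!: continuous_intros)

lemma C_k_add: "C_k k f \<Longrightarrow> C_k k g \<Longrightarrow> C_k k (\<lambda>x. f x + g x)"
proof (induction k arbitrary: f g)
  case (Suc k)
  show ?case
  proof (rule C_k_SucI)
    show "((\<lambda>x. f x + g x) has_derivative (\<lambda>h. frechet_derivative f (at x) h + frechet_derivative g (at x) h)) (at x)" for x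
      by (intro has_derivative_add C_k_Suc_has_derivative[OF Suc.prems(1)] C_k_Suc_has_derivative[OF Suc.prems(2)])
    show "C_k k (\<lambda>x. frechet_derivative f (at x) e + frechet_derivative g (at x) e)" for e
      using Suc.prems by (intro Suc.IH) auto
  qed
qed (simp add: continuous_on_add)

lemma C_k_mult: "C_k k f \<Longrightarrow> C_k k g \<Longrightarrow> C_k k (\<lambda>x. f x * g x)"
proof (induction k arbitrary: f g)
  case (Suc k)
  show ?case
  proof (rule C_k_SucI)
    show "((\<lambda>x. f x * g x) has_derivative (\<lambda>h. f x * frechet_derivative g (at x) h + frechet_derivative f (at x) h * g x)) (at x)" for x
      by (intro has_derivative_mult C_k_Suc_has_derivative[OF Suc.prems(1)] C_k_Suc_has_derivative[OF Suc.prems(2)])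
    have "C_k k f" "C_k k g" using C_k_SucD[OF Suc.prems(1)] C_k_SucD[OF Suc.prems(2)] by auto
    then show "C_k k (\<lambda>x. f x * frechet_derivative g (at x) e + frechet_derivative f (at x) e * g x)" for e
      using Suc.prems by (intro C_k_add Suc.IH) auto
  qed
qed (simp add: continuous_on_mult)

lemma C_k_prod: "finite I \<Longrightarrow> (\<And>i. i \<in> I \<Longrightarrow> C_k k (f i)) \<Longrightarrow> C_k k (\<lambda>x. \<Prod>i\<in>I. f i x)"
  by (induction I rule: finite_induct) (auto intro: C_k_const C_k_mult)

lemma C_k_power: "C_k k f \<Longrightarrow> C_k k (\<lambda>x. f x ^ n)"
  by (induction n) (auto intro: C_k_const C_k_mult)

text \<open>The flat function exp(-1/t) on the positive half line, divided by a power of t. The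
  division makes the family closed under differentiation: the derivative of member \<open>j\<close>
  combines members \<open>j + 2\<close> and \<open>j + 1\<close>, so smoothness of all members
  follows by one induction.\<close>

definition bump :: "nat \<Rightarrow> real \<Rightarrow> real" where
  "bump j t = (if t > 0 then exp (- 1 / t) / t ^ j else 0)"

lemma bump_DERIV: "(bump j has_field_derivative bump (j + 2) t - real j * bump (j + 1) t) (at t)"
proof -
  consider "t > 0" | "t < 0" | "t = 0" by linarith
  then show ?thesis
  proof cases
    case 1
    have "((\<lambda>t. exp (- inverse t) * inverse t ^ j) has_field_derivative
        exp (- inverse t) * (inverse t * inverse t) * inverse t ^ j
        - real j * (exp (- inverse t) * inverse t ^ Suc j)) (at t)"
    proof -
      have i: "(inverse has_field_derivative - (inverse t * inverse t)) (at t)"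
        using 1 DERIV_inverse[of t] by (simp add: power2_eq_square)
      show ?thesis
        using DERIV_mult[OF DERIV_fun_exp[OF DERIV_minus[OF i]] DERIV_power[OF i, of j]]
        by (cases j) (auto simp: algebra_simps)
    qed
    then have "((\<lambda>t. exp (- inverse t) * inverse t ^ j) has_field_derivative
        bump (j + 2) t - real j * bump (j + 1) t) (at t)"
      using 1 by (simp add: bump_def divide_inverse power_inverse mult_ac)
    then show ?thesis
      by (rule has_field_derivative_transform_within_open[where S = "{0<..}"]) (use 1 in \<open>auto simp: bump_def divide_inverse power_inverse\<close>)
  next
    case 2
    have "((\<lambda>t. 0) has_field_derivative 0) (at t)" by simp
    then have "(bump j has_field_derivative 0) (at t)"
      by (rule has_field_derivative_transform_within_open[where S = "{..<0}"]) (use 2 in \<open>auto simp: bump_def\<close>)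
    with 2 show ?thesis by (simp add: bump_def)
  next
    case 3
    \<comment> \<open>From the right, the substitution s = 1/h turns the difference quotient at 0
      into s^(j+1) / exp s. From the left it is identically 0.\<close>
    have "((\<lambda>h. bump j h / h) \<longlongrightarrow> 0) (at_right 0)"
    proof -
      have "((\<lambda>s::real. s ^ (j + 1) / exp s) \<longlongrightarrow> 0) at_top"
        by (rule tendsto_power_div_exp_0)
      then have "((\<lambda>h::real. inverse h ^ (j + 1) / exp (inverse h)) \<longlongrightarrow> 0) (at_right 0)"
        by (rule filterlim_compose[OF _ filterlim_inverse_at_top_right])
      then show ?thesis
      proof (rule Lim_transform_eventually)
        show "\<forall>\<^sub>F h in at_right 0. inverse h ^ (j + 1) / exp (inverse h) = bump j h / h"
          by (rule eventually_at_right_less[THEN eventually_mono])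
             (simp add: bump_def field_simps exp_minus)
      qed
    qed
    moreover have "((\<lambda>h. bump j h / h) \<longlongrightarrow> 0) (at_left 0)"
      by (rule Lim_transform_eventually[OF tendsto_const])
         (auto simp: bump_def eventually_at_left_field intro!: exI[of _ "-1"])
    ultimately have "((\<lambda>h. bump j h / h) \<longlongrightarrow> 0) (at 0)"
      by (simp add: filterlim_split_at)
    then show ?thesis
      using 3 by (simp add: has_field_derivative_iff bump_def)
  qed
qed

lemma C_k_bump: "C_k k (\<lambda>x. bump j (c * (x \<bullet> e) + a))"
proof (induction k arbitrary: j)
  case 0
  have "isCont (bump j) t" for t
    using bump_DERIV by (rule DERIV_isCont)
  then have "continuous_on UNIV (bump j)"
    by (simp add: continuous_at_imp_continuous_on)
  then show ?case
    by (auto intro!: continuous_on_compose2[of UNIV "bump j" UNIV "\<lambda>x. c * (x \<bullet> e) + a"] continuous_intros)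
next
  case (Suc k)
  show ?case
  proof (rule C_k_SucI)
    let ?l = "\<lambda>x. c * (x \<bullet> e) + a"
    show "((\<lambda>x. bump j (?l x)) has_derivative
        (\<lambda>h. (bump (j + 2) (?l x) + (- real j) * bump (j + 1) (?l x)) * (c * (h \<bullet> e)))) (at x)" for x
    proof -
      have l: "(?l has_derivative (\<lambda>h. c * (h \<bullet> e))) (at x)"
        by (auto intro!: derivative_eq_intros)
      show ?thesis
        using has_derivative_compose[OF l bump_DERIV[of j "?l x", unfolded has_field_derivative_def]]
        by simp
    qed
    show "C_k k (\<lambda>x. (bump (j + 2) (?l x) + (- real j) * bump (j + 1) (?l x)) * (c * (h \<bullet> e)))" for h
      by (intro C_k_mult C_k_add C_k_const Suc)
  qed
qed

section \<open>Calculus of test functions\<close>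

lemma test_functionsD:
  assumes "\<phi> \<in> test_functions D"
  shows "C_k k \<phi>" "(\<phi> has_derivative frechet_derivative \<phi> (at x)) (at x)"
    "continuous_on UNIV \<phi>" "continuous_on UNIV (\<lambda>x. frechet_derivative \<phi> (at x) e)"
proof -
  show *: "C_k k \<phi>" for k using assms by (simp add: test_functions_def)
  show "(\<phi> has_derivative frechet_derivative \<phi> (at x)) (at x)"
    using *[of 1] C_k_Suc_has_derivative[of 0] by simp
  show "continuous_on UNIV \<phi>" using *[of 0] by simp
  show "continuous_on UNIV (\<lambda>x. frechet_derivative \<phi> (at x) e)" using *[of 1] by simp
qed

lemma test_functions_zero_off:
  assumes "\<phi> \<in> test_functions D"
  shows "x \<notin> closure {x. \<phi> x \<noteq> 0} \<Longrightarrow> \<phi> x = 0"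
    and "x \<notin> closure {x. \<phi> x \<noteq> 0} \<Longrightarrow> frechet_derivative \<phi> (at x) e = 0"
proof -
  define K where "K = closure {x. \<phi> x \<noteq> 0}"
  assume "x \<notin> closure {x. \<phi> x \<noteq> 0}"
  then have x: "x \<notin> K" by (simp add: K_def)
  have z: "\<phi> y = 0" if "y \<notin> K" for y
    using that closure_subset[of "{x. \<phi> x \<noteq> 0}"] unfolding K_def by blast
  from z[OF x] show "\<phi> x = 0" .
  have "((\<lambda>_. 0) has_derivative (\<lambda>_. 0)) (at x)" by simp
  then have "(\<phi> has_derivative (\<lambda>_. 0)) (at x)"
  proof (rule has_derivative_transform_within_open[where s = "- K"])
    show "open (- K)" by (simp add: K_def open_Compl)
  qed (use x z in auto)
  from frechet_derivative_at[OF this, symmetric] show "frechet_derivative \<phi> (at x) e = 0"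
    by simp
qed

lemma test_functionsI:
  assumes "\<And>k. C_k k f" "compact K" "K \<subseteq> D" "\<And>x. x \<notin> K \<Longrightarrow> f x = 0"
  shows "f \<in> test_functions D"
proof -
  have s: "closure {x. f x \<noteq> 0} \<subseteq> K"
    using assms(2,4) by (intro closure_minimal compact_imp_closed) auto
  moreover have "compact (closure {x. f x \<noteq> 0})"
    using compact_Int_closed[OF assms(2) closed_closure] s by (metis inf.absorb_iff2)
  ultimately show ?thesis
    using assms by (auto simp: test_functions_def)
qed

lemma test_functionsE:
  assumes "f \<in> test_functions D"
  obtains K where "compact K" "K \<subseteq> D" "\<And>x. x \<notin> K \<Longrightarrow> f x = 0"
    "\<And>x e. x \<notin> K \<Longrightarrow> frechet_derivative f (at x) e = 0"
proof (rule that[of "closure {x. f x \<noteq> 0}"])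
  show "compact (closure {x. f x \<noteq> 0})" "closure {x. f x \<noteq> 0} \<subseteq> D"
    using assms by (auto simp: test_functions_def)
qed (rule test_functions_zero_off[OF assms], assumption)+

lemma test_functions_zero_outside:
  assumes "f \<in> test_functions D" "x \<notin> D"
  shows "f x = 0" "frechet_derivative f (at x) e = 0"
  using assms by (meson test_functionsE subsetD)+

lemma test_functions_deriv:
  assumes "f \<in> test_functions D"
  shows "(\<lambda>x. frechet_derivative f (at x) e) \<in> test_functions D"
proof -
  obtain K where "compact K" "K \<subseteq> D" "\<And>x. x \<notin> K \<Longrightarrow> frechet_derivative f (at x) e = 0"
    using test_functionsE[OF assms] by metis
  moreover have "C_k k (\<lambda>x. frechet_derivative f (at x) e)" for k
    using test_functionsD(1)[OF assms, of "Suc k"] by simp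
  ultimately show ?thesis by (intro test_functionsI)
qed

lemma test_functions_mult:
  assumes "f \<in> test_functions D" "\<And>k. C_k k g"
  shows "(\<lambda>x. g x * f x) \<in> test_functions D"
proof -
  obtain K where "compact K" "K \<subseteq> D" "\<And>x. x \<notin> K \<Longrightarrow> f x = 0"
    using test_functionsE[OF assms(1)] by metis
  then show ?thesis
    by (intro test_functionsI[of _ K] C_k_mult assms(2) test_functionsD(1)[OF assms(1)]) auto
qed

lemma test_functions_add:
  assumes "f \<in> test_functions D" "g \<in> test_functions D"
  shows "(\<lambda>x. f x + g x) \<in> test_functions D"
proof -
  obtain K where K: "compact K" "K \<subseteq> D" "\<And>x. x \<notin> K \<Longrightarrow> f x = 0"
    using test_functionsE[OF assms(1)] by metis
  obtain K' where K': "compact K'" "K' \<subseteq> D" "\<And>x. x \<notin> K' \<Longrightarrow> g x = 0"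
    using test_functionsE[OF assms(2)] by metis
  from K K' show ?thesis
    by (intro test_functionsI[of _ "K \<union> K'"] C_k_add test_functionsD(1)[OF assms(1)]
          test_functionsD(1)[OF assms(2)]) auto
qed

lemma test_functions_scale: "f \<in> test_functions D \<Longrightarrow> (\<lambda>x. c * f x) \<in> test_functions D"
  by (intro test_functions_mult C_k_const)

lemma test_functions_power:
  assumes "f \<in> test_functions D" "n \<noteq> 0"
  shows "(\<lambda>x. f x ^ n) \<in> test_functions D"
proof -
  obtain m where "n = Suc m" using assms(2) by (cases n) auto
  then show ?thesis
    using test_functions_mult[OF assms(1) C_k_power[OF test_functionsD(1)[OF assms(1)]], of m]
    by (simp add: mult.commute)
qed

lemma integrable_compact_support:
  fixes f :: "'a::euclidean_space \<Rightarrow> real"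
  assumes "continuous_on UNIV f" "compact K" "\<And>x. x \<notin> K \<Longrightarrow> f x = 0"
  shows "integrable lborel f"
proof -
  have "integrable lborel (\<lambda>x. indicator K x *\<^sub>R f x)"
    using assms continuous_on_subset by (intro borel_integrable_compact) blast+
  also have "(\<lambda>x. indicator K x *\<^sub>R f x) = f"
    using assms(3) by (auto simp: fun_eq_iff indicator_def)
  finally show ?thesis .
qed

lemma sq_int_compact_support:
  fixes f :: "'a::euclidean_space \<Rightarrow> real"
  assumes "continuous_on UNIV f" "compact K" "\<And>x. x \<notin> K \<Longrightarrow> f x = 0"
  shows "sq_int f"
  unfolding sq_int_def using assms
  by (auto intro!: borel_measurable_continuous_onI integrable_compact_support continuous_intros)

lemma test_functions_sq_int: "f \<in> test_functions D \<Longrightarrow> sq_int f"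
  by (meson test_functionsE test_functionsD(3) sq_int_compact_support)

lemma test_functions_measurable: "f \<in> test_functions D \<Longrightarrow> f \<in> borel_measurable borel"
  by (intro borel_measurable_continuous_onI test_functionsD(3))

lemma test_functions_in_L2_on: "f \<in> test_functions D \<Longrightarrow> abs_L2 f \<in> L2_on D"
  by (intro abs_in_L2_on test_functions_sq_int test_functions_zero_outside(1))

lemma test_functions_integrable: "f \<in> test_functions D \<Longrightarrow> integrable lborel f"
  by (meson test_functionsE test_functionsD(3) integrable_compact_support)

section \<open>Translations, difference quotients and integration by parts\<close>

lemma lborel_integral_translate:
  fixes f :: "'a::euclidean_space \<Rightarrow> real"
  assumes "f \<in> borel_measurable borel"
  shows "(\<integral>x. f (c + x) \<partial>lborel) = (\<integral>x. f x \<partial>lborel)"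
proof -
  have "(\<integral>x. f x \<partial>lborel) = (\<integral>x. f x \<partial>distr lborel borel ((+) c))"
    by (simp add: lborel_distr_plus)
  also have "\<dots> = (\<integral>x. f (c + x) \<partial>lborel)"
    using assms by (subst integral_distr) auto
  finally show ?thesis by simp
qed

lemma lborel_integrable_translate:
  fixes f :: "'a::euclidean_space \<Rightarrow> real"
  assumes "integrable lborel f"
  shows "integrable lborel (\<lambda>x. f (c + x))"
proof -
  have "integrable (distr lborel borel ((+) c)) f"
    using assms by (simp add: lborel_distr_plus)
  then show ?thesis
    by (subst (asm) integrable_distr_eq) (use assms in auto)
qed

lemma difference_quotient_tendsto:
  fixes f :: "'a::euclidean_space \<Rightarrow> real"
  assumes "(f has_derivative f') (at x)" "h \<longlonglongrightarrow> 0" "\<And>n. h n \<noteq> (0::real)"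
  shows "(\<lambda>n. (f (h n *\<^sub>R e + x) - f x) / h n) \<longlonglongrightarrow> f' e"
proof -
  have "((\<lambda>t. f (t *\<^sub>R e + x)) has_derivative (\<lambda>t. f' (t *\<^sub>R e))) (at 0)"
    by (rule has_derivative_compose[of "\<lambda>t. t *\<^sub>R e + x" "\<lambda>t. t *\<^sub>R e" 0 UNIV f f'])
       (auto intro!: derivative_eq_intros simp: assms)
  moreover have "f' (t *\<^sub>R e) = f' e * t" for t
    using has_derivative_linear[OF assms(1)] by (simp add: linear_cmul)
  ultimately have "((\<lambda>t. f (t *\<^sub>R e + x)) has_field_derivative f' e) (at 0)"
    by (simp add: has_field_derivative_def)
  then have "((\<lambda>t. (f (t *\<^sub>R e + x) - f x) / t) \<longlongrightarrow> f' e) (at 0)"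
    by (simp add: has_field_derivative_iff)
  then show ?thesis
    by (rule filterlim_compose) (simp add: filterlim_at assms)
qed

lemma test_function_derivative_bounded:
  assumes f: "f \<in> test_functions D"
  obtains M where "M \<ge> 0" "\<And>x. \<bar>frechet_derivative f (at x) e\<bar> \<le> M"
proof -
  obtain K where K: "compact K" "\<And>x. x \<notin> K \<Longrightarrow> frechet_derivative f (at x) e = 0"
    using test_functionsE[OF f] by metis
  have "compact ((\<lambda>x. frechet_derivative f (at x) e) ` K)"
    by (intro compact_continuous_image continuous_on_subset[OF test_functionsD(4)[OF f]] K(1)) simp
  then obtain M where M: "\<And>x. x \<in> K \<Longrightarrow> norm (frechet_derivative f (at x) e) \<le> M"
    by (meson bounded_iff compact_imp_bounded imageI)
  show ?thesis
  proof (rule that[of "max M 0"])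
    show "\<bar>frechet_derivative f (at x) e\<bar> \<le> max M 0" for x
      using M[of x] K(2)[of x] by (cases "x \<in> K") auto
  qed simp
qed

text \<open>Supplies the majorant for dominated convergence. The mean value inequality bounds the
  quotient by \<open>M\<close>, and for \<open>\<bar>h\<bar> \<le> 1\<close> both \<open>x\<close>
  and \<open>h *\<^sub>R e + x\<close> lie outside the support once \<open>x\<close> is farther from
  0 than the support by more than \<open>norm e\<close>.\<close>

lemma difference_quotient_bound:
  assumes f: "f \<in> test_functions D"
  obtains M R where "M \<ge> 0"
    "\<And>x h. \<bar>h\<bar> \<le> 1 \<Longrightarrow> h \<noteq> 0 \<Longrightarrow> \<bar>(f (h *\<^sub>R e + x) - f x) / h\<bar> \<le> M * indicator (cball 0 R) x"
proof -
  obtain M where M: "M \<ge> 0" "\<And>x. \<bar>frechet_derivative f (at x) e\<bar> \<le> M"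
    using test_function_derivative_bounded[OF f] by metis
  obtain K where K: "compact K" "\<And>x. x \<notin> K \<Longrightarrow> f x = 0"
    using test_functionsE[OF f] by metis
  obtain R where R: "\<And>x. x \<in> K \<Longrightarrow> norm x \<le> R"
    using K(1) by (meson bounded_iff compact_imp_bounded)
  have "\<bar>(f (h *\<^sub>R e + x) - f x) / h\<bar> \<le> M * indicator (cball 0 (R + norm e)) x" if h: "\<bar>h\<bar> \<le> 1" "h \<noteq> 0" for x h
  proof (cases "norm x \<le> R + norm e")
    case True
    have "norm ((\<lambda>t. f (t *\<^sub>R e + x)) h - (\<lambda>t. f (t *\<^sub>R e + x)) 0) \<le> M * norm (h - 0)"
    proof (rule differentiable_bound[of UNIV _ "\<lambda>t s. frechet_derivative f (at (t *\<^sub>R e + x)) (s *\<^sub>R e)"])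
      fix t :: real
      show "((\<lambda>t. f (t *\<^sub>R e + x)) has_derivative (\<lambda>s. frechet_derivative f (at (t *\<^sub>R e + x)) (s *\<^sub>R e))) (at t within UNIV)"
        by (rule has_derivative_compose[of "\<lambda>t. t *\<^sub>R e + x" "\<lambda>t. t *\<^sub>R e" t UNIV f])
           (auto intro!: derivative_eq_intros test_functionsD(2)[OF f])
      have "norm (frechet_derivative f (at (t *\<^sub>R e + x)) (s *\<^sub>R e)) \<le> M * norm s" for s
        using mult_right_mono[OF M(2)[of "t *\<^sub>R e + x"], of "\<bar>s\<bar>"]
          linear_cmul[OF has_derivative_linear[OF test_functionsD(2)[OF f, of "t *\<^sub>R e + x"]], of s e]
        by (simp add: abs_mult mult.commute)
      then show "onorm (\<lambda>s. frechet_derivative f (at (t *\<^sub>R e + x)) (s *\<^sub>R e)) \<le> M"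
        by (intro onorm_bound M(1))
    qed auto
    then show ?thesis using True h
      by (simp add: field_simps abs_divide)
  next
    case False
    have "norm (h *\<^sub>R e + x) > R" "norm x > R"
    proof -
      have "norm (h *\<^sub>R e) \<le> norm e" using h(1) by (simp add: mult_left_le_one_le)
      then show "norm (h *\<^sub>R e + x) > R"
        using False norm_triangle_ineq2[of x "- (h *\<^sub>R e)"] by (simp add: add.commute)
      show "norm x > R" using False norm_ge_zero[of e] by linarith
    qed
    then have "f (h *\<^sub>R e + x) = 0" "f x = 0"
      using R K(2) by (meson not_le)+
    then show ?thesis using False by simp
  qed
  with M(1) show ?thesis by (rule that)
qed

text \<open>Local integrability of the weight is enough, because all quotients live in one common
  ball. The weight 1 gives the vanishing integral of a derivative; a cut-off product with a
  Lipschitz function is the weight in \<open>product_difference_bound\<close>.\<close>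

lemma difference_quotient_integral:
  fixes w :: "'a::euclidean_space \<Rightarrow> real"
  assumes f: "f \<in> test_functions D" and h: "h \<longlonglongrightarrow> 0" "\<And>n. h n \<noteq> (0::real)" "\<And>n. \<bar>h n\<bar> \<le> 1"
    and w: "w \<in> borel_measurable borel" "\<And>R. integrable lborel (\<lambda>x. w x * indicator (cball 0 R) x)"
  shows "(\<lambda>n. \<integral>x. w x * ((f (h n *\<^sub>R e + x) - f x) / h n) \<partial>lborel)
     \<longlonglongrightarrow> (\<integral>x. w x * frechet_derivative f (at x) e \<partial>lborel)"
proof -
  obtain M R where M: "M \<ge> 0"
    "\<And>x h. \<bar>h\<bar> \<le> 1 \<Longrightarrow> h \<noteq> 0 \<Longrightarrow> \<bar>(f (h *\<^sub>R e + x) - f x) / h\<bar> \<le> M * indicator (cball 0 R) x"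
    using difference_quotient_bound[OF f] by metis
  note [measurable] = w(1) test_functions_measurable[OF f] test_functions_measurable[OF test_functions_deriv[OF f]]
  show ?thesis
  proof (rule integral_dominated_convergence[where w = "\<lambda>x. M * \<bar>w x * indicator (cball 0 R) x\<bar>"])
    show "integrable lborel (\<lambda>x. M * \<bar>w x * indicator (cball 0 R) x\<bar>)"
      using w(2) by (intro integrable_mult_right integrable_abs)
    show "AE x in lborel. (\<lambda>n. w x * ((f (h n *\<^sub>R e + x) - f x) / h n)) \<longlonglongrightarrow> w x * frechet_derivative f (at x) e"
      by (intro AE_I2 tendsto_intros difference_quotient_tendsto[OF test_functionsD(2)[OF f] h(1,2)])
    show "AE x in lborel. norm (w x * ((f (h n *\<^sub>R e + x) - f x) / h n)) \<le> M * \<bar>w x * indicator (cball 0 R) x\<bar>" for n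
      using mult_left_mono[OF M(2)[OF h(3)[of n] h(2)[of n]], of "\<bar>w x\<bar>" for x]
      by (intro AE_I2) (auto simp: abs_mult ac_simps)
  qed measurable
qed

text \<open>By translation invariance the integral of each difference quotient is 0, and the
  derivative is their dominated limit.\<close>

lemma integral_derivative_zero:
  fixes f :: "'a::euclidean_space \<Rightarrow> real"
  assumes f: "f \<in> test_functions D"
  shows "(\<integral>x. frechet_derivative f (at x) e \<partial>lborel) = 0"
proof -
  define h :: "nat \<Rightarrow> real" where "h n = 1 / Suc n" for n
  have h: "h \<longlonglongrightarrow> 0" unfolding h_def using LIMSEQ_Suc[OF lim_1_over_n] by simp
  have "(\<lambda>n. \<integral>x. 1 * ((f (h n *\<^sub>R e + x) - f x) / h n) \<partial>lborel)
     \<longlonglongrightarrow> (\<integral>x. 1 * frechet_derivative f (at x) e \<partial>lborel)"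
    by (rule difference_quotient_integral[OF f h]) (auto simp: h_def intro!: integrable_real_indicator emeasure_lborel_cball_finite)
  moreover have "(\<integral>x. 1 * ((f (h n *\<^sub>R e + x) - f x) / h n) \<partial>lborel) = 0" for n
    using lborel_integral_translate[of f "h n *\<^sub>R e"] test_functions_integrable[OF f]
      lborel_integrable_translate[of f "h n *\<^sub>R e"]
    by simp
  ultimately have "(\<lambda>n. 0) \<longlonglongrightarrow> (\<integral>x. frechet_derivative f (at x) e \<partial>lborel)"
    by (simp only: mult_1)
  then show ?thesis by (metis LIMSEQ_unique tendsto_const)
qed

lemma frechet_derivative_mult_real:
  fixes f g :: "'a::euclidean_space \<Rightarrow> real"
  assumes "(f has_derivative f') (at x)" "(g has_derivative g') (at x)"
  shows "frechet_derivative (\<lambda>x. f x * g x) (at x) e = f x * g' e + f' e * g x"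
  using frechet_derivative_at[OF has_derivative_mult[OF assms], symmetric] by simp

lemma frechet_derivative_power_real:
  fixes f :: "'a::euclidean_space \<Rightarrow> real"
  assumes "(f has_derivative f') (at x)"
  shows "frechet_derivative (\<lambda>x. f x ^ n) (at x) e = real n * f x ^ (n - 1) * f' e"
  using frechet_derivative_at[OF has_derivative_power[OF assms, of n], symmetric]
  by (simp add: mult_ac)

text \<open>Compact support of \<open>f\<close> suffices, since the product inherits it. This
  freedom is needed for the Poincare inequality, where \<open>g\<close> is a coordinate
  function.\<close>

lemma integration_by_parts:
  assumes f: "f \<in> test_functions D" and g: "\<And>k. C_k k g"
  shows "(\<integral>x. g x * frechet_derivative f (at x) e \<partial>lborel)
     = - (\<integral>x. frechet_derivative g (at x) e * f x \<partial>lborel)"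
proof -
  have g': "C_k k (\<lambda>x. frechet_derivative g (at x) e)" for k
    using g[of "Suc k"] by simp
  have "0 = (\<integral>x. frechet_derivative (\<lambda>x. g x * f x) (at x) e \<partial>lborel)"
    using integral_derivative_zero[OF test_functions_mult[OF f g]] by simp
  also have "\<dots> = (\<integral>x. g x * frechet_derivative f (at x) e + frechet_derivative g (at x) e * f x \<partial>lborel)"
    by (simp add: frechet_derivative_mult_real[OF C_k_Suc_has_derivative[OF g] test_functionsD(2)[OF f]])
  also have "\<dots> = (\<integral>x. g x * frechet_derivative f (at x) e \<partial>lborel) + (\<integral>x. frechet_derivative g (at x) e * f x \<partial>lborel)"
    by (intro Bochner_Integration.integral_add test_functions_integrable[OF test_functions_mult[OF f g']]
         test_functions_integrable[OF test_functions_mult[OF test_functions_deriv[OF f] g]])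
  finally show ?thesis by simp
qed

section \<open>Weak gradients\<close>

definition box_bump :: "'a::euclidean_space \<Rightarrow> 'a \<Rightarrow> nat \<Rightarrow> 'a \<Rightarrow> real" where
  "box_bump c d n x = (\<Prod>b\<in>Basis. bump 0 (real (Suc n) * (x \<bullet> b) + (- real (Suc n) * (c \<bullet> b)))
     * bump 0 (- real (Suc n) * (x \<bullet> b) + real (Suc n) * (d \<bullet> b)))"

lemma bump_0_bounds: "0 \<le> bump 0 t" "bump 0 t \<le> 1"
  by (auto simp: bump_def)

lemma box_bump_bounds: "0 \<le> box_bump c d n x" "box_bump c d n x \<le> 1"
  unfolding box_bump_def
  by (auto intro!: prod_nonneg prod_le_1 mult_nonneg_nonneg mult_le_one simp: bump_0_bounds)

lemma box_bump_zero:
  assumes "x \<notin> box c d"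
  shows "box_bump c d n x = 0"
proof -
  obtain b where b: "b \<in> Basis" "x \<bullet> b \<le> c \<bullet> b \<or> d \<bullet> b \<le> x \<bullet> b"
    using assms by (auto simp: mem_box not_less)
  then have "real (Suc n) * (x \<bullet> b) \<le> real (Suc n) * (c \<bullet> b) \<or> real (Suc n) * (d \<bullet> b) \<le> real (Suc n) * (x \<bullet> b)"
    by (meson mult_left_mono of_nat_0_le_iff)
  then have "bump 0 (real (Suc n) * (x \<bullet> b) + (- real (Suc n) * (c \<bullet> b)))
     * bump 0 (- real (Suc n) * (x \<bullet> b) + real (Suc n) * (d \<bullet> b)) = 0"
    by (auto simp: bump_def simp del: of_nat_Suc)
  with b(1) show ?thesis
    unfolding box_bump_def by (intro prod_zero) auto
qed

lemma bump_0_tendsto: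
  assumes "t > 0"
  shows "(\<lambda>n. bump 0 (real (Suc n) * t)) \<longlonglongrightarrow> 1"
proof -
  have "(\<lambda>n. exp (- (1 / t) * (1 / real (Suc n)))) \<longlonglongrightarrow> exp (- (1 / t) * 0)"
    by (intro tendsto_intros LIMSEQ_Suc[OF lim_1_over_n])
  moreover have "exp (- (1 / t) * (1 / real (Suc n))) = bump 0 (real (Suc n) * t)" for n
  proof -
    have "real (Suc n) * t > 0" using assms by simp
    then show ?thesis by (simp add: bump_def mult.commute del: of_nat_Suc)
  qed
  ultimately show ?thesis by (simp del: of_nat_Suc)
qed

text \<open>For t > 0 the value exp(-1/(n t)) tends to 1, and for t \<le> 0 the bump is 0. Hence the
  indicator of an open box is a bounded pointwise limit of test functions.\<close>

lemma box_bump_tendsto: "(\<lambda>n. box_bump c d n x) \<longlonglongrightarrow> indicator (box c d) x"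
proof (cases "x \<in> box c d")
  case True
  have "(\<lambda>n. \<Prod>b\<in>Basis. bump 0 (real (Suc n) * (x \<bullet> b - c \<bullet> b)) * bump 0 (real (Suc n) * (d \<bullet> b - x \<bullet> b)))
     \<longlonglongrightarrow> (\<Prod>b\<in>(Basis::'a set). 1 * 1)"
    using True by (intro tendsto_prod tendsto_mult bump_0_tendsto) (auto simp: mem_box)
  moreover have "box_bump c d n x
     = (\<Prod>b\<in>Basis. bump 0 (real (Suc n) * (x \<bullet> b - c \<bullet> b)) * bump 0 (real (Suc n) * (d \<bullet> b - x \<bullet> b)))" for n
    unfolding box_bump_def by (intro prod.cong refl) (simp add: algebra_simps)
  ultimately show ?thesis using True by simp
qed (simp add: box_bump_zero)

lemma box_bump_test:
  assumes "cbox c d \<subseteq> D"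
  shows "box_bump c d n \<in> test_functions D"
proof (rule test_functionsI[OF _ compact_cbox assms])
  show "C_k k (box_bump c d n)" for k
    unfolding box_bump_def[abs_def] by (intro C_k_prod C_k_mult C_k_bump finite_Basis)
  show "box_bump c d n x = 0" if "x \<notin> cbox c d" for x
    using that box_subset_cbox by (intro box_bump_zero) blast
qed

lemma sq_int_indicator:
  assumes "A \<in> sets borel" "emeasure lborel A < \<infinity>"
  shows "sq_int (indicator A :: 'a::euclidean_space \<Rightarrow> real)"
proof -
  have "(\<lambda>x. (norm (indicator A x :: real))\<^sup>2) = indicat_real A"
    by (auto simp: indicator_def fun_eq_iff)
  with assms show ?thesis
    by (simp add: sq_int_def integrable_real_indicator)
qed

lemma integral_box_zero:
  fixes f :: "'a::euclidean_space \<Rightarrow> real"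
  assumes f: "sq_int f" and zero: "\<And>\<phi>. \<phi> \<in> test_functions D \<Longrightarrow> (\<integral>x. f x * \<phi> x \<partial>lborel) = 0"
    and sub: "cbox c d \<subseteq> D"
  shows "(\<integral>x. f x * indicator (box c d) x \<partial>lborel) = 0"
proof -
  have [measurable]: "f \<in> borel_measurable borel" using f by (simp add: sq_int_def)
  have m [measurable]: "box_bump c d n \<in> borel_measurable borel" for n
    by (rule test_functions_measurable[OF box_bump_test[OF sub]])
  have "(\<lambda>n. \<integral>x. f x * box_bump c d n x \<partial>lborel) \<longlonglongrightarrow> (\<integral>x. f x * indicator (box c d) x \<partial>lborel)"
  proof (rule integral_dominated_convergence[where w = "\<lambda>x. \<bar>f x \<bullet> indicator (box c d) x\<bar>"])
    have "sq_int (indicator (box c d) :: 'a \<Rightarrow> real)"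
      by (intro sq_int_indicator emeasure_lborel_box_finite) auto
    from sq_int_inner[OF f this]
    show "integrable lborel (\<lambda>x. \<bar>f x \<bullet> indicator (box c d) x\<bar>)"
      by (rule integrable_abs)
    show "AE x in lborel. (\<lambda>n. f x * box_bump c d n x) \<longlonglongrightarrow> f x * indicator (box c d) x"
      by (intro AE_I2 tendsto_intros box_bump_tendsto)
    show "AE x in lborel. norm (f x * box_bump c d n x) \<le> \<bar>f x \<bullet> indicator (box c d) x\<bar>" for n
    proof (intro AE_I2)
      fix x show "norm (f x * box_bump c d n x) \<le> \<bar>f x \<bullet> indicator (box c d) x\<bar>"
        using box_bump_bounds[of c d n x] box_bump_zero[of x c d n]
        by (cases "x \<in> box c d") (auto simp: abs_mult mult_left_le)
    qed
  qed measurable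
  moreover have "(\<integral>x. f x * box_bump c d n x \<partial>lborel) = 0" for n
    by (rule zero[OF box_bump_test[OF sub]])
  ultimately show ?thesis
    by (simp add: LIMSEQ_const_iff)
qed

text \<open>The positive and the negative part of \<open>f\<close> on the box, taken as densities,
  give the same finite mass to every box. Boxes generate the Borel sets and are stable under
  intersection, so the two measures are equal, hence so are the two parts, and both must
  vanish.\<close>

lemma fundamental_lemma_box:
  fixes f :: "'a::euclidean_space \<Rightarrow> real"
  assumes f: "sq_int f" and zero: "\<And>\<phi>. \<phi> \<in> test_functions D \<Longrightarrow> (\<integral>x. f x * \<phi> x \<partial>lborel) = 0"
    and sub: "cbox a b \<subseteq> D"
  shows "AE x in lborel. x \<in> box a b \<longrightarrow> f x = 0"
proof -
  have [measurable]: "f \<in> borel_measurable borel" using f by (simp add: sq_int_def)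
  define h where "h x = f x * indicator (box a b) x" for x
  have [measurable]: "h \<in> borel_measurable borel" unfolding h_def by measurable
  have sqi: "sq_int (indicator (box l u) :: 'a \<Rightarrow> real)" for l u
    by (intro sq_int_indicator emeasure_lborel_box_finite) auto
  \<comment> \<open>\<open>ennreal\<close> sends negative reals to 0, so these are the measures
    whose densities are the positive and the negative part of \<open>h\<close>.\<close>
  have eq: "emeasure (density lborel (\<lambda>x. ennreal (h x))) X = emeasure (density lborel (\<lambda>x. ennreal (- h x))) X"
    and fin: "emeasure (density lborel (\<lambda>x. ennreal (h x))) X \<noteq> \<infinity>" if "X = box l u" for X l u
  proof -
    define c where "c = (\<Sum>i\<in>Basis. max (l \<bullet> i) (a \<bullet> i) *\<^sub>R i)"
    define d where "d = (\<Sum>i\<in>Basis. min (u \<bullet> i) (b \<bullet> i) *\<^sub>R i)"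
    define k where "k x = f x * indicator (box c d) x" for x
    have cd: "box l u \<inter> box a b = box c d"
      by (simp add: box_Int_box c_def d_def)
    have "cbox c d \<subseteq> D"
      using sub by (auto simp: c_def d_def mem_box)
    from integral_box_zero[OF f zero this]
    have k0: "(\<integral>x. k x \<partial>lborel) = 0" by (simp add: k_def)
    have ki: "integrable lborel k"
      using sq_int_inner[OF f sqi[of c d]] by (simp add: k_def[abs_def])
    have hk: "h x * indicator X x = k x" for x
      unfolding h_def k_def that cd[symmetric] by (auto simp: indicator_def)
    have e1: "emeasure (density lborel (\<lambda>x. ennreal (h x))) X = (\<integral>\<^sup>+x. ennreal (k x) \<partial>lborel)"
      unfolding that by (subst emeasure_density)
        (auto simp: hk[unfolded that, symmetric] indicator_def intro!: nn_integral_cong)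
    have e2: "emeasure (density lborel (\<lambda>x. ennreal (- h x))) X = (\<integral>\<^sup>+x. ennreal (- k x) \<partial>lborel)"
      unfolding that by (subst emeasure_density)
        (auto simp: hk[unfolded that, symmetric] indicator_def intro!: nn_integral_cong)
    have f1: "(\<integral>\<^sup>+x. ennreal (k x) \<partial>lborel) \<noteq> \<infinity>" "(\<integral>\<^sup>+x. ennreal (- k x) \<partial>lborel) \<noteq> \<infinity>"
      using ki by (auto simp: real_integrable_def)
    \<comment> \<open>The integral of \<open>k\<close> is the difference of these two numbers.
      Finiteness of both integrals is what lifts the equality back to
      \<open>ennreal\<close>.\<close>
    have "enn2real (\<integral>\<^sup>+x. ennreal (k x) \<partial>lborel) = enn2real (\<integral>\<^sup>+x. ennreal (- k x) \<partial>lborel)"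
      using k0 real_lebesgue_integral_def[OF ki] by simp
    then have "(\<integral>\<^sup>+x. ennreal (k x) \<partial>lborel) = (\<integral>\<^sup>+x. ennreal (- k x) \<partial>lborel)"
      using f1 by (metis ennreal_enn2real infinity_ennreal_def less_top)
    with e1 e2 f1 show "emeasure (density lborel (\<lambda>x. ennreal (h x))) X = emeasure (density lborel (\<lambda>x. ennreal (- h x))) X"
      "emeasure (density lborel (\<lambda>x. ennreal (h x))) X \<noteq> \<infinity>" by auto
  qed
  have "density lborel (\<lambda>x. ennreal (h x)) = density lborel (\<lambda>x. ennreal (- h x))"
  proof (rule measure_eqI_generator_eq)
    let ?E = "range (\<lambda>(a, b). box a b::'a set)"
    show "Int_stable ?E"
      by (auto simp: Int_stable_def box_Int_box)
    show "?E \<subseteq> Pow UNIV" "sets (density lborel (\<lambda>x. ennreal (h x))) = sigma_sets UNIV ?E"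
      "sets (density lborel (\<lambda>x. ennreal (- h x))) = sigma_sets UNIV ?E"
      by (simp_all add: borel_eq_box)
    let ?A = "\<lambda>n::nat. box (- (real n *\<^sub>R One)) (real n *\<^sub>R One) :: 'a set"
    show "range ?A \<subseteq> ?E" "(\<Union>i. ?A i) = UNIV"
      unfolding UN_box_eq_UNIV by auto
    show "emeasure (density lborel (\<lambda>x. ennreal (h x))) (?A i) \<noteq> \<infinity>" for i
      by (rule fin[OF refl])
    show "emeasure (density lborel (\<lambda>x. ennreal (h x))) X = emeasure (density lborel (\<lambda>x. ennreal (- h x))) X"
      if "X \<in> ?E" for X
      using that by (auto intro: eq)
  qed
  then have "AE x in lborel. ennreal (h x) = ennreal (- h x)"
    by (intro sigma_finite_measure.density_unique[OF sigma_finite_lborel]) auto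
  then show ?thesis
  proof eventually_elim
    case (elim x)
    then have "h x = 0"
      by (cases "h x \<ge> 0") (auto simp: ennreal_neg ennreal_eq_0_iff dest: sym)
    then show ?case by (auto simp: h_def indicator_def)
  qed
qed

lemma AE_cbox_box: "AE x in lborel. x \<in> cbox a b \<longrightarrow> x \<in> box a b"
proof (rule AE_I[where N = "cbox a b - box a b"])
  have "emeasure lborel (cbox a b - box a b) = emeasure lborel (cbox a b) - emeasure lborel (box a b)"
    using emeasure_lborel_box_finite[of a b] by (intro emeasure_Diff) (auto simp: box_subset_cbox less_top)
  then show "emeasure lborel (cbox a b - box a b) = 0"
    by (simp add: emeasure_lborel_cbox_eq emeasure_lborel_box_eq)
qed auto

text \<open>An open set is a countable union of closed boxes inside it, and passing from the closed
  to the open box loses only the faces, a null set.\<close>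

lemma fundamental_lemma:
  fixes f :: "'a::euclidean_space \<Rightarrow> real"
  assumes f: "sq_int f" and zero: "\<And>\<phi>. \<phi> \<in> test_functions D \<Longrightarrow> (\<integral>x. f x * \<phi> x \<partial>lborel) = 0"
    and "open D"
  shows "AE x in lborel. x \<in> D \<longrightarrow> f x = 0"
proof -
  obtain \<D> where \<D>: "countable \<D>" "\<D> \<subseteq> Pow D" "\<And>X. X \<in> \<D> \<Longrightarrow> \<exists>a b. X = cbox a b" "\<Union>\<D> = D"
    using open_countable_Union_open_cbox[OF \<open>open D\<close>] by metis
  have "\<forall>X\<in>\<D>. AE x in lborel. x \<in> X \<longrightarrow> f x = 0"
  proof
    fix X assume X: "X \<in> \<D>"
    then obtain a b where ab: "X = cbox a b" using \<D>(3) by blast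
    with X \<D>(2) have "cbox a b \<subseteq> D" by auto
    then have "AE x in lborel. x \<in> box a b \<longrightarrow> f x = 0"
      using zero by (intro fundamental_lemma_box[OF f])
    with AE_cbox_box[of a b] show "AE x in lborel. x \<in> X \<longrightarrow> f x = 0"
      unfolding ab by eventually_elim blast
  qed
  then have "AE x in lborel. \<forall>X\<in>\<D>. x \<in> X \<longrightarrow> f x = 0"
    by (subst AE_ball_countable[OF \<D>(1)])
  then show ?thesis
  proof eventually_elim
    case (elim x)
    then show ?case using \<D>(4) by blast
  qed
qed

section \<open>Weak gradients and the space H^1\<close>

definition grad :: "('a::euclidean_space \<Rightarrow> real) \<Rightarrow> 'a \<Rightarrow> 'a" where
  "grad \<phi> x = (\<Sum>i\<in>Basis. frechet_derivative \<phi> (at x) i *\<^sub>R i)"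

lemma grad_inner_Basis: "i \<in> Basis \<Longrightarrow> grad \<phi> x \<bullet> i = frechet_derivative \<phi> (at x) i"
  by (simp add: grad_def inner_sum_left inner_Basis if_distrib cong: if_cong)

lemma sq_int_times_vector: "sq_int f \<Longrightarrow> sq_int (\<lambda>x. f x *\<^sub>R (e::'b::euclidean_space))"
  for f :: "'a::euclidean_space \<Rightarrow> real"
  by (rule sq_int_bound[of f _ "norm e"]) (auto simp: sq_int_def)

lemma sq_int_sum: "(\<And>i. i \<in> I \<Longrightarrow> sq_int (f i)) \<Longrightarrow> sq_int (\<lambda>x. \<Sum>i\<in>I. f i x)"
  by (induction I rule: infinite_finite_induct) (auto intro: sq_int_add sq_int_zero)

lemma sq_int_grad: "\<phi> \<in> test_functions D \<Longrightarrow> sq_int (grad \<phi>)"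
  unfolding grad_def[abs_def]
  by (intro sq_int_sum sq_int_times_vector test_functions_sq_int[OF test_functions_deriv])

lemma grad_in_L2_on: "\<phi> \<in> test_functions D \<Longrightarrow> abs_L2 (grad \<phi>) \<in> L2_on D"
  by (rule abs_in_L2_on[OF sq_int_grad]) (auto simp: grad_def test_functions_zero_outside(2))

lemma set_integral_zero_off:
  assumes "\<And>x. x \<notin> D \<Longrightarrow> f x = (0::real)"
  shows "(LINT x:D|M. f x) = (\<integral>x. f x \<partial>M)"
  unfolding set_lebesgue_integral_def using assms
  by (intro Bochner_Integration.integral_cong) (auto simp: indicator_def)

text \<open>With inner products in place of set integrals, linearity and closedness of the weak
  gradient become properties of the inner product. The restriction to \<open>D\<close> disappears
  because test functions and their derivatives vanish off \<open>D\<close>.\<close>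

lemma is_weak_gradient_iff:
  "is_weak_gradient D u G \<longleftrightarrow> G \<in> L2_on D \<and> (\<forall>\<phi>\<in>test_functions D. \<forall>i\<in>Basis.
     u \<bullet> abs_L2 (\<lambda>x. frechet_derivative \<phi> (at x) i) = - (G \<bullet> abs_L2 (\<lambda>x. \<phi> x *\<^sub>R i)))"
proof -
  have "(LINT x:D|lborel. rep_L2 u x * frechet_derivative \<phi> (at x) i)
      = u \<bullet> abs_L2 (\<lambda>x. frechet_derivative \<phi> (at x) i)"
    "(LINT x:D|lborel. (rep_L2 G x \<bullet> i) * \<phi> x) = G \<bullet> abs_L2 (\<lambda>x. \<phi> x *\<^sub>R i)"
    if "\<phi> \<in> test_functions D" for \<phi> i
  proof -
    have s: "sq_int (\<lambda>x. frechet_derivative \<phi> (at x) i)" "sq_int (\<lambda>x. \<phi> x *\<^sub>R i)"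
      by (rule test_functions_sq_int[OF test_functions_deriv[OF that]],
          rule sq_int_times_vector[OF test_functions_sq_int[OF that]])
    show "(LINT x:D|lborel. rep_L2 u x * frechet_derivative \<phi> (at x) i)
      = u \<bullet> abs_L2 (\<lambda>x. frechet_derivative \<phi> (at x) i)"
      using test_functions_zero_outside(2)[OF that]
      by (subst set_integral_zero_off) (auto simp: inner_L2_abs[OF s(1)])
    show "(LINT x:D|lborel. (rep_L2 G x \<bullet> i) * \<phi> x) = G \<bullet> abs_L2 (\<lambda>x. \<phi> x *\<^sub>R i)"
      using test_functions_zero_outside(1)[OF that]
      by (subst set_integral_zero_off) (auto simp: inner_L2_abs[OF s(2)] mult.commute)
  qed
  then show ?thesis unfolding is_weak_gradient_def by auto
qed

lemma is_weak_gradient_add: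
  "is_weak_gradient D u G \<Longrightarrow> is_weak_gradient D v H \<Longrightarrow> is_weak_gradient D (u + v) (G + H)"
  by (simp add: is_weak_gradient_iff add_in_L2_on inner_add_left)

lemma is_weak_gradient_scaleR:
  "is_weak_gradient D u G \<Longrightarrow> is_weak_gradient D (c *\<^sub>R u) (c *\<^sub>R G)"
  by (simp add: is_weak_gradient_iff scaleR_in_L2_on)

lemma is_weak_gradient_limit:
  assumes "\<And>n. is_weak_gradient D (u n) (G n)" "u \<longlonglongrightarrow> v" "G \<longlonglongrightarrow> H"
  shows "is_weak_gradient D v H"
  unfolding is_weak_gradient_iff
proof (intro conjI ballI)
  show "H \<in> L2_on D"
    using assms(1) by (intro L2_on_limit[OF _ assms(3)]) (simp add: is_weak_gradient_def)
  fix \<phi> and i :: 'a assume a: "\<phi> \<in> test_functions D" "i \<in> Basis"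
  let ?p = "abs_L2 (\<lambda>x. frechet_derivative \<phi> (at x) i)" and ?q = "abs_L2 (\<lambda>x. \<phi> x *\<^sub>R i)"
  have "(\<lambda>n. u n \<bullet> ?p) \<longlonglongrightarrow> v \<bullet> ?p" "(\<lambda>n. - (G n \<bullet> ?q)) \<longlonglongrightarrow> - (H \<bullet> ?q)"
    by (intro tendsto_inner tendsto_minus tendsto_const assms)+
  moreover have "u n \<bullet> ?p = - (G n \<bullet> ?q)" for n
    using assms(1)[of n] a unfolding is_weak_gradient_iff by blast
  ultimately have "(\<lambda>n. - (G n \<bullet> ?q)) \<longlonglongrightarrow> v \<bullet> ?p" "(\<lambda>n. - (G n \<bullet> ?q)) \<longlonglongrightarrow> - (H \<bullet> ?q)"
    by (simp_all only:)
  then show "v \<bullet> ?p = - (H \<bullet> ?q)"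
    by (rule LIMSEQ_unique)
qed

text \<open>This makes the definite description \<open>weak_gradient\<close> meaningful. On
  \<open>D\<close> the fundamental lemma is applied to each coordinate of the difference; off
  \<open>D\<close> both candidates vanish.\<close>

lemma is_weak_gradient_unique:
  assumes D: "open D" and G: "is_weak_gradient D u G" "is_weak_gradient D u H"
  shows "G = H"
proof -
  let ?d = "G - H"
  have z: "AE x in lborel. x \<in> D \<longrightarrow> rep_L2 ?d x \<bullet> i = 0" if i: "i \<in> Basis" for i
  proof (rule fundamental_lemma[OF _ _ D])
    show "sq_int (\<lambda>x. rep_L2 ?d x \<bullet> i)"
      by (rule sq_int_bound[OF sq_int_rep_L2[of ?d], where C = 1]) (use i in \<open>auto simp: Basis_le_norm\<close>)
    fix \<phi> assume p: "\<phi> \<in> test_functions D"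
    have "?d \<bullet> abs_L2 (\<lambda>x. \<phi> x *\<^sub>R i) = 0"
      using G p i by (simp add: is_weak_gradient_iff inner_diff_left)
    then show "(\<integral>x. rep_L2 ?d x \<bullet> i * \<phi> x \<partial>lborel) = 0"
      using inner_L2_abs[OF sq_int_times_vector[OF test_functions_sq_int[OF p]], of ?d i]
      by (simp add: mult.commute)
  qed
  have "AE x in lborel. \<forall>i\<in>Basis. x \<in> D \<longrightarrow> rep_L2 ?d x \<bullet> i = 0"
    by (rule AE_finite_allI) (auto intro: z)
  moreover have "AE x in lborel. x \<notin> D \<longrightarrow> rep_L2 ?d x = 0"
    using diff_in_L2_on[of G D H] G by (simp add: is_weak_gradient_iff L2_on_iff)
  moreover note rep_zero_L2[where 'a = 'a and 'b = 'a]
  ultimately have "AE x in lborel. rep_L2 ?d x = rep_L2 0 x"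
    by eventually_elim (metis euclidean_all_zero_iff)
  then have "?d = 0" by (subst L2_eq_iff)
  then show ?thesis by simp
qed

lemma weak_gradient_eqI: "open D \<Longrightarrow> is_weak_gradient D u G \<Longrightarrow> weak_gradient D u = G"
  unfolding weak_gradient_def using is_weak_gradient_unique by blast

lemma H1_is_weak_gradient: "open D \<Longrightarrow> u \<in> H1 D \<Longrightarrow> is_weak_gradient D u (weak_gradient D u)"
  using weak_gradient_eqI by (auto simp: H1_def)

lemma H1_add:
  assumes "open D" "u \<in> H1 D" "v \<in> H1 D"
  shows "u + v \<in> H1 D" "weak_gradient D (u + v) = weak_gradient D u + weak_gradient D v"
  using is_weak_gradient_add[OF H1_is_weak_gradient[OF assms(1,2)] H1_is_weak_gradient[OF assms(1,3)]] assms
  by (auto simp: H1_def add_in_L2_on intro: weak_gradient_eqI)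

lemma H1_scaleR:
  assumes "open D" "u \<in> H1 D"
  shows "c *\<^sub>R u \<in> H1 D" "weak_gradient D (c *\<^sub>R u) = c *\<^sub>R weak_gradient D u"
  using is_weak_gradient_scaleR[OF H1_is_weak_gradient[OF assms]] assms
  by (auto simp: H1_def scaleR_in_L2_on intro: weak_gradient_eqI)

lemma H1_diff:
  assumes "open D" "u \<in> H1 D" "v \<in> H1 D"
  shows "u - v \<in> H1 D" "weak_gradient D (u - v) = weak_gradient D u - weak_gradient D v"
  using H1_add[OF assms(1,2) H1_scaleR(1)[OF assms(1,3)], of "-1"] H1_scaleR(2)[OF assms(1,3), of "-1"]
  by auto

text \<open>As a norm on a product space, \<open>H1_norm\<close> inherits the triangle inequality,
  homogeneity and continuity.\<close>

lemma H1_norm_Pair: "H1_norm D u = norm (u, weak_gradient D u)"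
  by (simp add: H1_norm_def norm_Pair)

lemma test_function_weak_gradient:
  assumes "\<phi> \<in> test_functions D"
  shows "is_weak_gradient D (abs_L2 \<phi>) (abs_L2 (grad \<phi>))"
  unfolding is_weak_gradient_iff
proof (intro conjI ballI)
  fix \<psi> and i :: 'a assume p: "\<psi> \<in> test_functions D" and i: "i \<in> Basis"
  have s: "sq_int (\<lambda>x. frechet_derivative \<psi> (at x) i)" "sq_int (\<lambda>x. \<psi> x *\<^sub>R i)"
    by (rule test_functions_sq_int[OF test_functions_deriv[OF p]],
        rule sq_int_times_vector[OF test_functions_sq_int[OF p]])
  show "abs_L2 \<phi> \<bullet> abs_L2 (\<lambda>x. frechet_derivative \<psi> (at x) i) = - (abs_L2 (grad \<phi>) \<bullet> abs_L2 (\<lambda>x. \<psi> x *\<^sub>R i))"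
    using integration_by_parts[OF p test_functionsD(1)[OF assms], of i] i
    by (simp add: inner_abs_L2[OF test_functions_sq_int[OF assms] s(1)]
        inner_abs_L2[OF sq_int_grad[OF assms] s(2)] grad_inner_Basis mult.commute)
qed (rule grad_in_L2_on[OF assms])

lemma test_function_H1:
  assumes "open D" "\<phi> \<in> test_functions D"
  shows "abs_L2 \<phi> \<in> H1 D" "weak_gradient D (abs_L2 \<phi>) = abs_L2 (grad \<phi>)"
  using test_function_weak_gradient[OF assms(2)] weak_gradient_eqI[OF assms(1)] test_functions_in_L2_on[OF assms(2)]
  by (auto simp: H1_def)

section \<open>H^1_0 as the closure of the test functions\<close>

lemma H10_D: "v \<in> H10 D \<Longrightarrow> v \<in> H1 D" "v \<in> H10 D \<Longrightarrow> v \<in> L2_on D"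
  by (auto simp: H10_def H1_def)

text \<open>The weak gradient is a closed operator, so the limit \<open>G\<close> of the classical
  gradients is automatically the weak gradient of \<open>v\<close>. Convergence of the pairs of
  function and gradient is then convergence in \<open>H1_norm\<close>.\<close>

lemma H10_I:
  assumes D: "open D" and p: "\<And>n. \<phi> n \<in> test_functions D"
    and "(\<lambda>n. abs_L2 (\<phi> n)) \<longlonglongrightarrow> v" "(\<lambda>n. abs_L2 (grad (\<phi> n))) \<longlonglongrightarrow> G"
  shows "v \<in> H10 D" "weak_gradient D v = G"
proof -
  have w: "is_weak_gradient D v G"
    by (rule is_weak_gradient_limit[OF test_function_weak_gradient[OF p] assms(3,4)])
  then show g: "weak_gradient D v = G" by (rule weak_gradient_eqI[OF D])
  have v: "v \<in> H1 D"
    using w L2_on_limit[OF test_functions_in_L2_on[OF p] assms(3)] by (auto simp: H1_def)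
  have "(\<lambda>n. norm (v - abs_L2 (\<phi> n), G - abs_L2 (grad (\<phi> n)))) \<longlonglongrightarrow> norm (v - v, G - G)"
    by (intro tendsto_intros assms)
  then have "(\<lambda>n. H1_norm D (v - abs_L2 (\<phi> n))) \<longlonglongrightarrow> 0"
    by (simp add: H1_norm_Pair H1_diff[OF D v test_function_H1(1)[OF D p]] test_function_H1[OF D p] g)
  then show "v \<in> H10 D"
    using v p by (auto simp: H10_def)
qed

lemma H10_approx:
  assumes D: "open D" and v: "v \<in> H10 D"
  obtains \<phi> where "\<And>n::nat. \<phi> n \<in> test_functions D"
    "(\<lambda>n. abs_L2 (\<phi> n)) \<longlonglongrightarrow> v" "(\<lambda>n. abs_L2 (grad (\<phi> n))) \<longlonglongrightarrow> weak_gradient D v"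
proof -
  obtain \<phi> where p: "\<And>n::nat. \<phi> n \<in> test_functions D" and l: "(\<lambda>n. H1_norm D (v - abs_L2 (\<phi> n))) \<longlonglongrightarrow> 0"
    using v by (auto simp: H10_def)
  have "(\<lambda>n. (v - abs_L2 (\<phi> n), weak_gradient D v - abs_L2 (grad (\<phi> n)))) \<longlonglongrightarrow> 0"
    using l by (simp add: H1_norm_Pair H1_diff[OF D H10_D(1)[OF v] test_function_H1(1)[OF D p]]
        test_function_H1[OF D p] tendsto_norm_zero_iff)
  from tendsto_fst[OF this] tendsto_snd[OF this]
  have a: "(\<lambda>n. v - abs_L2 (\<phi> n)) \<longlonglongrightarrow> 0" "(\<lambda>n. weak_gradient D v - abs_L2 (grad (\<phi> n))) \<longlonglongrightarrow> 0"
    by simp_all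
  show ?thesis
    using tendsto_diff[OF tendsto_const[of v] a(1)] tendsto_diff[OF tendsto_const[of "weak_gradient D v"] a(2)]
    by (intro that[OF p]) simp_all
qed

lemma test_functions_H10: "open D \<Longrightarrow> \<phi> \<in> test_functions D \<Longrightarrow> abs_L2 \<phi> \<in> H10 D"
  by (rule H10_I(1)[of D "\<lambda>_. \<phi>" _ "abs_L2 (grad \<phi>)"]) auto

lemma H10_zero: "open D \<Longrightarrow> 0 \<in> H10 D"
  using test_functions_H10[of D "\<lambda>_. 0"] test_functionsI[of "\<lambda>_. 0" "{}" D]
  by (simp add: C_k_const zero_L2.abs_eq)

lemma grad_add:
  assumes "\<phi> \<in> test_functions D" "\<psi> \<in> test_functions D"
  shows "grad (\<lambda>x. \<phi> x + \<psi> x) = (\<lambda>x. grad \<phi> x + grad \<psi> x)"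
  using frechet_derivative_at[OF has_derivative_add[OF test_functionsD(2)[OF assms(1)] test_functionsD(2)[OF assms(2)]], symmetric]
  by (simp add: grad_def fun_eq_iff sum.distrib scaleR_add_left)

lemma grad_scale:
  assumes "\<phi> \<in> test_functions D"
  shows "grad (\<lambda>x. c * \<phi> x) = (\<lambda>x. c *\<^sub>R grad \<phi> x)"
  using frechet_derivative_at[OF has_derivative_mult_right[OF test_functionsD(2)[OF assms]], symmetric]
  by (simp add: grad_def fun_eq_iff scaleR_sum_right)

lemma H10_add:
  assumes D: "open D" and u: "u \<in> H10 D" and v: "v \<in> H10 D"
  shows "u + v \<in> H10 D"
proof -
  obtain \<phi> where p: "\<And>n::nat. \<phi> n \<in> test_functions D"
    "(\<lambda>n. abs_L2 (\<phi> n)) \<longlonglongrightarrow> u" "(\<lambda>n. abs_L2 (grad (\<phi> n))) \<longlonglongrightarrow> weak_gradient D u"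
    using H10_approx[OF D u] by blast
  obtain \<psi> where q: "\<And>n::nat. \<psi> n \<in> test_functions D"
    "(\<lambda>n. abs_L2 (\<psi> n)) \<longlonglongrightarrow> v" "(\<lambda>n. abs_L2 (grad (\<psi> n))) \<longlonglongrightarrow> weak_gradient D v"
    using H10_approx[OF D v] by blast
  show ?thesis
    using tendsto_add[OF p(2) q(2)] tendsto_add[OF p(3) q(3)]
    by (intro H10_I(1)[OF D test_functions_add[OF p(1) q(1)]])
       (simp_all add: grad_add[OF p(1) q(1)] plus_abs_L2 test_functions_sq_int[OF p(1)]
          test_functions_sq_int[OF q(1)] sq_int_grad[OF p(1)] sq_int_grad[OF q(1)])
qed

lemma H10_scaleR:
  assumes D: "open D" and u: "u \<in> H10 D"
  shows "c *\<^sub>R u \<in> H10 D"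
proof -
  obtain \<phi> where p: "\<And>n::nat. \<phi> n \<in> test_functions D"
    "(\<lambda>n. abs_L2 (\<phi> n)) \<longlonglongrightarrow> u" "(\<lambda>n. abs_L2 (grad (\<phi> n))) \<longlonglongrightarrow> weak_gradient D u"
    using H10_approx[OF D u] by blast
  show ?thesis
    using tendsto_scaleR[OF tendsto_const[of c] p(2)] tendsto_scaleR[OF tendsto_const[of c] p(3)]
    by (intro H10_I(1)[OF D test_functions_scale[OF p(1)]])
       (simp_all add: grad_scale[OF p(1)] scaleR_abs_L2 test_functions_sq_int[OF p(1)] sq_int_grad[OF p(1)])
qed

lemma H10_diff: "open D \<Longrightarrow> u \<in> H10 D \<Longrightarrow> v \<in> H10 D \<Longrightarrow> u - v \<in> H10 D"
  using H10_add[of D u "(-1) *\<^sub>R v"] H10_scaleR[of D v "-1"] by simp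

text \<open>A diagonal argument: each \<open>X n\<close> is replaced by a test function within
  1/(n+1) of it, both in value and in gradient, and \<open>H10_I\<close> applies to these.\<close>

lemma H10_closed:
  assumes D: "open D" and X: "\<And>n. X n \<in> H10 D"
    and l: "X \<longlonglongrightarrow> v" "(\<lambda>n. weak_gradient D (X n)) \<longlonglongrightarrow> G"
  shows "v \<in> H10 D" "weak_gradient D v = G"
proof -
  have "\<exists>\<phi>\<in>test_functions D. norm (abs_L2 \<phi> - X n) < 1 / Suc n
      \<and> norm (abs_L2 (grad \<phi>) - weak_gradient D (X n)) < 1 / Suc n" for n
  proof -
    obtain \<phi> where p: "\<And>n::nat. \<phi> n \<in> test_functions D"
      "(\<lambda>n. abs_L2 (\<phi> n)) \<longlonglongrightarrow> X n" "(\<lambda>n. abs_L2 (grad (\<phi> n))) \<longlonglongrightarrow> weak_gradient D (X n)"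
      using H10_approx[OF D X] by blast
    have "\<forall>\<^sub>F k in sequentially. dist (abs_L2 (\<phi> k)) (X n) < 1 / Suc n
       \<and> dist (abs_L2 (grad (\<phi> k))) (weak_gradient D (X n)) < 1 / Suc n"
      by (intro eventually_conj tendstoD[OF p(2)] tendstoD[OF p(3)]) auto
    then obtain k where "dist (abs_L2 (\<phi> k)) (X n) < 1 / Suc n"
       "dist (abs_L2 (grad (\<phi> k))) (weak_gradient D (X n)) < 1 / Suc n"
      by (auto simp: eventually_sequentially)
    with p(1)[of k] show ?thesis by (auto simp: dist_norm)
  qed
  then obtain \<phi> where p: "\<And>n. \<phi> n \<in> test_functions D" "\<And>n. norm (abs_L2 (\<phi> n) - X n) < 1 / Suc n"
      "\<And>n. norm (abs_L2 (grad (\<phi> n)) - weak_gradient D (X n)) < 1 / Suc n"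
    by metis
  have n: "(\<lambda>n. 1 / real (Suc n)) \<longlonglongrightarrow> 0" by (rule LIMSEQ_Suc[OF lim_1_over_n])
  have "(\<lambda>n. abs_L2 (\<phi> n) - X n) \<longlonglongrightarrow> 0" "(\<lambda>n. abs_L2 (grad (\<phi> n)) - weak_gradient D (X n)) \<longlonglongrightarrow> 0"
    using p(2,3) by (auto intro!: Lim_null_comparison[OF _ n] always_eventually less_imp_le simp del: of_nat_Suc)
  from tendsto_add[OF this(1) l(1)] tendsto_add[OF this(2) l(2)]
  have "(\<lambda>n. abs_L2 (\<phi> n)) \<longlonglongrightarrow> v" "(\<lambda>n. abs_L2 (grad (\<phi> n))) \<longlonglongrightarrow> G"
    by simp_all
  from H10_I[OF D p(1) this] show "v \<in> H10 D" "weak_gradient D v = G" .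
qed

section \<open>The gradient norm and the Poincare inequality\<close>

lemma H10_norm_scaleR: "open D \<Longrightarrow> u \<in> H10 D \<Longrightarrow> H10_norm D (c *\<^sub>R u) = \<bar>c\<bar> * H10_norm D u"
  by (simp add: H10_norm_def H1_scaleR[OF _ H10_D(1)])

lemma H10_norm_nonneg: "0 \<le> H10_norm D u"
  by (simp add: H10_norm_def)

text \<open>Integrate the derivative of \<open>(x \<bullet> e) \<phi>(x)\<^sup>2\<close> in direction \<open>e\<close>.\<close>

lemma Poincare_test:
  fixes D :: "'a::euclidean_space set"
  assumes D: "D \<subseteq> cball 0 R" and p: "\<phi> \<in> test_functions D" and R: "0 \<le> R"
  shows "norm (abs_L2 \<phi>) \<le> 2 * R * norm (abs_L2 (grad \<phi>))"
proof -
  obtain e :: 'a where e: "e \<in> Basis" using nonempty_Basis by blast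
  have p2: "(\<lambda>x. \<phi> x ^ 2) \<in> test_functions D"
    by (rule test_functions_power[OF p]) simp
  have d: "frechet_derivative (\<lambda>x. \<phi> x ^ 2) (at x) e = 2 * \<phi> x * frechet_derivative \<phi> (at x) e" for x
    using frechet_derivative_power_real[OF test_functionsD(2)[OF p], of 2] by simp
  have "((\<lambda>x. x \<bullet> e) has_derivative (\<lambda>h. h \<bullet> e)) (at x)" for x :: 'a
    by (auto intro!: derivative_eq_intros)
  from frechet_derivative_at[OF this, symmetric] e
  have de: "frechet_derivative (\<lambda>x::'a. x \<bullet> e) (at x) e = 1" for x
    by simp
  have sp: "sq_int \<phi>" and sg: "sq_int (grad \<phi>)"
    using p by (rule test_functions_sq_int sq_int_grad)+
  have eq: "(\<integral>x. (x \<bullet> e) * (2 * \<phi> x * frechet_derivative \<phi> (at x) e) \<partial>lborel) = - (\<integral>x. (\<phi> x)\<^sup>2 \<partial>lborel)"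
    using integration_by_parts[OF p2 C_k_inner[of _ e], of e] by (simp add: d de)
  define f where "f x = \<bar>\<phi> x\<bar>" for x
  define g where "g x = norm (grad \<phi> x)" for x
  have sf: "sq_int f" and sgg: "sq_int g"
    using sp sg by (auto simp: sq_int_def f_def[abs_def] g_def[abs_def])
  have "(norm (abs_L2 \<phi>))\<^sup>2 = \<bar>\<integral>x. (x \<bullet> e) * (2 * \<phi> x * frechet_derivative \<phi> (at x) e) \<partial>lborel\<bar>"
    using eq by (simp add: norm_abs_L2_sq[OF sp])
  also have "\<dots> \<le> (\<integral>x. \<bar>(x \<bullet> e) * (2 * \<phi> x * frechet_derivative \<phi> (at x) e)\<bar> \<partial>lborel)"
    by (rule integral_abs_bound)
  also have "\<dots> \<le> (\<integral>x. (2 * R) * (f x \<bullet> g x) \<partial>lborel)"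
  proof (rule integral_mono)
    show "integrable lborel (\<lambda>x. (2 * R) * (f x \<bullet> g x))"
      by (intro integrable_mult_right sq_int_inner sf sgg)
    show "integrable lborel (\<lambda>x. \<bar>(x \<bullet> e) * (2 * \<phi> x * frechet_derivative \<phi> (at x) e)\<bar>)"
      using test_functions_integrable[OF test_functions_mult[OF test_functions_deriv[OF p2] C_k_inner[of _ e]], of e]
      by (intro integrable_abs) (simp add: d)
    fix x
    show "\<bar>(x \<bullet> e) * (2 * \<phi> x * frechet_derivative \<phi> (at x) e)\<bar> \<le> (2 * R) * (f x \<bullet> g x)"
    proof (cases "x \<in> D")
      case True
      have "\<bar>x \<bullet> e\<bar> \<le> R"
        using True D Basis_le_norm[OF e, of x] by (auto simp: subset_iff)
      moreover have "\<bar>frechet_derivative \<phi> (at x) e\<bar> \<le> norm (grad \<phi> x)"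
        using Basis_le_norm[OF e, of "grad \<phi> x"] by (simp add: grad_inner_Basis[OF e])
      ultimately have "\<bar>x \<bullet> e\<bar> * (2 * (\<bar>\<phi> x\<bar> * \<bar>frechet_derivative \<phi> (at x) e\<bar>)) \<le> R * (2 * (\<bar>\<phi> x\<bar> * norm (grad \<phi> x)))"
        by (intro mult_mono) auto
      then show ?thesis by (simp add: abs_mult f_def g_def mult_ac)
    qed (simp add: f_def test_functions_zero_outside[OF p])
  qed
  also have "\<dots> = 2 * R * (abs_L2 f \<bullet> abs_L2 g)"
    by (simp add: inner_abs_L2[OF sf sgg])
  also have "\<dots> \<le> 2 * \<bar>R\<bar> * (norm (abs_L2 f) * norm (abs_L2 g))"
  proof -
    have "2 * R * (abs_L2 f \<bullet> abs_L2 g) \<le> 2 * \<bar>R\<bar> * \<bar>abs_L2 f \<bullet> abs_L2 g\<bar>"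
    proof -
      have "2 * R * (abs_L2 f \<bullet> abs_L2 g) \<le> \<bar>2 * R * (abs_L2 f \<bullet> abs_L2 g)\<bar>" by (rule abs_ge_self)
      then show ?thesis by (simp add: abs_mult)
    qed
    also have "\<dots> \<le> 2 * \<bar>R\<bar> * (norm (abs_L2 f) * norm (abs_L2 g))"
      by (intro mult_left_mono Cauchy_Schwarz_ineq2) auto
    finally show ?thesis .
  qed
  also have "norm (abs_L2 f) = norm (abs_L2 \<phi>)"
    by (rule power2_eq_imp_eq) (simp_all add: norm_abs_L2_sq sf sp, simp add: f_def)
  also have "norm (abs_L2 g) = norm (abs_L2 (grad \<phi>))"
    by (rule power2_eq_imp_eq) (simp_all add: norm_abs_L2_sq sgg sg, simp add: g_def)
  finally have "norm (abs_L2 \<phi>) * norm (abs_L2 \<phi>) \<le> norm (abs_L2 \<phi>) * (2 * \<bar>R\<bar> * norm (abs_L2 (grad \<phi>)))"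
    by (simp add: power2_eq_square mult_ac)
  with R show ?thesis
    by (cases "norm (abs_L2 \<phi>) = 0") (auto simp: mult_le_cancel_left)
qed

lemma Poincare:
  assumes "open D" "bounded D"
  obtains C where "C \<ge> 0" "\<And>v. v \<in> H10 D \<Longrightarrow> norm v \<le> C * H10_norm D v"
proof -
  obtain R where R: "R > 0" "D \<subseteq> cball 0 R"
    using bounded_subset_ballD[OF assms(2), of 0] ball_subset_cball by blast
  show ?thesis
  proof (rule that[of "2 * R"])
    fix v assume "v \<in> H10 D"
    then obtain \<phi> where p: "\<And>n::nat. \<phi> n \<in> test_functions D"
      "(\<lambda>n. abs_L2 (\<phi> n)) \<longlonglongrightarrow> v" "(\<lambda>n. abs_L2 (grad (\<phi> n))) \<longlonglongrightarrow> weak_gradient D v"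
      using H10_approx[OF assms(1)] by blast
    show "norm v \<le> 2 * R * H10_norm D v"
      unfolding H10_norm_def
      by (rule LIMSEQ_le[OF tendsto_norm[OF p(2)] tendsto_mult[OF tendsto_const tendsto_norm[OF p(3)]]])
         (use Poincare_test[OF R(2) p(1)] R(1) in auto)
  qed (use R in auto)
qed

text \<open>A real supremum is a bound only over a set bounded above, and this comes from the
  Poincare inequality. At a vector of gradient norm 0 the quotient is 0 by convention and carries no
  information; there the Poincare inequality gives the claim directly.\<close>

lemma embedding_const:
  assumes "open D" "bounded D"
  shows "v \<in> H10 D \<Longrightarrow> norm v \<le> embedding_const D * H10_norm D v" "0 \<le> embedding_const D"
proof -
  obtain C where C: "C \<ge> 0" "\<And>v. v \<in> H10 D \<Longrightarrow> norm v \<le> C * H10_norm D v"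
    using Poincare[OF assms] by metis
  have q: "norm v / H10_norm D v \<le> C" if "v \<in> H10 D" for v
    using C(2)[OF that] C(1) H10_norm_nonneg[of D v]
    by (cases "H10_norm D v = 0") (auto simp: field_simps)
  have bdd: "bdd_above ((\<lambda>v. norm v / H10_norm D v) ` H10 D)"
    using q by (auto intro!: bdd_aboveI2)
  have up: "norm v / H10_norm D v \<le> embedding_const D" if "v \<in> H10 D" for v
    unfolding embedding_const_def onorm_on_def by (rule cSUP_upper[OF that bdd])
  show "0 \<le> embedding_const D"
    using up[OF H10_zero[OF assms(1)]] by simp
  assume v: "v \<in> H10 D"
  show "norm v \<le> embedding_const D * H10_norm D v"
    using up[OF v] C(2)[OF v] H10_norm_nonneg[of D v]
    by (cases "H10_norm D v = 0") (auto simp: field_simps)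
qed

section \<open>Sobolev embedding\<close>

text \<open>Lebesgue measure on the abstract space is recognised by its values on boxes as the image
  of the product measure under the coordinate map. The basis vectors may be listed in any order,
  which later provides the changes in the order of integration.\<close>

lemma nn_integral_lborel_3:
  fixes e1 e2 e3 :: "'a::euclidean_space" and F :: "'a \<Rightarrow> ennreal"
  assumes B: "Basis = {e1, e2, e3}" "e1 \<noteq> e2" "e1 \<noteq> e3" "e2 \<noteq> e3"
    and [measurable]: "F \<in> borel_measurable borel"
  shows "(\<integral>\<^sup>+p. F p \<partial>lborel) = (\<integral>\<^sup>+x. \<integral>\<^sup>+y. \<integral>\<^sup>+z. F (x *\<^sub>R e1 + y *\<^sub>R e2 + z *\<^sub>R e3) \<partial>lborel \<partial>lborel \<partial>lborel)"
proof -
  define T :: "real \<times> real \<times> real \<Rightarrow> 'a" where "T = (\<lambda>(x, y, z). x *\<^sub>R e1 + y *\<^sub>R e2 + z *\<^sub>R e3)"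
  have T_meas [measurable]: "T \<in> measurable borel borel"
    unfolding T_def case_prod_beta by (intro borel_measurable_continuous_onI continuous_intros)
  have e: "e1 \<in> Basis" "e2 \<in> Basis" "e3 \<in> Basis" using B by auto
  have ip: "e1 \<bullet> e1 = 1" "e2 \<bullet> e2 = 1" "e3 \<bullet> e3 = 1" "e1 \<bullet> e2 = 0" "e1 \<bullet> e3 = 0" "e2 \<bullet> e3 = 0"
     "e2 \<bullet> e1 = 0" "e3 \<bullet> e1 = 0" "e3 \<bullet> e2 = 0"
    using B e by (auto simp: inner_Basis)
  have "lborel = distr lborel borel T"
  proof (rule lborel_eqI)
    fix l u :: 'a assume lu: "\<And>b. b \<in> Basis \<Longrightarrow> l \<bullet> b \<le> u \<bullet> b"
    have "T -` box l u = {l \<bullet> e1<..<u \<bullet> e1} \<times> ({l \<bullet> e2<..<u \<bullet> e2} \<times> {l \<bullet> e3<..<u \<bullet> e3})"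
      by (auto simp: T_def mem_box B(1) inner_add_left ip)
    then have "emeasure (distr lborel borel T) (box l u)
      = emeasure lborel ({l \<bullet> e1<..<u \<bullet> e1} \<times> ({l \<bullet> e2<..<u \<bullet> e2} \<times> {l \<bullet> e3<..<u \<bullet> e3}))"
      by (subst emeasure_distr) auto
    also have "\<dots> = emeasure (lborel \<Otimes>\<^sub>M (lborel \<Otimes>\<^sub>M lborel)) ({l \<bullet> e1<..<u \<bullet> e1} \<times> ({l \<bullet> e2<..<u \<bullet> e2} \<times> {l \<bullet> e3<..<u \<bullet> e3}))"
      by (simp only: lborel_prod)
    also have "\<dots> = emeasure lborel {l \<bullet> e1<..<u \<bullet> e1} * (emeasure lborel {l \<bullet> e2<..<u \<bullet> e2} * emeasure lborel {l \<bullet> e3<..<u \<bullet> e3})"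
    proof -
      have sf: "sigma_finite_measure (lborel \<Otimes>\<^sub>M lborel :: (real \<times> real) measure)"
        unfolding lborel_prod by (rule sigma_finite_lborel)
      show ?thesis
        by (subst sigma_finite_measure.emeasure_pair_measure_Times[OF sf]) (auto simp: lborel.emeasure_pair_measure_Times)
    qed
    also have "\<dots> = ennreal ((u - l) \<bullet> e1) * (ennreal ((u - l) \<bullet> e2) * ennreal ((u - l) \<bullet> e3))"
      using lu e by (simp add: inner_diff_left)
    also have "\<dots> = ennreal (\<Prod>b\<in>Basis. (u - l) \<bullet> b)"
      using lu[OF e(1)] lu[OF e(2)] lu[OF e(3)] B(2,3,4) by (simp add: B(1) inner_diff_left ennreal_mult)
    finally show "emeasure (distr lborel borel T) (box l u) = ennreal (\<Prod>b\<in>Basis. (u - l) \<bullet> b)" .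
  qed simp
  then have "(\<integral>\<^sup>+p. F p \<partial>lborel) = (\<integral>\<^sup>+p. F (T p) \<partial>lborel)"
    by (rule trans[OF arg_cong[where f = "\<lambda>M. nn_integral M F"] nn_integral_distr]) auto
  also have "\<dots> = (\<integral>\<^sup>+p. F (T p) \<partial>(lborel \<Otimes>\<^sub>M lborel))"
    by (simp only: lborel_prod)
  also have "\<dots> = (\<integral>\<^sup>+x. \<integral>\<^sup>+q. F (T (x, q)) \<partial>lborel \<partial>lborel)"
    by (subst lborel.nn_integral_fst[symmetric]) (auto simp: lborel_prod)
  also have "\<dots> = (\<integral>\<^sup>+x. \<integral>\<^sup>+q. F (T (x, q)) \<partial>(lborel \<Otimes>\<^sub>M lborel) \<partial>lborel)"
    by (simp only: lborel_prod)
  also have "\<dots> = (\<integral>\<^sup>+x. \<integral>\<^sup>+y. \<integral>\<^sup>+z. F (T (x, y, z)) \<partial>lborel \<partial>lborel \<partial>lborel)"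
    by (intro nn_integral_cong, subst lborel.nn_integral_fst[symmetric]) (auto simp: lborel_prod)
  finally show ?thesis by (simp add: T_def)
qed

lemma nn_integral_lborel_2:
  fixes e1 e2 :: "'a::euclidean_space" and F :: "'a \<Rightarrow> ennreal"
  assumes B: "Basis = {e1, e2}" "e1 \<noteq> e2"
    and [measurable]: "F \<in> borel_measurable borel"
  shows "(\<integral>\<^sup>+p. F p \<partial>lborel) = (\<integral>\<^sup>+x. \<integral>\<^sup>+y. F (x *\<^sub>R e1 + y *\<^sub>R e2) \<partial>lborel \<partial>lborel)"
proof -
  define T :: "real \<times> real \<Rightarrow> 'a" where "T = (\<lambda>(x, y). x *\<^sub>R e1 + y *\<^sub>R e2)"
  have T_meas [measurable]: "T \<in> measurable borel borel"
    unfolding T_def case_prod_beta by (intro borel_measurable_continuous_onI continuous_intros)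
  have e: "e1 \<in> Basis" "e2 \<in> Basis" using B by auto
  have ip: "e1 \<bullet> e1 = 1" "e2 \<bullet> e2 = 1" "e1 \<bullet> e2 = 0" "e2 \<bullet> e1 = 0"
    using B e by (auto simp: inner_Basis)
  have "lborel = distr lborel borel T"
  proof (rule lborel_eqI)
    fix l u :: 'a assume lu: "\<And>b. b \<in> Basis \<Longrightarrow> l \<bullet> b \<le> u \<bullet> b"
    have "T -` box l u = {l \<bullet> e1<..<u \<bullet> e1} \<times> {l \<bullet> e2<..<u \<bullet> e2}"
      by (auto simp: T_def mem_box B(1) inner_add_left ip)
    then have "emeasure (distr lborel borel T) (box l u)
      = emeasure lborel ({l \<bullet> e1<..<u \<bullet> e1} \<times> {l \<bullet> e2<..<u \<bullet> e2})"
      by (subst emeasure_distr) auto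
    also have "\<dots> = emeasure (lborel \<Otimes>\<^sub>M lborel) ({l \<bullet> e1<..<u \<bullet> e1} \<times> {l \<bullet> e2<..<u \<bullet> e2})"
      by (simp only: lborel_prod)
    also have "\<dots> = ennreal ((u - l) \<bullet> e1) * ennreal ((u - l) \<bullet> e2)"
      using lu e by (simp add: lborel.emeasure_pair_measure_Times inner_diff_left)
    also have "\<dots> = ennreal (\<Prod>b\<in>Basis. (u - l) \<bullet> b)"
      using lu[OF e(1)] lu[OF e(2)] B(2) by (simp add: B(1) inner_diff_left ennreal_mult)
    finally show "emeasure (distr lborel borel T) (box l u) = ennreal (\<Prod>b\<in>Basis. (u - l) \<bullet> b)" .
  qed simp
  then have "(\<integral>\<^sup>+p. F p \<partial>lborel) = (\<integral>\<^sup>+p. F (T p) \<partial>lborel)"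
    by (rule trans[OF arg_cong[where f = "\<lambda>M. nn_integral M F"] nn_integral_distr]) auto
  also have "\<dots> = (\<integral>\<^sup>+p. F (T p) \<partial>(lborel \<Otimes>\<^sub>M lborel))"
    by (simp only: lborel_prod)
  also have "\<dots> = (\<integral>\<^sup>+x. \<integral>\<^sup>+y. F (T (x, y)) \<partial>lborel \<partial>lborel)"
    by (subst lborel.nn_integral_fst[symmetric]) (auto simp: lborel_prod)
  finally show ?thesis by (simp add: T_def)
qed

text \<open>Cauchy-Schwarz twice: first in (x, y), which splits off \<open>h\<close>, then in z
  inside \<open>K\<close>. What remains factors, because \<open>f\<close> and \<open>g\<close> share
  only the variable that has been integrated out.\<close>

lemma Loomis_Whitney_3:
  fixes f g h :: "real \<times> real \<Rightarrow> ennreal"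
  assumes [measurable]: "f \<in> borel_measurable borel" "g \<in> borel_measurable borel" "h \<in> borel_measurable borel"
  shows "(\<integral>\<^sup>+x. \<integral>\<^sup>+y. \<integral>\<^sup>+z. f (y, z) * g (x, z) * h (x, y) \<partial>lborel \<partial>lborel \<partial>lborel)\<^sup>2
    \<le> (\<integral>\<^sup>+y. \<integral>\<^sup>+z. (f (y, z))\<^sup>2 \<partial>lborel \<partial>lborel) * (\<integral>\<^sup>+x. \<integral>\<^sup>+z. (g (x, z))\<^sup>2 \<partial>lborel \<partial>lborel)
      * (\<integral>\<^sup>+x. \<integral>\<^sup>+y. (h (x, y))\<^sup>2 \<partial>lborel \<partial>lborel)"
proof -
  define K where "K x y = (\<integral>\<^sup>+z. f (y, z) * g (x, z) \<partial>lborel)" for x y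
  have [measurable]: "f \<in> borel_measurable (lborel \<Otimes>\<^sub>M lborel)" "g \<in> borel_measurable (lborel \<Otimes>\<^sub>M lborel)"
     "h \<in> borel_measurable (lborel \<Otimes>\<^sub>M lborel)" by (simp_all add: lborel_prod)
  have K_meas [measurable]: "(\<lambda>(x, y). K x y) \<in> borel_measurable (lborel \<Otimes>\<^sub>M lborel)"
    unfolding K_def by measurable
  have "(\<integral>\<^sup>+x. \<integral>\<^sup>+y. \<integral>\<^sup>+z. f (y, z) * g (x, z) * h (x, y) \<partial>lborel \<partial>lborel \<partial>lborel)
     = (\<integral>\<^sup>+x. \<integral>\<^sup>+y. K x y * h (x, y) \<partial>lborel \<partial>lborel)"
    unfolding K_def by (intro nn_integral_cong nn_integral_multc) measurable
  also have "\<dots> = (\<integral>\<^sup>+p. (case p of (x, y) \<Rightarrow> K x y) * h p \<partial>(lborel \<Otimes>\<^sub>M lborel))"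
    by (subst lborel.nn_integral_fst[symmetric]) auto
  also have "\<dots>\<^sup>2 \<le> (\<integral>\<^sup>+p. (case p of (x, y) \<Rightarrow> K x y)\<^sup>2 \<partial>(lborel \<Otimes>\<^sub>M lborel)) * (\<integral>\<^sup>+p. (h p)\<^sup>2 \<partial>(lborel \<Otimes>\<^sub>M lborel))"
    by (intro Cauchy_Schwarz_nn_integral) auto
  also have "(\<integral>\<^sup>+p. (h p)\<^sup>2 \<partial>(lborel \<Otimes>\<^sub>M lborel)) = (\<integral>\<^sup>+x. \<integral>\<^sup>+y. (h (x, y))\<^sup>2 \<partial>lborel \<partial>lborel)"
    by (subst lborel.nn_integral_fst[symmetric]) auto
  also have "(\<integral>\<^sup>+p. (case p of (x, y) \<Rightarrow> K x y)\<^sup>2 \<partial>(lborel \<Otimes>\<^sub>M lborel)) = (\<integral>\<^sup>+x. \<integral>\<^sup>+y. (K x y)\<^sup>2 \<partial>lborel \<partial>lborel)"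
    by (subst lborel.nn_integral_fst[symmetric]) auto
  also have "\<dots> \<le> (\<integral>\<^sup>+x. \<integral>\<^sup>+y. (\<integral>\<^sup>+z. (f (y, z))\<^sup>2 \<partial>lborel) * (\<integral>\<^sup>+z. (g (x, z))\<^sup>2 \<partial>lborel) \<partial>lborel \<partial>lborel)"
    unfolding K_def by (intro nn_integral_mono Cauchy_Schwarz_nn_integral) auto
  also have "\<dots> = (\<integral>\<^sup>+y. \<integral>\<^sup>+z. (f (y, z))\<^sup>2 \<partial>lborel \<partial>lborel) * (\<integral>\<^sup>+x. \<integral>\<^sup>+z. (g (x, z))\<^sup>2 \<partial>lborel \<partial>lborel)"
    by (simp add: nn_integral_multc nn_integral_cmult)
  finally show ?thesis
    by (simp add: mult_right_mono)
qed

section \<open>Line integrals and the Gagliardo inequality\<close>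

lemma abs_le_nn_integral_derivative:
  fixes f f' :: "real \<Rightarrow> real"
  assumes d: "\<And>t. (f has_field_derivative f' t) (at t)" and c: "continuous_on UNIV f'"
    and z: "\<And>t. \<bar>t\<bar> > R \<Longrightarrow> f t = 0"
  shows "ennreal \<bar>f s\<bar> \<le> (\<integral>\<^sup>+t. ennreal \<bar>f' t\<bar> \<partial>lborel)"
proof -
  \<comment> \<open>A point not to the right of \<open>s\<close> and to the left of the support; the
    absolute value of \<open>R\<close> covers negative \<open>R\<close>.\<close>
  define a where "a = min s (- \<bar>R\<bar> - 1)"
  have a: "a \<le> s" "f a = 0" unfolding a_def by (auto intro!: z)
  have i: "has_bochner_integral lborel (\<lambda>x. f' x * indicator {a .. s} x) (f s - f a)"
    by (rule has_bochner_integral_FTC_Icc_real[OF a(1) d]) (use c in \<open>simp add: continuous_on_eq_continuous_at\<close>)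
  then have "ennreal \<bar>f s\<bar> = ennreal (norm (\<integral>x. f' x * indicator {a .. s} x \<partial>lborel))"
    using a(2) by (simp add: has_bochner_integral_iff)
  also have "\<dots> \<le> (\<integral>\<^sup>+x. ennreal (norm (f' x * indicator {a .. s} x)) \<partial>lborel)"
    using i by (intro integral_norm_bound_ennreal) (simp add: has_bochner_integral_iff)
  also have "\<dots> \<le> (\<integral>\<^sup>+t. ennreal \<bar>f' t\<bar> \<partial>lborel)"
    by (intro nn_integral_mono ennreal_leI) (auto simp: indicator_def)
  finally show ?thesis .
qed

lemma test_function_line_bound:
  fixes w :: "'a::euclidean_space \<Rightarrow> real"
  assumes w: "w \<in> test_functions D" and e: "norm e = 1"
  shows "ennreal \<bar>w (p + s *\<^sub>R e)\<bar> \<le> (\<integral>\<^sup>+t. ennreal \<bar>frechet_derivative w (at (p + t *\<^sub>R e)) e\<bar> \<partial>lborel)"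
proof -
  obtain K where K: "compact K" "\<And>x. x \<notin> K \<Longrightarrow> w x = 0" using test_functionsE[OF w] by metis
  obtain R where R: "\<And>x. x \<in> K \<Longrightarrow> norm x \<le> R"
    using K(1) by (meson bounded_iff compact_imp_bounded)
  show ?thesis
  proof (rule abs_le_nn_integral_derivative[where f = "\<lambda>s. w (p + s *\<^sub>R e)" and R = "R + norm p"])
    fix t :: real
    let ?d = "frechet_derivative w (at (p + t *\<^sub>R e))"
    have "((\<lambda>s. w (p + s *\<^sub>R e)) has_derivative (\<lambda>s. ?d (s *\<^sub>R e))) (at t)"
      by (rule has_derivative_compose[of "\<lambda>s. p + s *\<^sub>R e" "\<lambda>s. s *\<^sub>R e" t UNIV w])
         (auto intro!: derivative_eq_intros test_functionsD(2)[OF w])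
    moreover have "?d (s *\<^sub>R e) = ?d e * s" for s
      using has_derivative_linear[OF test_functionsD(2)[OF w]] by (simp add: linear_cmul)
    ultimately show "((\<lambda>s. w (p + s *\<^sub>R e)) has_field_derivative ?d e) (at t)"
      by (simp add: has_field_derivative_def)
  next
    show "continuous_on UNIV (\<lambda>t. frechet_derivative w (at (p + t *\<^sub>R e)) e)"
      by (rule continuous_on_compose2[OF test_functionsD(4)[OF w]]) (auto intro!: continuous_intros)
  next
    fix t :: real assume "\<bar>t\<bar> > R + norm p"
    then have "norm (p + t *\<^sub>R e) > R"
      using norm_triangle_ineq2[of "t *\<^sub>R e" "- p"] e by (simp add: add.commute)
    then show "w (p + t *\<^sub>R e) = 0" using R K(2) by (meson not_le)
  qed
qed

text \<open>Applied to a derivative of a test function, this finiteness allows the square roots in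
  \<open>Gagliardo_3\<close> to be taken in the reals.\<close>

lemma test_function_line_finite:
  fixes w :: "'a::euclidean_space \<Rightarrow> real"
  assumes w: "w \<in> test_functions D" and e: "norm e = 1"
  shows "(\<integral>\<^sup>+t. ennreal \<bar>w (p + t *\<^sub>R e)\<bar> \<partial>lborel) < \<infinity>"
proof -
  obtain K where K: "compact K" "\<And>x. x \<notin> K \<Longrightarrow> w x = 0" using test_functionsE[OF w] by metis
  obtain R where R: "\<And>x. x \<in> K \<Longrightarrow> norm x \<le> R"
    using K(1) by (meson bounded_iff compact_imp_bounded)
  have "integrable lborel (\<lambda>t. w (p + t *\<^sub>R e))"
  proof (rule integrable_compact_support[of _ "cball 0 (R + norm p)"])
    show "continuous_on UNIV (\<lambda>t. w (p + t *\<^sub>R e))"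
      by (rule continuous_on_compose2[OF test_functionsD(3)[OF w]]) (auto intro!: continuous_intros)
    fix t :: real assume "t \<notin> cball 0 (R + norm p)"
    then have "\<bar>t\<bar> > R + norm p" by (simp add: dist_norm)
    then have "norm (p + t *\<^sub>R e) > R"
      using norm_triangle_ineq2[of "t *\<^sub>R e" "- p"] e by (simp add: add.commute)
    then show "w (p + t *\<^sub>R e) = 0" using R K(2) by (meson not_le)
  qed simp
  then show ?thesis by (simp add: integrable_iff_bounded)
qed

text \<open>The power 3/2 of \<open>\<bar>w\<bar>\<close> is a product of three square roots, one
  per axis. Each is bounded by the root of the integral of a partial derivative along that axis,
  which does not depend on the corresponding coordinate. This is the product structure of the
  Loomis-Whitney inequality.\<close>

lemma Gagliardo_3:
  fixes e1 e2 e3 :: "'a::euclidean_space"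
  assumes B: "Basis = {e1, e2, e3}" "e1 \<noteq> e2" "e1 \<noteq> e3" "e2 \<noteq> e3"
    and w: "w \<in> test_functions D"
  shows "(\<integral>\<^sup>+p. ennreal (sqrt \<bar>w p\<bar> ^ 3) \<partial>lborel)\<^sup>2
    \<le> (\<integral>\<^sup>+p. ennreal \<bar>frechet_derivative w (at p) e1\<bar> \<partial>lborel)
      * (\<integral>\<^sup>+p. ennreal \<bar>frechet_derivative w (at p) e2\<bar> \<partial>lborel)
      * (\<integral>\<^sup>+p. ennreal \<bar>frechet_derivative w (at p) e3\<bar> \<partial>lborel)"
proof -
  have e: "norm e1 = 1" "norm e2 = 1" "norm e3 = 1" by (auto intro!: norm_Basis simp: B(1))
  define a where "a i p = ennreal \<bar>frechet_derivative w (at p) i\<bar>" for i p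
  have am [measurable]: "a i \<in> borel_measurable borel" for i
    using test_functions_measurable[OF test_functions_deriv[OF w]] unfolding a_def by measurable
  have [measurable]: "w \<in> borel_measurable borel" by (rule test_functions_measurable[OF w])
  \<comment> \<open>The integral of the derivative in direction \<open>i\<close> over the line
    parallel to \<open>i\<close> whose coordinates along \<open>j\<close> and \<open>k\<close> are
    given by \<open>q\<close>; \<open>g\<close> is its square root.\<close>
  define G where "G i j k q = (\<integral>\<^sup>+t. a i (t *\<^sub>R i + fst q *\<^sub>R j + snd q *\<^sub>R k) \<partial>lborel)" for i j k and q :: "real \<times> real"
  define g where "g i j k q = ennreal (sqrt (enn2real (G i j k q)))" for i j k q
  have Gm [measurable]: "G i j k \<in> borel_measurable borel" for i j k
  proof -
    have "(\<lambda>z. snd z *\<^sub>R i + fst (fst z) *\<^sub>R j + snd (fst z) *\<^sub>R k) \<in> borel_measurable (borel :: ((real \<times> real) \<times> real) measure)"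
      by (intro borel_measurable_continuous_onI continuous_intros)
    then have "(\<lambda>z. a i (snd z *\<^sub>R i + fst (fst z) *\<^sub>R j + snd (fst z) *\<^sub>R k)) \<in> borel_measurable (lborel \<Otimes>\<^sub>M (lborel :: real measure))"
      unfolding lborel_prod by (intro measurable_compose[OF _ am]) simp
    from lborel.borel_measurable_nn_integral[of "\<lambda>q t. a i (t *\<^sub>R i + fst q *\<^sub>R j + snd q *\<^sub>R k)" lborel] this
    show ?thesis unfolding G_def by (simp add: case_prod_beta)
  qed
  have gm [measurable]: "g i j k \<in> borel_measurable borel" for i j k
    unfolding g_def by measurable
  have Gfin: "G i j k q < \<infinity>" if "norm i = 1" for i j k q
    using test_function_line_finite[OF test_functions_deriv[OF w] that, of "fst q *\<^sub>R j + snd q *\<^sub>R k" i]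
    by (simp add: G_def a_def algebra_simps)
  have gsq: "(g i j k q)\<^sup>2 = G i j k q" if "norm i = 1" for i j k q
  proof -
    have "(ennreal (sqrt x))\<^sup>2 = ennreal x" if "x \<ge> 0" for x
      using that by (simp add: ennreal_power)
    then show ?thesis
      using Gfin[OF that, of j k q] unfolding g_def by simp
  qed
  have bound: "ennreal (sqrt \<bar>w (s *\<^sub>R i + fst q *\<^sub>R j + snd q *\<^sub>R k)\<bar>) \<le> g i j k q" if "norm i = 1" for i j k q s
  proof -
    have "ennreal \<bar>w (s *\<^sub>R i + fst q *\<^sub>R j + snd q *\<^sub>R k)\<bar> \<le> G i j k q"
      using test_function_line_bound[OF w that, of "fst q *\<^sub>R j + snd q *\<^sub>R k" s]
      by (simp add: G_def a_def algebra_simps)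
    then have "\<bar>w (s *\<^sub>R i + fst q *\<^sub>R j + snd q *\<^sub>R k)\<bar> \<le> enn2real (G i j k q)"
      using Gfin[OF that, of j k q]
      by (metis abs_ge_zero enn2real_ennreal enn2real_mono infinity_ennreal_def)
    then show ?thesis unfolding g_def by (intro ennreal_leI) simp
  qed
  have "(\<integral>\<^sup>+p. ennreal (sqrt \<bar>w p\<bar> ^ 3) \<partial>lborel)
    = (\<integral>\<^sup>+x. \<integral>\<^sup>+y. \<integral>\<^sup>+z. ennreal (sqrt \<bar>w (x *\<^sub>R e1 + y *\<^sub>R e2 + z *\<^sub>R e3)\<bar> ^ 3) \<partial>lborel \<partial>lborel \<partial>lborel)"
    by (rule nn_integral_lborel_3[OF B]) measurable
  also have "\<dots> \<le> (\<integral>\<^sup>+x. \<integral>\<^sup>+y. \<integral>\<^sup>+z. g e1 e2 e3 (y, z) * g e2 e1 e3 (x, z) * g e3 e1 e2 (x, y) \<partial>lborel \<partial>lborel \<partial>lborel)"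
  proof (intro nn_integral_mono)
    fix x y z :: real
    let ?r = "sqrt \<bar>w (x *\<^sub>R e1 + y *\<^sub>R e2 + z *\<^sub>R e3)\<bar>"
    have "ennreal (?r ^ 3) = ennreal ?r * ennreal ?r * ennreal ?r"
    proof -
      have "ennreal (c ^ 3) = ennreal c * ennreal c * ennreal c" if "c \<ge> 0" for c
        using that by (simp add: power3_eq_cube ennreal_mult)
      then show ?thesis by simp
    qed
    also have "\<dots> \<le> g e1 e2 e3 (y, z) * g e2 e1 e3 (x, z) * g e3 e1 e2 (x, y)"
      using bound[OF e(1), of x "(y, z)" e2 e3] bound[OF e(2), of y "(x, z)" e1 e3] bound[OF e(3), of z "(x, y)" e1 e2]
      by (intro mult_mono) (auto simp: add_ac)
    finally show "ennreal (?r ^ 3) \<le> g e1 e2 e3 (y, z) * g e2 e1 e3 (x, z) * g e3 e1 e2 (x, y)" .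
  qed
  also have "(\<dots>)\<^sup>2 \<le> (\<integral>\<^sup>+y. \<integral>\<^sup>+z. (g e1 e2 e3 (y, z))\<^sup>2 \<partial>lborel \<partial>lborel) * (\<integral>\<^sup>+x. \<integral>\<^sup>+z. (g e2 e1 e3 (x, z))\<^sup>2 \<partial>lborel \<partial>lborel)
      * (\<integral>\<^sup>+x. \<integral>\<^sup>+y. (g e3 e1 e2 (x, y))\<^sup>2 \<partial>lborel \<partial>lborel)"
    by (intro Loomis_Whitney_3) measurable
  also have "\<dots> = (\<integral>\<^sup>+p. a e1 p \<partial>lborel) * (\<integral>\<^sup>+p. a e2 p \<partial>lborel) * (\<integral>\<^sup>+p. a e3 p \<partial>lborel)"
  proof -
    have "(\<integral>\<^sup>+y. \<integral>\<^sup>+z. (g e1 e2 e3 (y, z))\<^sup>2 \<partial>lborel \<partial>lborel) = (\<integral>\<^sup>+p. a e1 p \<partial>lborel)"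
      by (subst nn_integral_lborel_3[of e2 e3 e1 "a e1"]) (use B in \<open>auto simp: gsq[OF e(1)] G_def add_ac\<close>)
    moreover have "(\<integral>\<^sup>+x. \<integral>\<^sup>+z. (g e2 e1 e3 (x, z))\<^sup>2 \<partial>lborel \<partial>lborel) = (\<integral>\<^sup>+p. a e2 p \<partial>lborel)"
      by (subst nn_integral_lborel_3[of e1 e3 e2 "a e2"]) (use B in \<open>auto simp: gsq[OF e(2)] G_def add_ac\<close>)
    moreover have "(\<integral>\<^sup>+x. \<integral>\<^sup>+y. (g e3 e1 e2 (x, y))\<^sup>2 \<partial>lborel \<partial>lborel) = (\<integral>\<^sup>+p. a e3 p \<partial>lborel)"
      by (subst nn_integral_lborel_3[of e1 e2 e3 "a e3"]) (use B in \<open>auto simp: gsq[OF e(3)] G_def add_ac\<close>)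
    ultimately show ?thesis by simp
  qed
  finally show ?thesis
    by (simp add: a_def power_mono)
qed

text \<open>In the plane each of the two factors \<open>\<bar>w\<bar>\<close> is bounded by a line
  integral that depends on one coordinate only, and on different ones, so the double integral
  factors.\<close>

lemma Gagliardo_2:
  fixes e1 e2 :: "'a::euclidean_space"
  assumes B: "Basis = {e1, e2}" "e1 \<noteq> e2"
    and w: "w \<in> test_functions D"
  shows "(\<integral>\<^sup>+p. ennreal ((w p)\<^sup>2) \<partial>lborel)
    \<le> (\<integral>\<^sup>+p. ennreal \<bar>frechet_derivative w (at p) e1\<bar> \<partial>lborel)
      * (\<integral>\<^sup>+p. ennreal \<bar>frechet_derivative w (at p) e2\<bar> \<partial>lborel)"
proof -
  have e: "norm e1 = 1" "norm e2 = 1" by (auto intro!: norm_Basis simp: B(1))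
  define a where "a i p = ennreal \<bar>frechet_derivative w (at p) i\<bar>" for i p
  have am [measurable]: "a i \<in> borel_measurable borel" for i
    using test_functions_measurable[OF test_functions_deriv[OF w]] unfolding a_def by measurable
  have [measurable]: "w \<in> borel_measurable borel" by (rule test_functions_measurable[OF w])
  define G where "G i j y = (\<integral>\<^sup>+t. a i (t *\<^sub>R i + y *\<^sub>R j) \<partial>lborel)" for i j and y :: real
  have Gm [measurable]: "G i j \<in> borel_measurable borel" for i j
  proof -
    have "(\<lambda>z. snd z *\<^sub>R i + fst z *\<^sub>R j) \<in> borel_measurable (borel :: (real \<times> real) measure)"
      by (intro borel_measurable_continuous_onI continuous_intros)
    then have "(\<lambda>z. a i (snd z *\<^sub>R i + fst z *\<^sub>R j)) \<in> borel_measurable (lborel \<Otimes>\<^sub>M (lborel :: real measure))"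
      unfolding lborel_prod by (intro measurable_compose[OF _ am]) simp
    from lborel.borel_measurable_nn_integral[of "\<lambda>q t. a i (t *\<^sub>R i + q *\<^sub>R j)" lborel] this
    show ?thesis unfolding G_def by (simp add: case_prod_beta)
  qed
  have "(\<integral>\<^sup>+p. ennreal ((w p)\<^sup>2) \<partial>lborel)
    = (\<integral>\<^sup>+x. \<integral>\<^sup>+y. ennreal ((w (x *\<^sub>R e1 + y *\<^sub>R e2))\<^sup>2) \<partial>lborel \<partial>lborel)"
    by (rule nn_integral_lborel_2[OF B]) measurable
  also have "\<dots> \<le> (\<integral>\<^sup>+x. \<integral>\<^sup>+y. G e1 e2 y * G e2 e1 x \<partial>lborel \<partial>lborel)"
  proof (intro nn_integral_mono)
    fix x y :: real
    let ?r = "\<bar>w (x *\<^sub>R e1 + y *\<^sub>R e2)\<bar>"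
    have "ennreal ((w (x *\<^sub>R e1 + y *\<^sub>R e2))\<^sup>2) = ennreal ?r * ennreal ?r"
      by (simp add: power2_eq_square flip: ennreal_mult)
    also have "\<dots> \<le> G e1 e2 y * G e2 e1 x"
      using test_function_line_bound[OF w e(1), of "y *\<^sub>R e2" x] test_function_line_bound[OF w e(2), of "x *\<^sub>R e1" y]
      by (intro mult_mono) (auto simp: G_def a_def add_ac)
    finally show "ennreal ((w (x *\<^sub>R e1 + y *\<^sub>R e2))\<^sup>2) \<le> G e1 e2 y * G e2 e1 x" .
  qed
  also have "\<dots> = (\<integral>\<^sup>+y. G e1 e2 y \<partial>lborel) * (\<integral>\<^sup>+x. G e2 e1 x \<partial>lborel)"
    by (simp add: nn_integral_multc nn_integral_cmult)
  also have "\<dots> = (\<integral>\<^sup>+p. a e1 p \<partial>lborel) * (\<integral>\<^sup>+p. a e2 p \<partial>lborel)"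
  proof -
    have "(\<integral>\<^sup>+p. a e1 p \<partial>lborel) = (\<integral>\<^sup>+y. \<integral>\<^sup>+t. a e1 (y *\<^sub>R e2 + t *\<^sub>R e1) \<partial>lborel \<partial>lborel)"
      by (rule nn_integral_lborel_2[OF _ _ am]) (use B in auto)
    then have "(\<integral>\<^sup>+y. G e1 e2 y \<partial>lborel) = (\<integral>\<^sup>+p. a e1 p \<partial>lborel)"
      unfolding G_def by (simp only: add.commute)
    moreover have "(\<integral>\<^sup>+p. a e2 p \<partial>lborel) = (\<integral>\<^sup>+x. \<integral>\<^sup>+t. a e2 (x *\<^sub>R e1 + t *\<^sub>R e2) \<partial>lborel \<partial>lborel)"
      by (rule nn_integral_lborel_2[OF _ _ am]) (use B in auto)
    then have "(\<integral>\<^sup>+y. G e2 e1 y \<partial>lborel) = (\<integral>\<^sup>+p. a e2 p \<partial>lborel)"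
      unfolding G_def by (simp only: add.commute)
    ultimately show ?thesis by simp
  qed
  finally show ?thesis by (simp add: a_def)
qed

text \<open>Feeds a power of a test function into the Gagliardo inequalities: the derivative of
  \<phi>^k is k \<phi>^(k-1) times a derivative of \<phi>, and Cauchy-Schwarz separates the power
  from the gradient.\<close>

lemma power_derivative_integral_bound:
  fixes \<phi> :: "'a::euclidean_space \<Rightarrow> real"
  assumes p: "\<phi> \<in> test_functions D" and e: "e \<in> Basis" and k: "k > 0"
  shows "(\<integral>\<^sup>+x. ennreal \<bar>frechet_derivative (\<lambda>x. \<phi> x ^ k) (at x) e\<bar> \<partial>lborel)\<^sup>2
    \<le> ennreal ((real k)\<^sup>2) * (\<integral>\<^sup>+x. ennreal (\<phi> x ^ (2 * k - 2)) \<partial>lborel) * ennreal ((norm (abs_L2 (grad \<phi>)))\<^sup>2)"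
proof -
  note [measurable] = test_functions_measurable[OF p] test_functions_measurable[OF test_functions_deriv[OF p]]
  have eq: "ennreal \<bar>frechet_derivative (\<lambda>x. \<phi> x ^ k) (at x) e\<bar>
     = ennreal (real k * \<bar>\<phi> x\<bar> ^ (k - 1)) * ennreal \<bar>frechet_derivative \<phi> (at x) e\<bar>" for x
    by (subst frechet_derivative_power_real[OF test_functionsD(2)[OF p]])
       (simp add: abs_mult power_abs flip: ennreal_mult)
  have "(\<integral>\<^sup>+x. ennreal \<bar>frechet_derivative (\<lambda>x. \<phi> x ^ k) (at x) e\<bar> \<partial>lborel)\<^sup>2
     \<le> (\<integral>\<^sup>+x. (ennreal (real k * \<bar>\<phi> x\<bar> ^ (k - 1)))\<^sup>2 \<partial>lborel) * (\<integral>\<^sup>+x. (ennreal \<bar>frechet_derivative \<phi> (at x) e\<bar>)\<^sup>2 \<partial>lborel)"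
    unfolding eq by (intro Cauchy_Schwarz_nn_integral) measurable
  also have "(\<integral>\<^sup>+x. (ennreal (real k * \<bar>\<phi> x\<bar> ^ (k - 1)))\<^sup>2 \<partial>lborel)
      = (\<integral>\<^sup>+x. ennreal ((real k)\<^sup>2) * ennreal (\<phi> x ^ (2 * k - 2)) \<partial>lborel)"
  proof (intro nn_integral_cong)
    fix x
    obtain m where m: "k = Suc m" using k by (cases k) auto
    have "(\<bar>\<phi> x\<bar> ^ m)\<^sup>2 = (\<bar>\<phi> x\<bar>\<^sup>2) ^ m"
      by (simp only: power_mult[symmetric] mult.commute)
    also have "\<dots> = \<phi> x ^ (2 * m)"
      by (simp add: power_mult)
    finally have "(\<bar>\<phi> x\<bar> ^ (k - 1))\<^sup>2 = \<phi> x ^ (2 * k - 2)"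
      by (simp add: m)
    then have *: "(real k * \<bar>\<phi> x\<bar> ^ (k - 1))\<^sup>2 = (real k)\<^sup>2 * \<phi> x ^ (2 * k - 2)"
      by (simp add: power_mult_distrib)
    have "(ennreal (real k * \<bar>\<phi> x\<bar> ^ (k - 1)))\<^sup>2 = ennreal ((real k * \<bar>\<phi> x\<bar> ^ (k - 1))\<^sup>2)"
      by (rule ennreal_power) simp
    also have "\<dots> = ennreal ((real k)\<^sup>2) * ennreal (\<phi> x ^ (2 * k - 2))"
      unfolding * by (rule ennreal_mult) (auto intro!: zero_le_even_power)
    finally show "(ennreal (real k * \<bar>\<phi> x\<bar> ^ (k - 1)))\<^sup>2 = ennreal ((real k)\<^sup>2) * ennreal (\<phi> x ^ (2 * k - 2))" .
  qed
  also have "\<dots> = ennreal ((real k)\<^sup>2) * (\<integral>\<^sup>+x. ennreal (\<phi> x ^ (2 * k - 2)) \<partial>lborel)"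
    by (intro nn_integral_cmult) measurable
  also have "(\<integral>\<^sup>+x. (ennreal \<bar>frechet_derivative \<phi> (at x) e\<bar>)\<^sup>2 \<partial>lborel) \<le> (\<integral>\<^sup>+x. ennreal ((norm (grad \<phi> x))\<^sup>2) \<partial>lborel)"
  proof (intro nn_integral_mono)
    fix x
    have "\<bar>frechet_derivative \<phi> (at x) e\<bar> \<le> norm (grad \<phi> x)"
      using Basis_le_norm[OF e, of "grad \<phi> x"] by (simp add: grad_inner_Basis[OF e])
    then have "\<bar>frechet_derivative \<phi> (at x) e\<bar>\<^sup>2 \<le> (norm (grad \<phi> x))\<^sup>2"
      by (intro power_mono) auto
    then show "(ennreal \<bar>frechet_derivative \<phi> (at x) e\<bar>)\<^sup>2 \<le> ennreal ((norm (grad \<phi> x))\<^sup>2)"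
      by (simp add: ennreal_power ennreal_leI)
  qed
  also have "\<dots> = ennreal ((norm (abs_L2 (grad \<phi>)))\<^sup>2)"
    using nn_integral_eq_integral[of lborel "\<lambda>x. (norm (grad \<phi> x))\<^sup>2"] sq_int_grad[OF p]
    by (simp add: norm_abs_L2_sq sq_int_def)
  finally show ?thesis by (simp add: mult_left_mono)
qed

lemma nn_integral_test_power:
  assumes "\<phi> \<in> test_functions D" "k > 0"
  shows "(\<integral>\<^sup>+x. ennreal (\<phi> x ^ (2 * k)) \<partial>lborel) = ennreal (\<integral>x. \<phi> x ^ (2 * k) \<partial>lborel)"
    "0 \<le> (\<integral>x. \<phi> x ^ (2 * k) \<partial>lborel)"
  using test_functions_integrable[OF test_functions_power[OF assms(1), of "2 * k"]] assms(2)
  by (auto intro!: nn_integral_eq_integral)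

text \<open>The fourth power is chosen because the power 3/2 of it and the power 2 * 4 - 2 from
  Cauchy-Schwarz both equal 6. The same integral \<open>r\<close> thus stands on both sides, r^4
  \<le> (16 r n)^3, and can be cancelled since it is finite. The constant 4096 is 16^3.\<close>

lemma Sobolev_test_3:
  fixes D :: "'a::euclidean_space set"
  assumes "DIM('a) = 3" and p: "\<phi> \<in> test_functions D"
  shows "(\<integral>x. \<phi> x ^ 6 \<partial>lborel) \<le> 4096 * norm (abs_L2 (grad \<phi>)) ^ 6"
proof -
  obtain e1 e2 e3 :: 'a where B: "Basis = {e1, e2, e3}" "e1 \<noteq> e2" "e1 \<noteq> e3" "e2 \<noteq> e3"
    using assms(1) by (auto simp: card_3_iff)
  define r where "r = (\<integral>x. \<phi> x ^ 6 \<partial>lborel)"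
  define n where "n = (norm (abs_L2 (grad \<phi>)))\<^sup>2"
  define W where "W e = (\<integral>\<^sup>+x. ennreal \<bar>frechet_derivative (\<lambda>x. \<phi> x ^ 4) (at x) e\<bar> \<partial>lborel)" for e
  have r: "(\<integral>\<^sup>+x. ennreal (\<phi> x ^ 6) \<partial>lborel) = ennreal r" "0 \<le> r"
    using nn_integral_test_power[OF p, of 3] by (auto simp: r_def)
  have n: "0 \<le> n" by (simp add: n_def)
  have W: "(W e)\<^sup>2 \<le> ennreal (16 * r * n)" if "e \<in> Basis" for e
    using power_derivative_integral_bound[OF p that, of 4] r n
    by (simp add: W_def n_def[symmetric] ennreal_mult mult.assoc)
  have sq: "sqrt \<bar>\<phi> x ^ 4\<bar> ^ 3 = \<phi> x ^ 6" for x
  proof -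
    have "sqrt \<bar>\<phi> x ^ 4\<bar> = (\<phi> x)\<^sup>2"
      by (rule real_sqrt_unique) (auto simp: power_mult[symmetric])
    then show ?thesis by (simp add: power_mult[symmetric])
  qed
  have "(ennreal r)\<^sup>2 \<le> W e1 * W e2 * W e3"
    using Gagliardo_3[OF B test_functions_power[OF p zero_neq_numeral[symmetric, of "num.Bit0 (num.Bit0 num.One)"]]]
    unfolding sq r(1) W_def .
  then have "((ennreal r)\<^sup>2)\<^sup>2 \<le> (W e1 * W e2 * W e3)\<^sup>2"
    by (rule power_mono) simp
  also have "\<dots> = (W e1)\<^sup>2 * (W e2)\<^sup>2 * (W e3)\<^sup>2"
    by (simp add: power_mult_distrib)
  also have "\<dots> \<le> ennreal (16 * r * n) * ennreal (16 * r * n) * ennreal (16 * r * n)"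
    using B by (intro mult_mono W) auto
  also have "\<dots> = ennreal ((16 * r * n) ^ 3)"
  proof -
    have "ennreal c * ennreal c * ennreal c = ennreal (c ^ 3)" if "c \<ge> 0" for c
      using that by (simp add: power3_eq_cube ennreal_mult)
    from this[of "16 * r * n"] show ?thesis using r n by simp
  qed
  finally have "ennreal (r ^ 4) \<le> ennreal ((16 * r * n) ^ 3)"
    using r by (simp add: ennreal_power power_mult[symmetric])
  then have "r ^ 4 \<le> (16 * r * n) ^ 3"
    using r n by (subst (asm) ennreal_le_iff) auto
  then have "r ^ 3 * r \<le> r ^ 3 * (4096 * n ^ 3)"
    by (simp add: power_mult_distrib power3_eq_cube power4_eq_xxxx mult_ac)
  then have "r \<le> 4096 * n ^ 3"
    using r n by (cases "r = 0") (auto simp: mult_le_cancel_left)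
  then show ?thesis by (simp add: r_def n_def power_mult[symmetric])
qed

text \<open>With the power k + 1 of \<phi> in \<open>Gagliardo_2\<close>, Cauchy-Schwarz leaves the
  power 2k under the integral. So the exponent grows by 2 at the price of one squared gradient norm,
  which is the induction step for arbitrary even exponents.\<close>

lemma Sobolev_test_2:
  fixes D :: "'a::euclidean_space set"
  assumes "DIM('a) = 2" and p: "\<phi> \<in> test_functions D" and k: "k > 0"
  shows "(\<integral>x. \<phi> x ^ (2 * Suc k) \<partial>lborel) \<le> (real (Suc k))\<^sup>2 * (\<integral>x. \<phi> x ^ (2 * k) \<partial>lborel) * (norm (abs_L2 (grad \<phi>)))\<^sup>2"
proof -
  obtain e1 e2 :: 'a where B: "Basis = {e1, e2}" "e1 \<noteq> e2"
    using assms(1) by (auto simp: card_2_iff)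
  define r where "r = (\<integral>x. \<phi> x ^ (2 * Suc k) \<partial>lborel)"
  define s where "s = (\<integral>x. \<phi> x ^ (2 * k) \<partial>lborel)"
  define n where "n = (norm (abs_L2 (grad \<phi>)))\<^sup>2"
  define W where "W e = (\<integral>\<^sup>+x. ennreal \<bar>frechet_derivative (\<lambda>x. \<phi> x ^ Suc k) (at x) e\<bar> \<partial>lborel)" for e
  have r: "(\<integral>\<^sup>+x. ennreal (\<phi> x ^ (2 * Suc k)) \<partial>lborel) = ennreal r" "0 \<le> r"
    unfolding r_def by (rule nn_integral_test_power[OF p], simp)+
  have s: "(\<integral>\<^sup>+x. ennreal (\<phi> x ^ (2 * k)) \<partial>lborel) = ennreal s" "0 \<le> s"
    unfolding s_def by (rule nn_integral_test_power[OF p k])+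
  have n: "0 \<le> n" by (simp add: n_def)
  define c where "c = (real (Suc k))\<^sup>2 * s * n"
  have c: "0 \<le> c" unfolding c_def using s n by auto
  have W: "(W e)\<^sup>2 \<le> ennreal c" if "e \<in> Basis" for e
    using power_derivative_integral_bound[OF p that, of "Suc k"] s n
    by (simp add: W_def n_def[symmetric] c_def ennreal_mult del: of_nat_Suc power_Suc)
  have "ennreal r \<le> W e1 * W e2"
    using Gagliardo_2[OF B test_functions_power[OF p, of "Suc k"]] r(1)
    by (simp add: W_def power_mult[symmetric] mult.commute del: power_Suc)
  then have "(ennreal r)\<^sup>2 \<le> (W e1 * W e2)\<^sup>2"
    by (rule power_mono) simp
  also have "\<dots> = (W e1)\<^sup>2 * (W e2)\<^sup>2"
    by (simp add: power_mult_distrib)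
  also have "\<dots> \<le> ennreal c * ennreal c"
    using B by (intro mult_mono W) auto
  also have "\<dots> = ennreal (c\<^sup>2)"
    using c by (simp add: power2_eq_square ennreal_mult)
  finally have "r\<^sup>2 \<le> c\<^sup>2"
    using r c by (simp add: ennreal_power)
  then have "r \<le> c" using c by (rule power2_le_imp_le)
  then show ?thesis by (simp add: r_def c_def s_def n_def)
qed

text \<open>In the plane the induction starts from the Poincare inequality, the case of exponent 2.
  In space only the critical exponent 6 is treated.\<close>

lemma Sobolev_test:
  fixes D :: "'a::euclidean_space set"
  assumes D: "open D" "bounded D" and k: "k > 0" and dim: "DIM('a) = 2 \<or> DIM('a) = 3 \<and> k = 3"
  obtains K where "K \<ge> 0" "\<And>\<phi>. \<phi> \<in> test_functions D \<Longrightarrow>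
    (\<integral>x. \<phi> x ^ (2 * k) \<partial>lborel) \<le> K * norm (abs_L2 (grad \<phi>)) ^ (2 * k)"
proof (cases "DIM('a) = 3 \<and> k = 3")
  case True
  then show ?thesis using Sobolev_test_3[of _ D] by (intro that[of 4096]) auto
next
  case False
  then have dim: "DIM('a) = 2" using dim by auto
  have "\<exists>K\<ge>0. \<forall>\<phi>\<in>test_functions D. (\<integral>x. \<phi> x ^ (2 * k) \<partial>lborel) \<le> K * norm (abs_L2 (grad \<phi>)) ^ (2 * k)"
    using k
  proof (induction k rule: nat_induct_non_zero)
    case 1
    obtain C where C: "C \<ge> 0" "\<And>v. v \<in> H10 D \<Longrightarrow> norm v \<le> C * H10_norm D v"
      using Poincare[OF D] by metis
    show ?case
    proof (intro exI[of _ "C\<^sup>2"] conjI ballI)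
      fix \<phi> assume p: "\<phi> \<in> test_functions D"
      have "norm (abs_L2 \<phi>) \<le> C * norm (abs_L2 (grad \<phi>))"
        using C(2)[OF test_functions_H10[OF D(1) p]] test_function_H1(2)[OF D(1) p] by (simp add: H10_norm_def)
      then have "(norm (abs_L2 \<phi>))\<^sup>2 \<le> (C * norm (abs_L2 (grad \<phi>)))\<^sup>2"
        by (intro power_mono) auto
      then show "(\<integral>x. \<phi> x ^ (2 * 1) \<partial>lborel) \<le> C\<^sup>2 * norm (abs_L2 (grad \<phi>)) ^ (2 * 1)"
        by (simp add: norm_abs_L2_sq[OF test_functions_sq_int[OF p]] power_mult_distrib)
    qed simp
  next
    case (Suc k)
    then obtain K where K: "K \<ge> 0" "\<And>\<phi>. \<phi> \<in> test_functions D \<Longrightarrow>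
      (\<integral>x. \<phi> x ^ (2 * k) \<partial>lborel) \<le> K * norm (abs_L2 (grad \<phi>)) ^ (2 * k)" by blast
    show ?case
    proof (intro exI[of _ "(real (Suc k))\<^sup>2 * K"] conjI ballI)
      fix \<phi> assume p: "\<phi> \<in> test_functions D"
      have "(\<integral>x. \<phi> x ^ (2 * Suc k) \<partial>lborel) \<le> (real (Suc k))\<^sup>2 * (\<integral>x. \<phi> x ^ (2 * k) \<partial>lborel) * (norm (abs_L2 (grad \<phi>)))\<^sup>2"
        by (rule Sobolev_test_2[OF dim p \<open>k > 0\<close>])
      also have "\<dots> \<le> (real (Suc k))\<^sup>2 * (K * norm (abs_L2 (grad \<phi>)) ^ (2 * k)) * (norm (abs_L2 (grad \<phi>)))\<^sup>2"
        by (intro mult_right_mono mult_left_mono K(2)[OF p]) auto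
      also have "\<dots> = (real (Suc k))\<^sup>2 * K * norm (abs_L2 (grad \<phi>)) ^ (2 * Suc k)"
        by (simp add: power2_eq_square mult_ac del: of_nat_Suc)
      finally show "(\<integral>x. \<phi> x ^ (2 * Suc k) \<partial>lborel) \<le> (real (Suc k))\<^sup>2 * K * norm (abs_L2 (grad \<phi>)) ^ (2 * Suc k)" .
    qed (use K in auto)
  qed
  then show ?thesis using that by blast
qed

text \<open>Fatou's lemma along an almost everywhere convergent sequence of test functions carries
  the bound over; the finite bound in turn gives integrability.\<close>

lemma Sobolev:
  fixes D :: "'a::euclidean_space set"
  assumes D: "open D" "bounded D" and k: "k > 0" and dim: "DIM('a) = 2 \<or> DIM('a) = 3 \<and> k = 3"
  obtains K where "K \<ge> 0" "\<And>v. v \<in> H10 D \<Longrightarrow> integrable lborel (\<lambda>x. rep_L2 v x ^ (2 * k))"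
    "\<And>v. v \<in> H10 D \<Longrightarrow> (\<integral>x. rep_L2 v x ^ (2 * k) \<partial>lborel) \<le> K * H10_norm D v ^ (2 * k)"
proof -
  obtain K where K: "K \<ge> 0" "\<And>\<phi>. \<phi> \<in> test_functions D \<Longrightarrow>
    (\<integral>x. \<phi> x ^ (2 * k) \<partial>lborel) \<le> K * norm (abs_L2 (grad \<phi>)) ^ (2 * k)"
    using Sobolev_test[OF assms] by metis
  have main: "(\<integral>\<^sup>+x. ennreal (rep_L2 v x ^ (2 * k)) \<partial>lborel) \<le> ennreal (K * H10_norm D v ^ (2 * k))" if v: "v \<in> H10 D" for v
  proof -
    obtain \<phi> where p: "\<And>n::nat. \<phi> n \<in> test_functions D"
      "(\<lambda>n. abs_L2 (\<phi> n)) \<longlonglongrightarrow> v" "(\<lambda>n. abs_L2 (grad (\<phi> n))) \<longlonglongrightarrow> weak_gradient D v"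
      using H10_approx[OF D(1) v] by blast
    obtain r where r: "strict_mono r" "AE x in lborel. (\<lambda>n. rep_L2 (abs_L2 (\<phi> (r n))) x) \<longlonglongrightarrow> rep_L2 v x"
      using L2_subseq_AE[OF p(2)] by blast
    have "AE x in lborel. \<forall>n. rep_L2 (abs_L2 (\<phi> n)) x = \<phi> n x"
      using rep_abs_L2[OF test_functions_sq_int[OF p(1)]] by (simp add: AE_all_countable)
    with r(2) have lim: "AE x in lborel. (\<lambda>n. \<phi> (r n) x) \<longlonglongrightarrow> rep_L2 v x"
      by eventually_elim simp
    have [measurable]: "\<phi> n \<in> borel_measurable borel" for n by (rule test_functions_measurable[OF p(1)])
    have "(\<integral>\<^sup>+x. ennreal (rep_L2 v x ^ (2 * k)) \<partial>lborel)
      \<le> liminf (\<lambda>n. \<integral>\<^sup>+x. ennreal (\<phi> (r n) x ^ (2 * k)) \<partial>lborel)"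
    proof (rule nn_integral_le_liminf_AE)
      show "AE x in lborel. (\<lambda>n. ennreal (\<phi> (r n) x ^ (2 * k))) \<longlonglongrightarrow> ennreal (rep_L2 v x ^ (2 * k))"
        using lim by eventually_elim (intro tendsto_intros)
    qed measurable
    also have "\<dots> \<le> liminf (\<lambda>n. ennreal (K * norm (abs_L2 (grad (\<phi> (r n)))) ^ (2 * k)))"
      using nn_integral_test_power(1)[OF p(1) k] K(2)[OF p(1)]
      by (intro Liminf_mono always_eventually) (auto intro: ennreal_leI)
    also have "\<dots> = ennreal (K * H10_norm D v ^ (2 * k))"
    proof (rule lim_imp_Liminf)
      have "(\<lambda>n. abs_L2 (grad (\<phi> (r n)))) \<longlonglongrightarrow> weak_gradient D v"
        using LIMSEQ_subseq_LIMSEQ[OF p(3) r(1)] by (simp add: o_def)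
      then show "(\<lambda>n. ennreal (K * norm (abs_L2 (grad (\<phi> (r n)))) ^ (2 * k))) \<longlonglongrightarrow> ennreal (K * H10_norm D v ^ (2 * k))"
        unfolding H10_norm_def by (intro tendsto_intros)
    qed simp
    finally show ?thesis .
  qed
  have int: "integrable lborel (\<lambda>x. rep_L2 v x ^ (2 * k))" if "v \<in> H10 D" for v
    using main[OF that] by (intro integrableI_nonneg) (auto intro: le_less_trans)
  show ?thesis
  proof (rule that[OF K(1) int])
    fix v assume v: "v \<in> H10 D"
    have "ennreal (\<integral>x. rep_L2 v x ^ (2 * k) \<partial>lborel) \<le> ennreal (K * H10_norm D v ^ (2 * k))"
      using main[OF v] nn_integral_eq_integral[OF int[OF v]] by simp
    then show "(\<integral>x. rep_L2 v x ^ (2 * k) \<partial>lborel) \<le> K * H10_norm D v ^ (2 * k)"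
      using K(1) by (simp add: H10_norm_nonneg)
  qed
qed

section \<open>Minimisation in Hilbert spaces\<close>

text \<open>The common engine of \<open>Riesz_dense\<close>, \<open>prox_exists\<close> and
  \<open>solution_exists\<close>. If two values of \<open>J\<close> lie within c e^2 of the infimum,
  the value at the midpoint is still at least the infimum, so the convexity defect c N^2 is below c
  e^2. The function \<open>N\<close> is left open because the equations need \<open>H10_norm\<close>
  rather than the norm of the type.\<close>

lemma midpoint_convex_minimizing_sequence:
  fixes V :: "'v::real_vector set" and J N :: "'v \<Rightarrow> real"
  assumes ne: "V \<noteq> {}" and lb: "\<And>x. x \<in> V \<Longrightarrow> m0 \<le> J x" and c: "c > 0"
    and mid: "\<And>x y. x \<in> V \<Longrightarrow> y \<in> V \<Longrightarrow> (1/2) *\<^sub>R (x + y) \<in> V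
      \<and> J ((1/2) *\<^sub>R (x + y)) \<le> (J x + J y) / 2 - c * (N (x - y))\<^sup>2"
    and N: "\<And>x. 0 \<le> N x"
  obtains x :: "nat \<Rightarrow> 'v" and m where "\<And>n. x n \<in> V" "(\<lambda>n. J (x n)) \<longlonglongrightarrow> m" "\<And>y. y \<in> V \<Longrightarrow> m \<le> J y"
    "\<And>n. J (x n) < m + 1 / Suc n"
    "\<And>e. e > 0 \<Longrightarrow> \<exists>M. \<forall>i\<ge>M. \<forall>j\<ge>M. N (x i - x j) < e"
proof -
  define m where "m = Inf (J ` V)"
  have bdd: "bdd_below (J ` V)" using lb by (auto intro!: bdd_belowI2)
  have m: "m \<le> J y" if "y \<in> V" for y
    unfolding m_def using that bdd by (intro cInf_lower) auto
  have "\<exists>x\<in>V. J x < m + 1 / Suc n" for n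
  proof -
    have "\<exists>z\<in>J ` V. z < m + 1 / Suc n"
      unfolding m_def using ne bdd by (subst cInf_less_iff[symmetric]) auto
    then show ?thesis by blast
  qed
  then obtain x where x: "\<And>n. x n \<in> V" "\<And>n. J (x n) < m + 1 / Suc n" by metis
  have z: "(\<lambda>n. 1 / real (Suc n)) \<longlonglongrightarrow> 0" by (rule LIMSEQ_Suc[OF lim_1_over_n])
  have lim: "(\<lambda>n. J (x n)) \<longlonglongrightarrow> m"
  proof (rule tendsto_sandwich[OF _ _ tendsto_const])
    show "(\<lambda>n. m + 1 / real (Suc n)) \<longlonglongrightarrow> m"
      using tendsto_add[OF tendsto_const[of m] z] by simp
  qed (auto intro!: always_eventually m x less_imp_le[OF x(2)] simp del: of_nat_Suc)
  have cau: "\<exists>M. \<forall>i\<ge>M. \<forall>j\<ge>M. N (x i - x j) < e" if e: "e > 0" for e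
  proof -
    have "\<forall>\<^sub>F n in sequentially. J (x n) < m + c * e\<^sup>2"
      using e c by (intro order_tendstoD(2)[OF lim]) simp
    then obtain M where M: "\<And>n. n \<ge> M \<Longrightarrow> J (x n) < m + c * e\<^sup>2"
      by (auto simp: eventually_sequentially)
    have "N (x i - x j) < e" if "i \<ge> M" "j \<ge> M" for i j
    proof -
      have gen: "P < Q" if "m \<le> (a + b) / 2 - P" "a < m + Q" "b < m + Q" for a b P Q :: real
        using that by (simp add: field_simps)
      have "m \<le> (J (x i) + J (x j)) / 2 - c * (N (x i - x j))\<^sup>2"
        using m[OF conjunct1[OF mid[OF x(1)[of i] x(1)[of j]]]] conjunct2[OF mid[OF x(1)[of i] x(1)[of j]]]
        by (rule order_trans)
      from gen[OF this M[OF that(1)] M[OF that(2)]]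
      have "c * (N (x i - x j))\<^sup>2 < c * e\<^sup>2" .
      then have "(N (x i - x j))\<^sup>2 < e\<^sup>2" using c by simp
      then show ?thesis by (rule power2_less_imp_less) (use e in simp)
    qed
    then show ?thesis by blast
  qed
  show ?thesis by (rule that[OF x(1) lim m x(2) cau])
qed

lemma quadratic_lower_bound:
  fixes a b t :: real
  assumes "a > 0"
  shows "- (b\<^sup>2 / (4 * a)) \<le> a * t\<^sup>2 - b * t"
proof -
  have "0 \<le> (2 * a * t - b)\<^sup>2 / (4 * a)" using assms by simp
  also have "\<dots> = a * t\<^sup>2 - b * t + b\<^sup>2 / (4 * a)"
    using assms by (simp add: power2_eq_square field_simps)
  finally show ?thesis by simp
qed

lemma linear_coefficient_zero:
  fixes a b :: real
  assumes "\<And>t. 0 \<le> t * b + t\<^sup>2 * a"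
  shows "b = 0"
proof (rule ccontr)
  assume b: "b \<noteq> 0"
  \<comment> \<open>With \<open>s > a\<close> and \<open>s > 0\<close> the choice t = - b / s gives
    b^2 (a - s) / s^2, which is negative.\<close>
  define s where "s = \<bar>a\<bar> + 1"
  have s: "s > 0" "a < s" by (auto simp: s_def)
  have "0 \<le> (- b / s) * b + (- b / s)\<^sup>2 * a" by (rule assms)
  also have "\<dots> = b\<^sup>2 * (a - s) / s\<^sup>2"
    using s by (simp add: power2_eq_square field_simps)
  also have "\<dots> < 0"
    using b s by (simp add: divide_neg_pos mult_pos_neg)
  finally show False by simp
qed

text \<open>The Riesz representation of a bounded functional on a subspace that need not be closed,
  found by minimising half the squared norm minus \<open>l\<close>. The approximating sequence in
  \<open>S\<close> is part of the conclusion, because it later shows that the representing element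
  vanishes off \<open>D\<close>.\<close>

lemma Riesz_dense:
  fixes S :: "('a::euclidean_space, 'b::euclidean_space) L2 set" and l :: "('a, 'b) L2 \<Rightarrow> real"
  assumes S0: "0 \<in> S" and Sadd: "\<And>x y. x \<in> S \<Longrightarrow> y \<in> S \<Longrightarrow> x + y \<in> S"
    and Sscale: "\<And>x c. x \<in> S \<Longrightarrow> c *\<^sub>R x \<in> S"
    and ladd: "\<And>x y. x \<in> S \<Longrightarrow> y \<in> S \<Longrightarrow> l (x + y) = l x + l y"
    and lscale: "\<And>x c. x \<in> S \<Longrightarrow> l (c *\<^sub>R x) = c * l x"
    and bound: "\<And>x. x \<in> S \<Longrightarrow> \<bar>l x\<bar> \<le> C * norm x" and C: "C \<ge> 0"
  obtains G x where "\<And>n::nat. x n \<in> S" "x \<longlonglongrightarrow> G" "norm G \<le> C" "\<And>\<phi>. \<phi> \<in> S \<Longrightarrow> l \<phi> = G \<bullet> \<phi>"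
proof -
  define J where "J x = (norm x)\<^sup>2 / 2 - l x" for x
  obtain x m where x: "\<And>n::nat. x n \<in> S" "(\<lambda>n. J (x n)) \<longlonglongrightarrow> m" "\<And>y. y \<in> S \<Longrightarrow> m \<le> J y"
    and cau: "\<And>e. e > 0 \<Longrightarrow> \<exists>M. \<forall>i\<ge>M. \<forall>j\<ge>M. norm (x i - x j) < e"
  proof (rule midpoint_convex_minimizing_sequence[of S "- (C\<^sup>2 / 2)" J "1/8" norm])
    show "S \<noteq> {}" using S0 by blast
    show "- (C\<^sup>2 / 2) \<le> J x" if "x \<in> S" for x
      using quadratic_lower_bound[of "1/2" C "norm x"] bound[OF that] by (simp add: J_def)
    show "(1/2) *\<^sub>R (x + y) \<in> S \<and> J ((1/2) *\<^sub>R (x + y)) \<le> (J x + J y) / 2 - 1/8 * (norm (x - y))\<^sup>2"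
      if "x \<in> S" "y \<in> S" for x y
    proof
      show "(1/2) *\<^sub>R (x + y) \<in> S" by (intro Sscale Sadd that)
      have "(norm ((1/2) *\<^sub>R (x + y)))\<^sup>2 = (norm x)\<^sup>2 / 2 + (norm y)\<^sup>2 / 2 - (norm (x - y))\<^sup>2 / 4"
        unfolding power2_norm_eq_inner by (simp add: inner_simps inner_commute field_simps)
      moreover have "l ((1/2) *\<^sub>R (x + y)) = (l x + l y) / 2"
        using that by (simp add: lscale ladd Sadd)
      ultimately show "J ((1/2) *\<^sub>R (x + y)) \<le> (J x + J y) / 2 - 1/8 * (norm (x - y))\<^sup>2"
        unfolding J_def by (simp add: field_simps)
    qed
  qed (use that in auto)
  have "Cauchy x" using cau by (simp add: Cauchy_iff)
  then obtain G where G: "x \<longlonglongrightarrow> G" using L2_Cauchy_convergent by (auto simp: convergent_def)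
  \<comment> \<open>\<open>G\<close> may lie outside \<open>S\<close>, where \<open>l\<close> is not
    controlled. So the variation is performed at the points \<open>x n\<close>, and the limit is
    taken afterwards.\<close>
  have EL: "l \<phi> = G \<bullet> \<phi>" if p: "\<phi> \<in> S" for \<phi>
  proof -
    have "0 \<le> t * (G \<bullet> \<phi> - l \<phi>) + t\<^sup>2 * ((norm \<phi>)\<^sup>2 / 2)" for t
    proof (rule LIMSEQ_le[OF tendsto_const[of 0]])
      have e: "J (x n + t *\<^sub>R \<phi>) = J (x n) + (t * (x n \<bullet> \<phi> - l \<phi>) + t\<^sup>2 * ((norm \<phi>)\<^sup>2 / 2))" for n
        using x(1)[of n] p unfolding J_def power2_norm_eq_inner
        by (simp add: ladd lscale Sscale inner_simps inner_commute power2_eq_square field_simps)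
      have "m \<le> J (x n + t *\<^sub>R \<phi>)" for n by (intro x(3) Sadd Sscale p x(1))
      then show "\<exists>M. \<forall>n\<ge>M. 0 \<le> (J (x n) - m) + (t * (x n \<bullet> \<phi> - l \<phi>) + t\<^sup>2 * ((norm \<phi>)\<^sup>2 / 2))"
        unfolding e by (auto simp: algebra_simps)
      have "(\<lambda>n. (J (x n) - m) + (t * (x n \<bullet> \<phi> - l \<phi>) + t\<^sup>2 * ((norm \<phi>)\<^sup>2 / 2)))
        \<longlonglongrightarrow> (m - m) + (t * (G \<bullet> \<phi> - l \<phi>) + t\<^sup>2 * ((norm \<phi>)\<^sup>2 / 2))"
        by (intro tendsto_intros x(2) G)
      then show "(\<lambda>n. (J (x n) - m) + (t * (x n \<bullet> \<phi> - l \<phi>) + t\<^sup>2 * ((norm \<phi>)\<^sup>2 / 2)))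
        \<longlonglongrightarrow> t * (G \<bullet> \<phi> - l \<phi>) + t\<^sup>2 * ((norm \<phi>)\<^sup>2 / 2)" by simp
    qed
    from linear_coefficient_zero[OF this] show ?thesis by simp
  qed
  have "norm G * norm G \<le> C * norm G"
  proof (rule LIMSEQ_le)
    show "(\<lambda>n. G \<bullet> x n) \<longlonglongrightarrow> norm G * norm G"
      using tendsto_inner[OF tendsto_const[of G] G] by (simp add: power2_norm_eq_inner[symmetric] power2_eq_square)
    show "(\<lambda>n. C * norm (x n)) \<longlonglongrightarrow> C * norm G" by (intro tendsto_intros G)
    show "\<exists>N. \<forall>n\<ge>N. G \<bullet> x n \<le> C * norm (x n)"
    proof (intro exI allI impI)
      fix n show "G \<bullet> x n \<le> C * norm (x n)"
        using bound[OF x(1)[of n]] EL[OF x(1)[of n]] by linarith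
    qed
  qed
  then have "norm G \<le> C" using C by (cases "norm G = 0") auto
  with x(1) G show ?thesis using EL by (rule that)
qed

section \<open>Existence of proximity points\<close>

lemma ereal_eq_real: "x \<noteq> -\<infinity> \<Longrightarrow> x < \<infinity> \<Longrightarrow> x = ereal (real_of_ereal x)"
  by (cases x) auto

text \<open>The filter in \<open>lsc_on\<close> leaves out the point \<open>u\<close> itself; there
  the hypothesis on \<open>c\<close> provides the inequality.\<close>

lemma lsc_on_ball:
  fixes u :: "'v::metric_space"
  assumes lsc: "lsc_on V \<psi>" and u: "u \<in> V" and c: "c < \<psi> u"
  obtains d where "d > 0" "\<And>w. w \<in> V \<Longrightarrow> dist w u < d \<Longrightarrow> c < \<psi> w"
proof -
  have "\<psi> u \<le> Liminf (at u within V) \<psi>" using lsc u by (simp add: lsc_on_def)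
  then have "\<forall>\<^sub>F x in at u within V. c < \<psi> x" using c by (simp add: le_Liminf_iff)
  then obtain d where "d > 0" "\<And>w. w \<in> V \<Longrightarrow> w \<noteq> u \<Longrightarrow> dist w u < d \<Longrightarrow> c < \<psi> w"
    by (auto simp: eventually_at)
  then show ?thesis using c by (intro that[of d]) metis+
qed

text \<open>If \<open>\<psi>\<close> were very negative at \<open>w\<close>, then by convexity it would already be too small on the segment
  from \<open>u0\<close> to \<open>w\<close> close to \<open>u0\<close>.\<close>

lemma convex_lsc_bounded_below:
  fixes \<psi> :: "'v::real_normed_vector \<Rightarrow> ereal"
  assumes proper: "proper_on V \<psi>" and conv: "convex_ereal_on V \<psi>" and lsc: "lsc_on V \<psi>"
    and V: "\<And>x y t. x \<in> V \<Longrightarrow> y \<in> V \<Longrightarrow> (1 - t) *\<^sub>R x + t *\<^sub>R y \<in> V"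
    and r: "\<And>u. u \<in> V \<Longrightarrow> \<psi> u < \<infinity> \<Longrightarrow> norm u \<le> r"
  obtains m where "\<And>w. w \<in> V \<Longrightarrow> ereal m \<le> \<psi> w"
proof -
  obtain u0 where u0: "u0 \<in> V" "\<psi> u0 < \<infinity>" using proper by (auto simp: proper_on_def)
  have ninf: "\<psi> w \<noteq> -\<infinity>" if "w \<in> V" for w using proper that by (auto simp: proper_on_def)
  define p0 where "p0 = real_of_ereal (\<psi> u0)"
  have p0: "\<psi> u0 = ereal p0" unfolding p0_def by (rule ereal_eq_real[OF ninf[OF u0(1)] u0(2)])
  obtain d where d: "d > 0" "\<And>w. w \<in> V \<Longrightarrow> dist w u0 < d \<Longrightarrow> ereal (p0 - 1) < \<psi> w"
    using lsc_on_ball[OF lsc u0(1), of "ereal (p0 - 1)"] by (auto simp: p0)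
  have r0: "0 \<le> r" using r[OF u0] norm_ge_zero[of u0] by linarith
  \<comment> \<open>Two points where \<psi> is finite are at most 2r apart, so this \<open>t\<close>
    keeps the point of the segment within \<open>d\<close> of \<open>u0\<close>. The added 1 makes
    the inequality strict and covers r = 0.\<close>
  define t where "t = min 1 (d / (2 * r + 1))"
  have t: "0 < t" "t \<le> 1" using d r0 by (auto simp: t_def)
  have td: "t * (2 * r) < d"
  proof -
    have "t * (2 * r) \<le> d / (2 * r + 1) * (2 * r)"
      using r0 by (intro mult_right_mono) (auto simp: t_def)
    also have "\<dots> < d" using r0 d(1) by (simp add: field_simps)
    finally show ?thesis .
  qed
  show ?thesis
  proof (rule that[of "p0 - 1 / t"])
    fix w assume w: "w \<in> V"
    show "ereal (p0 - 1 / t) \<le> \<psi> w"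
    proof (cases "\<psi> w < \<infinity>")
      case True
      define p where "p = real_of_ereal (\<psi> w)"
      have p: "\<psi> w = ereal p" unfolding p_def by (rule ereal_eq_real[OF ninf[OF w] True])
      let ?z = "(1 - t) *\<^sub>R u0 + t *\<^sub>R w"
      have "?z - u0 = t *\<^sub>R (w - u0)" by (simp add: algebra_simps)
      then have "dist ?z u0 = t * norm (w - u0)" using t by (simp add: dist_norm)
      also have "\<dots> \<le> t * (2 * r)"
        using r[OF u0] r[OF w True] norm_triangle_ineq4[of w u0] t by (intro mult_left_mono) auto
      finally have "dist ?z u0 < d" using td by linarith
      from d(2)[OF V[OF u0(1) w] this] have "ereal (p0 - 1) < \<psi> ?z" .
      also have "\<psi> ?z \<le> ereal (1 - t) * \<psi> u0 + ereal t * \<psi> w"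
        using conv u0 w t by (auto simp: convex_ereal_on_def)
      finally have "p0 - 1 < (1 - t) * p0 + t * p" by (simp add: p p0)
      then have "t * p0 - 1 < t * p" by (simp add: algebra_simps)
      then have "p0 - 1 / t < p" using t by (simp add: field_simps)
      then show ?thesis by (simp add: p)
    qed simp
  qed
qed

text \<open>On the effective domain of \<psi> the objective is real-valued, and half the
  parallelogram identity for the quadratic term gives midpoint convexity with constant 1/8. Lower
  semicontinuity makes the limit of the minimising sequence a minimiser, so the choice in
  \<open>arg_min\<close> picks a genuine one.\<close>

lemma prox_exists:
  fixes D :: "'a::euclidean_space set" and \<psi> :: "('a, real) L2 \<Rightarrow> ereal"
  assumes proper: "proper_on (L2_on D) \<psi>" and conv: "convex_ereal_on (L2_on D) \<psi>" and lsc: "lsc_on (L2_on D) \<psi>"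
    and \<alpha>: "\<alpha> > 0" and r: "\<And>u. u \<in> L2_on D \<Longrightarrow> \<psi> u < \<infinity> \<Longrightarrow> norm u \<le> r"
  shows "prox_on (L2_on D) \<psi> \<alpha> v \<in> L2_on D" "\<psi> (prox_on (L2_on D) \<psi> \<alpha> v) < \<infinity>"
proof -
  let ?V = "L2_on D"
  let ?f = "\<lambda>w. \<psi> w / ereal \<alpha> + ereal (1 / 2 * (norm (v - w))\<^sup>2)"
  have Vc: "(1 - t) *\<^sub>R x + t *\<^sub>R y \<in> ?V" if "x \<in> ?V" "y \<in> ?V" for x y :: "('a, real) L2" and t
    by (intro add_in_L2_on scaleR_in_L2_on that)
  obtain m0 where m0: "\<And>w. w \<in> ?V \<Longrightarrow> ereal m0 \<le> \<psi> w"
    using convex_lsc_bounded_below[OF proper conv lsc Vc r] by blast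
  obtain u0 where u0: "u0 \<in> ?V" "\<psi> u0 < \<infinity>" using proper by (auto simp: proper_on_def)
  have ninf: "\<psi> w \<noteq> -\<infinity>" if "w \<in> ?V" for w using proper that by (auto simp: proper_on_def)
  define V' where "V' = {w \<in> ?V. \<psi> w < \<infinity>}"
  define p where "p w = real_of_ereal (\<psi> w)" for w
  have p: "\<psi> w = ereal (p w)" if "w \<in> V'" for w
    unfolding p_def using that ninf by (intro ereal_eq_real) (auto simp: V'_def)
  define J where "J w = p w / \<alpha> + 1 / 2 * (norm (v - w))\<^sup>2" for w
  have fJ: "?f w = ereal (J w)" if "w \<in> V'" for w
    using \<alpha> by (simp add: p[OF that] J_def)
  obtain x m where x: "\<And>n::nat. x n \<in> V'" "(\<lambda>n. J (x n)) \<longlonglongrightarrow> m" "\<And>y. y \<in> V' \<Longrightarrow> m \<le> J y"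
    and cau: "\<And>e. e > 0 \<Longrightarrow> \<exists>M. \<forall>i\<ge>M. \<forall>j\<ge>M. norm (x i - x j) < e"
  proof (rule midpoint_convex_minimizing_sequence[of V' "m0 / \<alpha>" J "1/8" norm])
    show "V' \<noteq> {}" using u0 by (auto simp: V'_def)
    show "m0 / \<alpha> \<le> J x" if "x \<in> V'" for x
    proof -
      have "m0 \<le> p x" using m0[of x] p[OF that] that by (simp add: V'_def)
      then have "m0 / \<alpha> \<le> p x / \<alpha>" using \<alpha> by (simp add: divide_right_mono)
      then show ?thesis by (simp add: J_def add_increasing2)
    qed
    show "(1/2) *\<^sub>R (x + y) \<in> V' \<and> J ((1/2) *\<^sub>R (x + y)) \<le> (J x + J y) / 2 - 1/8 * (norm (x - y))\<^sup>2"
      if xy: "x \<in> V'" "y \<in> V'" for x y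
    proof -
      let ?z = "(1/2) *\<^sub>R (x + y)"
      have z: "?z = (1 - 1/2) *\<^sub>R x + (1/2) *\<^sub>R y" by (simp add: scaleR_add_right)
      have V: "?z \<in> ?V" unfolding z using xy by (intro Vc) (auto simp: V'_def)
      have "\<psi> ?z \<le> ereal (1 - 1/2) * \<psi> x + ereal (1/2) * \<psi> y"
        unfolding z using conv[unfolded convex_ereal_on_def, rule_format, of x y "1/2"] xy
        by (auto simp: V'_def)
      then have le: "\<psi> ?z \<le> ereal ((p x + p y) / 2)"
        by (simp add: p[OF xy(1)] p[OF xy(2)] add_divide_distrib)
      then have zV: "?z \<in> V'" using V by (auto simp: V'_def)
      have "p ?z \<le> (p x + p y) / 2" using le p[OF zV] by simp
      then have "p ?z / \<alpha> \<le> (p x + p y) / 2 / \<alpha>" using \<alpha> by (intro divide_right_mono) auto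
      then have e1: "p ?z / \<alpha> \<le> (p x / \<alpha> + p y / \<alpha>) / 2" by (simp only: add_divide_distrib divide_divide_eq_left mult.commute)
      have e2: "(norm (v - ?z))\<^sup>2 = (norm (v - x))\<^sup>2 / 2 + (norm (v - y))\<^sup>2 / 2 - (norm (x - y))\<^sup>2 / 4"
        unfolding power2_norm_eq_inner by (simp add: inner_simps inner_commute field_simps)
      have gen: "X + 1 / 2 * n \<le> (a + 1 / 2 * c + (b + 1 / 2 * d)) / 2 - 1/8 * e"
        if "X \<le> (a + b) / 2" "n = c / 2 + d / 2 - e / 4" for X n a b c d e :: real
        using that by (simp add: field_simps)
      have "J ?z \<le> (J x + J y) / 2 - 1/8 * (norm (x - y))\<^sup>2"
        unfolding J_def by (rule gen[OF e1 e2])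
      with zV show ?thesis by blast
    qed
  qed (use that in auto)
  have "Cauchy x" using cau by (simp add: Cauchy_iff)
  then obtain L where L: "x \<longlonglongrightarrow> L" using L2_Cauchy_convergent by (auto simp: convergent_def)
  have xV: "x n \<in> ?V" for n using x(1) by (auto simp: V'_def)
  have LV: "L \<in> ?V" by (rule L2_on_limit[OF xV L])
  \<comment> \<open>The limit of the values of \<psi> along the sequence, recovered from the limit
    of \<open>J\<close> because the quadratic term converges.\<close>
  define s where "s = \<alpha> * (m - 1 / 2 * (norm (v - L))\<^sup>2)"
  have "(\<lambda>n. \<alpha> * (J (x n) - 1 / 2 * (norm (v - x n))\<^sup>2)) \<longlonglongrightarrow> s"
    unfolding s_def by (intro tendsto_intros x(2) L)
  moreover have "\<alpha> * (J (x n) - 1 / 2 * (norm (v - x n))\<^sup>2) = p (x n)" for n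
    using \<alpha> by (simp add: J_def)
  ultimately have ps: "(\<lambda>n. p (x n)) \<longlonglongrightarrow> s" by simp
  have \<psi>L: "\<psi> L \<le> ereal s"
  proof (rule ccontr)
    assume "\<not> \<psi> L \<le> ereal s"
    then have "ereal s < \<psi> L" by simp
    then obtain c where c: "ereal s < ereal c" "ereal c < \<psi> L" using ereal_dense2 by blast
    obtain d where d: "d > 0" "\<And>w. w \<in> ?V \<Longrightarrow> dist w L < d \<Longrightarrow> ereal c < \<psi> w"
      using lsc_on_ball[OF lsc LV c(2)] by blast
    have "\<forall>\<^sub>F n in sequentially. dist (x n) L < d \<and> p (x n) < c"
      using c(1) by (intro eventually_conj tendstoD[OF L d(1)] order_tendstoD(2)[OF ps]) auto
    then obtain n where n: "dist (x n) L < d" "p (x n) < c"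
      by (auto simp: eventually_sequentially)
    from d(2)[OF xV n(1)] n(2) show False by (simp add: p[OF x(1)])
  qed
  have LV': "L \<in> V'" using LV \<psi>L by (auto simp: V'_def)
  have JL: "J L \<le> m"
    using \<psi>L p[OF LV'] \<alpha> by (simp add: J_def s_def field_simps)
  have "is_arg_min ?f (\<lambda>w. w \<in> ?V) L"
    unfolding is_arg_min_def
  proof (intro conjI notI LV)
    assume "\<exists>y. y \<in> ?V \<and> ?f y < ?f L"
    then obtain y where y: "y \<in> ?V" "?f y < ?f L" by blast
    then have "\<psi> y < \<infinity>" using \<alpha> by (cases "\<psi> y") (auto simp: fJ[OF LV'])
    then have y': "y \<in> V'" using y by (simp add: V'_def)
    with y(2) have "J y < J L" by (simp add: fJ[OF y'] fJ[OF LV'] del: ereal_less)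
      (metis fJ[OF y'] fJ[OF LV'] less_ereal.simps(1) y(2))
    then show False using x(3)[OF y'] JL by linarith
  qed
  then have am: "is_arg_min ?f (\<lambda>w. w \<in> ?V) (prox_on ?V \<psi> \<alpha> v)"
    unfolding prox_on_def arg_min_def by (rule someI)
  then show P: "prox_on ?V \<psi> \<alpha> v \<in> ?V" by (simp add: is_arg_min_def)
  \<comment> \<open>The chosen minimiser need not be \<open>L\<close>, but an infinite value there
    would exceed the finite value at \<open>L\<close>.\<close>
  have "\<not> ?f L < ?f (prox_on ?V \<psi> \<alpha> v)"
    using am LV by (auto simp: is_arg_min_def)
  then show "\<psi> (prox_on ?V \<psi> \<alpha> v) < \<infinity>"
    unfolding fJ[OF LV'] using \<alpha> by (cases "\<psi> (prox_on ?V \<psi> \<alpha> v)") auto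
qed

text \<open>The norm controls gradients only. The Poincare inequality makes the functions themselves
  Cauchy in L^2, and closedness of the weak gradient identifies the limit.\<close>

lemma H10_complete:
  assumes D: "open D" "bounded D" and X: "\<And>n. X n \<in> H10 D"
    and cau: "\<And>e. e > 0 \<Longrightarrow> \<exists>M. \<forall>i\<ge>M. \<forall>j\<ge>M. H10_norm D (X i - X j) < e"
  obtains y where "y \<in> H10 D" "X \<longlonglongrightarrow> y" "(\<lambda>n. H10_norm D (X n - y)) \<longlonglongrightarrow> 0"
proof -
  obtain C where C: "C \<ge> 0" "\<And>v. v \<in> H10 D \<Longrightarrow> norm v \<le> C * H10_norm D v"
    using Poincare[OF D] by metis
  have g: "weak_gradient D (X i - X j) = weak_gradient D (X i) - weak_gradient D (X j)" for i j
    by (rule H1_diff(2)[OF D(1) H10_D(1)[OF X] H10_D(1)[OF X]])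
  have "Cauchy (\<lambda>n. weak_gradient D (X n))"
    using cau by (simp add: Cauchy_iff H10_norm_def g)
  then obtain G where G: "(\<lambda>n. weak_gradient D (X n)) \<longlonglongrightarrow> G"
    using L2_Cauchy_convergent by (auto simp: convergent_def)
  have "Cauchy X"
  proof (rule CauchyI)
    fix e :: real assume e: "e > 0"
    \<comment> \<open>Dividing by \<open>C + 1\<close> instead of \<open>C\<close> covers the case
      \<open>C = 0\<close> and gives a strict inequality below.\<close>
    obtain M where M: "\<forall>i\<ge>M. \<forall>j\<ge>M. H10_norm D (X i - X j) < e / (C + 1)"
      using cau[of "e / (C + 1)"] e C(1) by auto
    have "norm (X i - X j) < e" if "i \<ge> M" "j \<ge> M" for i j
    proof -
      have "norm (X i - X j) \<le> C * H10_norm D (X i - X j)"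
        by (intro C(2) H10_diff D X)
      also have "\<dots> \<le> C * (e / (C + 1))"
        using M that C(1) by (intro mult_left_mono) (auto intro: less_imp_le)
      also have "\<dots> < e" using e C(1) by (simp add: field_simps)
      finally show ?thesis .
    qed
    then show "\<exists>M. \<forall>m\<ge>M. \<forall>n\<ge>M. norm (X m - X n) < e" by blast
  qed
  then obtain y where y: "X \<longlonglongrightarrow> y" using L2_Cauchy_convergent by (auto simp: convergent_def)
  note yH = H10_closed[OF D(1) X y G]
  have "(\<lambda>n. norm (weak_gradient D (X n) - G)) \<longlonglongrightarrow> norm (G - G)"
    by (intro tendsto_intros G)
  then have "(\<lambda>n. H10_norm D (X n - y)) \<longlonglongrightarrow> 0"
    by (simp add: H10_norm_def H1_diff(2)[OF D(1) H10_D(1)[OF X] H10_D(1)[OF yH(1)]] yH(2))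
  with yH(1) y show ?thesis by (rule that)
qed

section \<open>Semilinear elliptic equations\<close>

text \<open>Natural exponents suffice, and no norm is attached, because integrability is always
  obtained from a pointwise bound by a multiple of the n-th power of one such function.\<close>

definition Lp_fun :: "nat \<Rightarrow> ('a::euclidean_space \<Rightarrow> real) \<Rightarrow> bool" where
  "Lp_fun n f \<longleftrightarrow> f \<in> borel_measurable borel \<and> integrable lborel (\<lambda>x. \<bar>f x\<bar> ^ n)"

lemma power_add_le:
  fixes a b :: real
  assumes "0 \<le> a" "0 \<le> b"
  shows "(a + b) ^ n \<le> 2 ^ n * (a ^ n + b ^ n)"
proof -
  have "(a + b) ^ n \<le> (2 * max a b) ^ n"
    using assms by (intro power_mono) auto
  also have "\<dots> = 2 ^ n * max a b ^ n" by (rule power_mult_distrib)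
  also have "\<dots> \<le> 2 ^ n * (a ^ n + b ^ n)"
    using assms by (intro mult_left_mono) (auto simp: max_def)
  finally show ?thesis .
qed

lemma Lp_fun_add_abs:
  assumes "Lp_fun n f" "Lp_fun n g"
  shows "Lp_fun n (\<lambda>x. \<bar>f x\<bar> + \<bar>g x\<bar>)"
proof -
  have [measurable]: "f \<in> borel_measurable borel" "g \<in> borel_measurable borel"
    using assms by (auto simp: Lp_fun_def)
  have "integrable lborel (\<lambda>x. \<bar>\<bar>f x\<bar> + \<bar>g x\<bar>\<bar> ^ n)"
  proof (rule Bochner_Integration.integrable_bound)
    show "integrable lborel (\<lambda>x. 2 ^ n * (\<bar>f x\<bar> ^ n + \<bar>g x\<bar> ^ n))"
      using assms by (auto simp: Lp_fun_def)
    show "AE x in lborel. norm (\<bar>\<bar>f x\<bar> + \<bar>g x\<bar>\<bar> ^ n) \<le> norm (2 ^ n * (\<bar>f x\<bar> ^ n + \<bar>g x\<bar> ^ n))"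
      by (intro AE_I2) (auto intro!: power_add_le)
  qed measurable
  then show ?thesis by (simp add: Lp_fun_def)
qed

lemma Lp_fun_dominates:
  assumes s: "Lp_fun n s" and "h \<in> borel_measurable borel" and "\<And>x. \<bar>h x\<bar> \<le> C * s x ^ n"
  shows "integrable lborel h"
proof (rule Bochner_Integration.integrable_bound)
  show "integrable lborel (\<lambda>x. C * \<bar>s x\<bar> ^ n)" using s by (simp add: Lp_fun_def)
  show "AE x in lborel. norm (h x) \<le> norm (C * \<bar>s x\<bar> ^ n)"
  proof (intro AE_I2)
    fix x
    have "\<bar>h x\<bar> \<le> \<bar>C * s x ^ n\<bar>" using assms(3)[of x] by linarith
    then show "norm (h x) \<le> norm (C * \<bar>s x\<bar> ^ n)" by (simp add: abs_mult power_abs)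
  qed
qed (use assms in simp)

lemma power_pred_mult_le:
  fixes s t C :: real
  assumes "0 \<le> t" "t \<le> s" "n > 0" "0 \<le> C"
  shows "C * s ^ (n - 1) * t \<le> C * s ^ n"
proof -
  obtain m where "n = Suc m" using assms(3) by (cases n) auto
  then have "C * s ^ (n - 1) * t \<le> C * s ^ (n - 1) * s"
    using assms by (intro mult_left_mono) auto
  also have "\<dots> = C * s ^ n" using \<open>n = Suc m\<close> by simp
  finally show ?thesis .
qed

text \<open>What the state and the adjoint equation share. Linearity is required in the first
  argument; symmetry transfers it to the second.\<close>

locale elliptic_form =
  fixes D :: "'a::euclidean_space set" and A :: "('a, real) L2 \<Rightarrow> ('a, real) L2 \<Rightarrow> real"
    and \<kappa> CA :: real and n :: nat
  assumes D_open: "open D" and D_bounded: "bounded D" and n: "n > 0"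
    and H10_Lp: "\<And>v. v \<in> H10 D \<Longrightarrow> Lp_fun n (rep_L2 v)"
    and A_add: "\<And>u v w. u \<in> H10 D \<Longrightarrow> v \<in> H10 D \<Longrightarrow> w \<in> H10 D \<Longrightarrow> A (u + v) w = A u w + A v w"
    and A_scale: "\<And>c u w. u \<in> H10 D \<Longrightarrow> w \<in> H10 D \<Longrightarrow> A (c *\<^sub>R u) w = c * A u w"
    and A_sym: "\<And>u w. u \<in> H10 D \<Longrightarrow> w \<in> H10 D \<Longrightarrow> A u w = A w u"
    and A_bound: "\<And>u w. u \<in> H10 D \<Longrightarrow> w \<in> H10 D \<Longrightarrow> \<bar>A u w\<bar> \<le> CA * H10_norm D u * H10_norm D w"
    and \<kappa>: "\<kappa> > 0" and A_coercive: "\<And>u. u \<in> H10 D \<Longrightarrow> \<kappa> * (H10_norm D u)\<^sup>2 \<le> A u u"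
begin

lemma A_add2: "u \<in> H10 D \<Longrightarrow> v \<in> H10 D \<Longrightarrow> w \<in> H10 D \<Longrightarrow> A w (u + v) = A w u + A w v"
  using A_add A_sym H10_add[OF D_open] by metis

lemma A_scale2: "u \<in> H10 D \<Longrightarrow> w \<in> H10 D \<Longrightarrow> A w (c *\<^sub>R u) = c * A w u"
  using A_scale A_sym H10_scaleR[OF D_open] by metis

lemma A_diff: "u \<in> H10 D \<Longrightarrow> v \<in> H10 D \<Longrightarrow> w \<in> H10 D \<Longrightarrow> A (u - v) w = A u w - A v w"
  using A_add[of u "(-1) *\<^sub>R v" w] A_scale[of v w "-1"] H10_scaleR[OF D_open, of v "-1"] by simp

lemma A_diff2: "u \<in> H10 D \<Longrightarrow> v \<in> H10 D \<Longrightarrow> w \<in> H10 D \<Longrightarrow> A w (u - v) = A w u - A w v"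
  using A_diff A_sym H10_diff[OF D_open] by metis

lemma A_quadratic:
  assumes "u \<in> H10 D" "v \<in> H10 D"
  shows "A (u + t *\<^sub>R v) (u + t *\<^sub>R v) = A u u + 2 * t * A u v + t\<^sup>2 * A v v"
  using assms A_sym[of u v]
  by (simp add: A_add A_add2 A_scale A_scale2 H10_add[OF D_open] H10_scaleR[OF D_open] power2_eq_square algebra_simps)

lemma A_midpoint:
  assumes "u \<in> H10 D" "v \<in> H10 D"
  shows "A ((1/2) *\<^sub>R (u + v)) ((1/2) *\<^sub>R (u + v)) = A u u / 2 + A v v / 2 - A (u - v) (u - v) / 4"
  using assms A_sym[of u v]
  by (simp add: A_add A_add2 A_scale A_scale2 A_diff A_diff2 H10_add[OF D_open] H10_scaleR[OF D_open]
      H10_diff[OF D_open] field_simps)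

end

text \<open>The equation A y + a(x, y) = f with monotone \<open>a\<close> is the Euler equation of
  half the quadratic form plus the integral of the convex antiderivative \<open>\<Phi>\<close> minus
  \<open>f\<close>. It is instantiated by \<open>q\<close> for the state and by multiplication with
  \<open>q'\<close> along the state for the adjoint; \<open>\<rho>\<close> absorbs what the growth
  bound contains besides the argument \<open>t\<close>.\<close>

locale semilinear = elliptic_form D A \<kappa> CA n
  for D :: "'a::euclidean_space set" and A \<kappa> CA n +
  fixes a \<Phi> :: "'a \<Rightarrow> real \<Rightarrow> real" and \<rho> :: "'a \<Rightarrow> real" and C :: real
  assumes \<Phi>_deriv: "\<And>x t. (\<Phi> x has_field_derivative a x t) (at t)" and \<Phi>_0: "\<And>x. \<Phi> x 0 = 0"
    and a_mono: "\<And>x s t. s \<le> t \<Longrightarrow> a x s \<le> a x t" and a_0: "\<And>x. a x 0 = 0"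
    and a_cont: "\<And>x t. isCont (a x) t"
    and a_growth: "\<And>x t. \<bar>a x t\<bar> \<le> C * (\<rho> x + \<bar>t\<bar>) ^ (n - 1)" and \<rho>: "\<And>x. 0 \<le> \<rho> x" and C: "C \<ge> 0"
    and \<rho>_Lp: "Lp_fun n \<rho>"
    and a_meas: "\<And>u. u \<in> borel_measurable borel \<Longrightarrow> (\<lambda>x. a x (u x)) \<in> borel_measurable borel"
    and \<Phi>_meas: "\<And>u. u \<in> borel_measurable borel \<Longrightarrow> (\<lambda>x. \<Phi> x (u x)) \<in> borel_measurable borel"
begin

text \<open>The subgradient inequality, with slope taken at \<open>s\<close>. All uses of convexity
  are drawn from it: nonnegativity, the midpoint inequality, integrability and the bound for
  difference quotients.\<close>

lemma \<Phi>_tangent: "\<Phi> x s - \<Phi> x t \<le> a x s * (s - t)"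
proof -
  consider "t < s" | "s < t" | "s = t" by linarith
  then show ?thesis
  proof cases
    case 1
    obtain z where z: "t < z" "z < s" "\<Phi> x s - \<Phi> x t = (s - t) * a x z"
      using MVT2[OF 1, of "\<Phi> x" "a x"] \<Phi>_deriv by blast
    then show ?thesis using a_mono[of z s x] 1 by (simp add: mult.commute mult_left_mono)
  next
    case 2
    obtain z where z: "s < z" "z < t" "\<Phi> x t - \<Phi> x s = (t - s) * a x z"
      using MVT2[OF 2, of "\<Phi> x" "a x"] \<Phi>_deriv by blast
    have "(t - s) * a x s \<le> (t - s) * a x z"
      using a_mono[of s z x] z 2 by (intro mult_left_mono) auto
    then show ?thesis using z by (simp add: algebra_simps)
  qed simp
qed

lemma \<Phi>_nonneg: "0 \<le> \<Phi> x t"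
  using \<Phi>_tangent[of x 0 t] by (simp add: \<Phi>_0 a_0)

lemma \<Phi>_midpoint: "\<Phi> x ((s + t) / 2) \<le> (\<Phi> x s + \<Phi> x t) / 2"
  using \<Phi>_tangent[of x "(s + t) / 2" s] \<Phi>_tangent[of x "(s + t) / 2" t] by (simp add: field_simps)

text \<open>Both arguments are measured against the same \<open>r\<close>, so the power n - 1 from
  the growth of \<open>a\<close> and the additional factor combine to an n-th power of a single
  function.\<close>

lemma a_mult_bound:
  assumes "\<bar>t\<bar> \<le> r" "\<bar>s\<bar> \<le> r"
  shows "\<bar>a x t * s\<bar> \<le> C * (\<rho> x + r) ^ n"
proof -
  have "\<bar>a x t * s\<bar> \<le> C * (\<rho> x + \<bar>t\<bar>) ^ (n - 1) * \<bar>s\<bar>"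
    unfolding abs_mult by (intro mult_right_mono a_growth) simp
  also have "\<dots> \<le> C * (\<rho> x + r) ^ (n - 1) * \<bar>s\<bar>"
    using assms \<rho>[of x] C by (intro mult_right_mono mult_left_mono power_mono) auto
  also have "\<dots> \<le> C * (\<rho> x + r) ^ n"
    using assms \<rho>[of x] C n by (intro power_pred_mult_le) auto
  finally show ?thesis .
qed

lemma Lp_dominating:
  assumes "u \<in> H10 D" "v \<in> H10 D"
  shows "Lp_fun n (\<lambda>x. \<rho> x + (\<bar>rep_L2 u x\<bar> + \<bar>rep_L2 v x\<bar>))"
  using Lp_fun_add_abs[OF \<rho>_Lp Lp_fun_add_abs[OF H10_Lp[OF assms(1)] H10_Lp[OF assms(2)]]] \<rho>
  by simp

lemma a_integrable:
  assumes "u \<in> H10 D" "v \<in> H10 D"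
  shows "integrable lborel (\<lambda>x. a x (rep_L2 u x) * rep_L2 v x)"
proof (rule Lp_fun_dominates[OF Lp_dominating[OF assms], where C = C])
  show "(\<lambda>x. a x (rep_L2 u x) * rep_L2 v x) \<in> borel_measurable borel"
    by (intro borel_measurable_times a_meas rep_L2_borel)
qed (rule a_mult_bound; simp)

lemma \<Phi>_integrable:
  assumes "u \<in> H10 D"
  shows "integrable lborel (\<lambda>x. \<Phi> x (rep_L2 u x))"
proof (rule Lp_fun_dominates[OF Lp_dominating[OF assms assms], where C = C])
  show "(\<lambda>x. \<Phi> x (rep_L2 u x)) \<in> borel_measurable borel"
    by (intro \<Phi>_meas rep_L2_borel)
  fix x
  have "\<Phi> x (rep_L2 u x) \<le> a x (rep_L2 u x) * rep_L2 u x"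
    using \<Phi>_tangent[of x "rep_L2 u x" 0] by (simp add: \<Phi>_0)
  also have "\<dots> \<le> C * (\<rho> x + (\<bar>rep_L2 u x\<bar> + \<bar>rep_L2 u x\<bar>)) ^ n"
    using a_mult_bound[of "rep_L2 u x" "\<bar>rep_L2 u x\<bar> + \<bar>rep_L2 u x\<bar>" "rep_L2 u x" x] by linarith
  finally show "\<bar>\<Phi> x (rep_L2 u x)\<bar> \<le> C * (\<rho> x + (\<bar>rep_L2 u x\<bar> + \<bar>rep_L2 u x\<bar>)) ^ n"
    using \<Phi>_nonneg[of x "rep_L2 u x"] by simp
qed

text \<open>The functional is uniformly convex for the gradient norm, since coercivity of
  \<open>A\<close> provides the defect \<kappa>/8. Along the minimising sequence the terms with
  \<open>A\<close> and \<open>f\<close> converge, while for the integral of \<open>\<Phi>\<close>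
  lower semicontinuity is enough and follows from Fatou's lemma.\<close>

lemma solution_exists:
  assumes f_add: "\<And>u v. u \<in> H10 D \<Longrightarrow> v \<in> H10 D \<Longrightarrow> f (u + v) = f u + f v"
    and f_scale: "\<And>c u. u \<in> H10 D \<Longrightarrow> f (c *\<^sub>R u) = c * f u"
    and f_bound: "\<And>u. u \<in> H10 D \<Longrightarrow> \<bar>f u\<bar> \<le> Cf * H10_norm D u"
  obtains y where "y \<in> H10 D"
    "\<And>v. v \<in> H10 D \<Longrightarrow> A y v + (\<integral>x. a x (rep_L2 y x) * rep_L2 v x \<partial>lborel) = f v"
proof -
  let ?N = "H10_norm D"
  define I where "I v = (\<integral>x. \<Phi> x (rep_L2 v x) \<partial>lborel)" for v
  define J where "J v = A v v / 2 + I v - f v" for v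
  have I_nonneg: "0 \<le> I v" for v
    unfolding I_def by (intro Bochner_Integration.integral_nonneg \<Phi>_nonneg)
  have f_diff: "f (u - v) = f u - f v" if "u \<in> H10 D" "v \<in> H10 D" for u v
    using f_add[of u "(-1) *\<^sub>R v"] f_scale[of v "-1"] H10_scaleR[OF D_open, of v "-1"] that by simp
  obtain x m where x: "\<And>n::nat. x n \<in> H10 D" "(\<lambda>n. J (x n)) \<longlonglongrightarrow> m" "\<And>y. y \<in> H10 D \<Longrightarrow> m \<le> J y"
    and cau: "\<And>e. e > 0 \<Longrightarrow> \<exists>M. \<forall>i\<ge>M. \<forall>j\<ge>M. ?N (x i - x j) < e"
  proof (rule midpoint_convex_minimizing_sequence[of "H10 D" "- (Cf\<^sup>2 / (4 * (\<kappa> / 2)))" J "\<kappa> / 8" ?N])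
    show "H10 D \<noteq> {}" using H10_zero[OF D_open] by blast
    show "- (Cf\<^sup>2 / (4 * (\<kappa> / 2))) \<le> J v" if "v \<in> H10 D" for v
      using quadratic_lower_bound[of "\<kappa> / 2" Cf "?N v"] \<kappa> f_bound[OF that] A_coercive[OF that] I_nonneg[of v]
      unfolding J_def by linarith
    show "\<kappa> / 8 > 0" using \<kappa> by simp
    show "(1/2) *\<^sub>R (u + v) \<in> H10 D \<and> J ((1/2) *\<^sub>R (u + v)) \<le> (J u + J v) / 2 - \<kappa> / 8 * (?N (u - v))\<^sup>2"
      if uv: "u \<in> H10 D" "v \<in> H10 D" for u v
    proof
      show w: "(1/2) *\<^sub>R (u + v) \<in> H10 D" by (intro H10_scaleR H10_add D_open uv)
      have "I ((1/2) *\<^sub>R (u + v)) \<le> (\<integral>x. (\<Phi> x (rep_L2 u x) + \<Phi> x (rep_L2 v x)) / 2 \<partial>lborel)"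
        unfolding I_def
      proof (rule integral_mono_AE)
        show "integrable lborel (\<lambda>x. (\<Phi> x (rep_L2 u x) + \<Phi> x (rep_L2 v x)) / 2)"
          using uv by (intro integrable_divide Bochner_Integration.integrable_add \<Phi>_integrable)
        show "AE x in lborel. \<Phi> x (rep_L2 ((1/2) *\<^sub>R (u + v)) x) \<le> (\<Phi> x (rep_L2 u x) + \<Phi> x (rep_L2 v x)) / 2"
          using rep_plus_L2[of u v] rep_scaleR_L2[of "1/2" "u + v"]
          by eventually_elim (use \<Phi>_midpoint in \<open>simp add: add_divide_distrib\<close>)
      qed (rule \<Phi>_integrable[OF w])
      also have "\<dots> = (I u + I v) / 2"
        unfolding I_def using \<Phi>_integrable[OF uv(1)] \<Phi>_integrable[OF uv(2)] by simp
      finally have "I ((1/2) *\<^sub>R (u + v)) \<le> (I u + I v) / 2" .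
      moreover have "f ((1/2) *\<^sub>R (u + v)) = (f u + f v) / 2"
        using uv by (simp add: f_scale f_add H10_add[OF D_open])
      moreover have "\<kappa> * (?N (u - v))\<^sup>2 \<le> A (u - v) (u - v)"
        by (intro A_coercive H10_diff D_open uv)
      ultimately show "J ((1/2) *\<^sub>R (u + v)) \<le> (J u + J v) / 2 - \<kappa> / 8 * (?N (u - v))\<^sup>2"
        unfolding J_def A_midpoint[OF uv] by (simp add: field_simps)
    qed
  qed (use that H10_norm_nonneg in auto)
  obtain y where y: "y \<in> H10 D" "x \<longlonglongrightarrow> y" "(\<lambda>n. ?N (x n - y)) \<longlonglongrightarrow> 0"
    using H10_complete[OF D_open D_bounded x(1) cau] by blast
  have dH: "x n - y \<in> H10 D" for n by (intro H10_diff D_open x y)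
  have f_lim: "(\<lambda>n. f (x n)) \<longlonglongrightarrow> f y"
  proof -
    have "(\<lambda>n. f (x n - y)) \<longlonglongrightarrow> 0"
    proof (rule Lim_null_comparison)
      show "(\<lambda>n. Cf * ?N (x n - y)) \<longlonglongrightarrow> 0" using tendsto_mult_left[OF y(3), of Cf] by simp
      show "\<forall>\<^sub>F n in sequentially. norm (f (x n - y)) \<le> Cf * ?N (x n - y)"
        using f_bound[OF dH] by simp
    qed
    then show ?thesis using f_diff[OF x(1) y(1)] by (simp add: LIM_zero_iff)
  qed
  have A_lim: "(\<lambda>n. A (x n) (x n)) \<longlonglongrightarrow> A y y"
  proof -
    have e: "A (x n) (x n) = A y y + 2 * A (x n - y) y + A (x n - y) (x n - y)" for n
      using A_quadratic[OF y(1) dH[of n], of 1] A_sym[OF y(1) dH[of n]] by simp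
    have l1: "(\<lambda>n. A (x n - y) y) \<longlonglongrightarrow> 0"
    proof (rule Lim_null_comparison)
      show "(\<lambda>n. CA * ?N (x n - y) * ?N y) \<longlonglongrightarrow> 0"
        using tendsto_mult_right[OF tendsto_mult_left[OF y(3), of CA], of "?N y"] by simp
      show "\<forall>\<^sub>F n in sequentially. norm (A (x n - y) y) \<le> CA * ?N (x n - y) * ?N y"
        using A_bound[OF dH y(1)] by simp
    qed
    have l2: "(\<lambda>n. A (x n - y) (x n - y)) \<longlonglongrightarrow> 0"
    proof (rule Lim_null_comparison)
      show "(\<lambda>n. CA * ?N (x n - y) * ?N (x n - y)) \<longlonglongrightarrow> 0"
        using tendsto_mult[OF tendsto_mult_left[OF y(3), of CA] y(3)] by simp
      show "\<forall>\<^sub>F n in sequentially. norm (A (x n - y) (x n - y)) \<le> CA * ?N (x n - y) * ?N (x n - y)"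
        using A_bound[OF dH dH] by simp
    qed
    have "(\<lambda>n. A y y + 2 * A (x n - y) y + A (x n - y) (x n - y)) \<longlonglongrightarrow> A y y + 2 * 0 + 0"
      by (intro tendsto_intros l1 l2)
    then show ?thesis by (simp add: e[symmetric])
  qed
  \<comment> \<open>The limit of the integrals \<open>I (x n)\<close>. Fatou's lemma shows that
    \<open>I y\<close> does not exceed it, hence \<open>J y \<le> m\<close>.\<close>
  define s where "s = m - A y y / 2 + f y"
  have I_lim: "(\<lambda>n. I (x n)) \<longlonglongrightarrow> s"
  proof -
    have "(\<lambda>n. J (x n) - A (x n) (x n) / 2 + f (x n)) \<longlonglongrightarrow> s"
      unfolding s_def by (intro tendsto_intros x(2) A_lim f_lim) simp
    then show ?thesis by (simp add: J_def)
  qed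
  have s_nonneg: "0 \<le> s"
    by (rule LIMSEQ_le_const[OF I_lim]) (use I_nonneg in auto)
  obtain r where r: "strict_mono r" "AE z in lborel. (\<lambda>n. rep_L2 (x (r n)) z) \<longlonglongrightarrow> rep_L2 y z"
    using L2_subseq_AE[OF y(2)] by blast
  have nnI: "(\<integral>\<^sup>+z. ennreal (\<Phi> z (rep_L2 v z)) \<partial>lborel) = ennreal (I v)" if "v \<in> H10 D" for v
    unfolding I_def using \<Phi>_nonneg by (intro nn_integral_eq_integral \<Phi>_integrable that) auto
  have \<Phi>_cont: "isCont (\<Phi> z) t" for z t using \<Phi>_deriv by (rule DERIV_isCont)
  have "(\<integral>\<^sup>+z. ennreal (\<Phi> z (rep_L2 y z)) \<partial>lborel)
      \<le> liminf (\<lambda>n. \<integral>\<^sup>+z. ennreal (\<Phi> z (rep_L2 (x (r n)) z)) \<partial>lborel)"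
  proof (rule nn_integral_le_liminf_AE)
    show "AE z in lborel. (\<lambda>n. ennreal (\<Phi> z (rep_L2 (x (r n)) z))) \<longlonglongrightarrow> ennreal (\<Phi> z (rep_L2 y z))"
      using r(2) by eventually_elim (intro tendsto_intros isCont_tendsto_compose[OF \<Phi>_cont])
  qed (use \<Phi>_meas[OF rep_L2_borel] in measurable)
  also have "\<dots> = liminf (\<lambda>n. ennreal (I (x (r n))))"
    by (simp add: nnI x(1))
  also have "\<dots> = ennreal s"
    using LIMSEQ_subseq_LIMSEQ[OF I_lim r(1)]
    by (intro lim_imp_Liminf tendsto_intros) (auto simp: o_def)
  finally have "I y \<le> s" using s_nonneg by (simp add: nnI[OF y(1)])
  then have Jy: "J y \<le> m" by (simp add: J_def s_def)
  txt \<open>Convexity of \<open>\<Phi>\<close> bounds the difference quotients of \<open>J\<close> at \<open>y\<close> from above, so \<open>J\<close> need not be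
    differentiated.\<close>
  define g where "g v = A y v + (\<integral>x. a x (rep_L2 y x) * rep_L2 v x \<partial>lborel) - f v" for v
  have g_nonneg: "0 \<le> g v" if v: "v \<in> H10 D" for v
  proof -
    define h where "h k = 1 / real (Suc k)" for k
    have h: "0 < h k" "h k \<le> 1" for k by (auto simp: h_def)
    have h0: "h \<longlonglongrightarrow> 0" unfolding h_def by (rule LIMSEQ_Suc[OF lim_1_over_n])
    have w: "y + h k *\<^sub>R v \<in> H10 D" for k by (intro H10_add H10_scaleR D_open y v)
    \<comment> \<open>The slope of \<open>\<Phi>\<close> is taken at the displaced point, where the
      subgradient inequality bounds the increment from above. Dominated convergence moves the slope
      back to \<open>y\<close>; \<open>h k \<le> 1\<close> makes the majorant independent of
      \<open>k\<close>.\<close>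
    define b where "b k x = a x (rep_L2 y x + h k * rep_L2 v x) * rep_L2 v x" for k x
    have b_meas [measurable]: "b k \<in> borel_measurable borel" for k
      unfolding b_def by (intro borel_measurable_times a_meas borel_measurable_add borel_measurable_const rep_L2_borel)
    have b_bound: "\<bar>b k x\<bar> \<le> C * (\<rho> x + (\<bar>rep_L2 y x\<bar> + \<bar>rep_L2 v x\<bar>)) ^ n" for k x
      unfolding b_def
    proof (rule a_mult_bound)
      have "\<bar>h k * rep_L2 v x\<bar> \<le> \<bar>rep_L2 v x\<bar>"
        using h[of k] by (simp add: abs_mult mult_left_le_one_le)
      then show "\<bar>rep_L2 y x + h k * rep_L2 v x\<bar> \<le> \<bar>rep_L2 y x\<bar> + \<bar>rep_L2 v x\<bar>" by linarith
    qed simp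
    have b_int: "integrable lborel (b k)" for k
      by (rule Lp_fun_dominates[OF Lp_dominating[OF y(1) v] b_meas b_bound])
    have ge: "0 \<le> A y v + h k / 2 * A v v - f v + (\<integral>x. b k x \<partial>lborel)" for k
    proof -
      have "I (y + h k *\<^sub>R v) - I y = (\<integral>x. \<Phi> x (rep_L2 (y + h k *\<^sub>R v) x) - \<Phi> x (rep_L2 y x) \<partial>lborel)"
        unfolding I_def by (intro Bochner_Integration.integral_diff[symmetric] \<Phi>_integrable w y)
      also have "\<dots> \<le> (\<integral>x. h k * b k x \<partial>lborel)"
      proof (rule integral_mono_AE)
        show "integrable lborel (\<lambda>x. \<Phi> x (rep_L2 (y + h k *\<^sub>R v) x) - \<Phi> x (rep_L2 y x))"
          by (intro Bochner_Integration.integrable_diff \<Phi>_integrable w y)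
        show "AE x in lborel. \<Phi> x (rep_L2 (y + h k *\<^sub>R v) x) - \<Phi> x (rep_L2 y x) \<le> h k * b k x"
          using rep_plus_L2[of y "h k *\<^sub>R v"] rep_scaleR_L2[of "h k" v]
        proof eventually_elim
          case (elim x)
          then show ?case
            using \<Phi>_tangent[of x "rep_L2 y x + h k * rep_L2 v x" "rep_L2 y x"] by (simp add: b_def mult_ac)
        qed
      qed (intro integrable_mult_right b_int)
      also have "\<dots> = h k * (\<integral>x. b k x \<partial>lborel)" by simp
      finally have i: "I (y + h k *\<^sub>R v) \<le> I y + h k * (\<integral>x. b k x \<partial>lborel)" by simp
      have "J y \<le> J (y + h k *\<^sub>R v)" using x(3)[OF w[of k]] Jy by linarith
      then have "0 \<le> h k * A y v + (h k)\<^sup>2 / 2 * A v v + h k * (\<integral>x. b k x \<partial>lborel) - h k * f v"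
        unfolding J_def A_quadratic[OF y(1) v] using i
        by (simp add: f_add[OF y(1) H10_scaleR[OF D_open v]] f_scale[OF v] add_divide_distrib)
      also have "\<dots> = h k * (A y v + h k / 2 * A v v - f v + (\<integral>x. b k x \<partial>lborel))"
        by (simp add: power2_eq_square algebra_simps)
      finally show ?thesis using h(1)[of k] by (simp add: zero_le_mult_iff)
    qed
    have b_lim: "(\<lambda>k. \<integral>x. b k x \<partial>lborel) \<longlonglongrightarrow> (\<integral>x. a x (rep_L2 y x) * rep_L2 v x \<partial>lborel)"
    proof (rule integral_dominated_convergence[where w = "\<lambda>x. C * \<bar>\<rho> x + (\<bar>rep_L2 y x\<bar> + \<bar>rep_L2 v x\<bar>)\<bar> ^ n"])
      show "integrable lborel (\<lambda>x. C * \<bar>\<rho> x + (\<bar>rep_L2 y x\<bar> + \<bar>rep_L2 v x\<bar>)\<bar> ^ n)"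
        using Lp_dominating[OF y(1) v] by (simp add: Lp_fun_def)
      show "AE x in lborel. norm (b k x) \<le> C * \<bar>\<rho> x + (\<bar>rep_L2 y x\<bar> + \<bar>rep_L2 v x\<bar>)\<bar> ^ n" for k
        using b_bound \<rho> by (intro AE_I2) (simp add: abs_of_nonneg)
      show "AE x in lborel. (\<lambda>k. b k x) \<longlonglongrightarrow> a x (rep_L2 y x) * rep_L2 v x"
      proof (intro AE_I2)
        fix x
        have "(\<lambda>k. rep_L2 y x + h k * rep_L2 v x) \<longlonglongrightarrow> rep_L2 y x + 0 * rep_L2 v x"
          by (intro tendsto_intros h0)
        then have "(\<lambda>k. a x (rep_L2 y x + h k * rep_L2 v x)) \<longlonglongrightarrow> a x (rep_L2 y x)"
          by (intro isCont_tendsto_compose[OF a_cont]) simp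
        then show "(\<lambda>k. b k x) \<longlonglongrightarrow> a x (rep_L2 y x) * rep_L2 v x"
          unfolding b_def by (intro tendsto_mult tendsto_const)
      qed
    qed (use a_meas[OF rep_L2_borel] in measurable)
    have "(\<lambda>k. A y v + h k / 2 * A v v - f v + (\<integral>x. b k x \<partial>lborel))
       \<longlonglongrightarrow> A y v + 0 / 2 * A v v - f v + (\<integral>x. a x (rep_L2 y x) * rep_L2 v x \<partial>lborel)"
      by (intro tendsto_intros h0 b_lim) simp
    then have "0 \<le> A y v + 0 / 2 * A v v - f v + (\<integral>x. a x (rep_L2 y x) * rep_L2 v x \<partial>lborel)"
      by (rule LIMSEQ_le_const) (use ge in auto)
    then show ?thesis by (simp add: g_def)
  qed
  \<comment> \<open>\<open>g\<close> is odd, so the one-sided inequality for \<open>v\<close> and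
    for its negative gives equality.\<close>
  have g_zero: "g v = 0" if v: "v \<in> H10 D" for v
  proof -
    have mv: "(-1) *\<^sub>R v \<in> H10 D" by (intro H10_scaleR D_open v)
    have "(\<integral>x. a x (rep_L2 y x) * rep_L2 ((-1) *\<^sub>R v) x \<partial>lborel) = (\<integral>x. - (a x (rep_L2 y x) * rep_L2 v x) \<partial>lborel)"
    proof (rule integral_cong_AE)
      show "AE x in lborel. a x (rep_L2 y x) * rep_L2 ((-1) *\<^sub>R v) x = - (a x (rep_L2 y x) * rep_L2 v x)"
        using rep_scaleR_L2[of "-1" v] by eventually_elim simp
    qed (use a_meas[OF rep_L2_borel] in measurable)
    then have "g ((-1) *\<^sub>R v) = - g v"
      unfolding g_def A_scale2[OF v y(1)] f_scale[OF v] by simp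
    then show ?thesis using g_nonneg[OF v] g_nonneg[OF mv] by linarith
  qed
  show ?thesis
    by (rule that[OF y(1)]) (use g_zero in \<open>simp add: g_def\<close>)
qed

end

section \<open>State and adjoint state\<close>

text \<open>The cut-off keeps the product measurable and square integrable when \<open>g\<close> is
  controlled on \<open>D\<close> only.\<close>

definition mult_on :: "'a set \<Rightarrow> ('a::euclidean_space \<Rightarrow> real) \<Rightarrow> ('a, real) L2 \<Rightarrow> ('a, real) L2" where
  "mult_on D g u = abs_L2 (\<lambda>x. indicator D x * g x * rep_L2 u x)"

context
  fixes D :: "'a::euclidean_space set" and g :: "'a \<Rightarrow> real" and s :: real
  assumes D: "open D" and gc: "continuous_on D g" and gb: "\<And>x. x \<in> D \<Longrightarrow> \<bar>g x\<bar> \<le> s"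
begin

lemma mult_on_measurable: "(\<lambda>x. indicator D x * g x) \<in> borel_measurable borel"
  using borel_measurable_continuous_on_indicator[OF _ gc] D by simp

lemma mult_on_bound: "\<bar>indicator D x * g x * t\<bar> \<le> \<bar>s\<bar> * \<bar>t\<bar>"
  using gb[of x] by (auto simp: indicator_def abs_mult intro!: mult_right_mono)

lemma mult_on_sq_int: "sq_int (\<lambda>x. indicator D x * g x * rep_L2 u x)"
proof (rule sq_int_bound[OF sq_int_rep_L2[of u], where C = "\<bar>s\<bar>"])
  show "(\<lambda>x. indicator D x * g x * rep_L2 u x) \<in> borel_measurable borel"
    by (intro borel_measurable_times[OF mult_on_measurable rep_L2_borel])
qed (simp add: mult_on_bound del: abs_mult)

lemma mult_on_inner: "mult_on D g u \<bullet> v = (\<integral>x. indicator D x * g x * rep_L2 u x * rep_L2 v x \<partial>lborel)"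
  unfolding mult_on_def by (subst inner_commute, subst inner_L2_abs[OF mult_on_sq_int]) (simp add: mult.commute)

lemma mult_on_sym: "mult_on D g u \<bullet> v = u \<bullet> mult_on D g v"
  by (subst inner_commute[of u]) (simp add: mult_on_inner mult_ac)

lemma mult_on_in_L2_on: "mult_on D g u \<in> L2_on D"
  unfolding mult_on_def by (rule abs_in_L2_on[OF mult_on_sq_int]) simp

lemma norm_mult_on: "norm (mult_on D g u) \<le> \<bar>s\<bar> * norm u"
proof (rule power2_le_imp_le)
  have "(norm (mult_on D g u))\<^sup>2 = (\<integral>x. (norm (indicator D x * g x * rep_L2 u x))\<^sup>2 \<partial>lborel)"
    unfolding mult_on_def by (rule norm_abs_L2_sq[OF mult_on_sq_int])
  also have "\<dots> \<le> (\<integral>x. \<bar>s\<bar>\<^sup>2 * (norm (rep_L2 u x))\<^sup>2 \<partial>lborel)"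
  proof (rule integral_mono)
    show "integrable lborel (\<lambda>x. (norm (indicator D x * g x * rep_L2 u x))\<^sup>2)"
      using mult_on_sq_int by (simp add: sq_int_def)
    show "integrable lborel (\<lambda>x. \<bar>s\<bar>\<^sup>2 * (norm (rep_L2 u x))\<^sup>2)"
      by (intro integrable_mult_right rep_L2_norm_integrable)
    fix x
    have "(norm (indicator D x * g x * rep_L2 u x))\<^sup>2 \<le> (\<bar>s\<bar> * \<bar>rep_L2 u x\<bar>)\<^sup>2"
      unfolding real_norm_def by (intro power_mono mult_on_bound) simp
    then show "(norm (indicator D x * g x * rep_L2 u x))\<^sup>2 \<le> \<bar>s\<bar>\<^sup>2 * (norm (rep_L2 u x))\<^sup>2"
      by (simp add: power_mult_distrib)
  qed
  also have "\<dots> = (\<bar>s\<bar> * norm u)\<^sup>2"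
    by (simp add: norm_L2_sq power_mult_distrib)
  finally show "(norm (mult_on D g u))\<^sup>2 \<le> (\<bar>s\<bar> * norm u)\<^sup>2" .
qed simp

end

text \<open>The data frozen at one sample. The growth exponents n - 1, n - 2 and n - 3 of q, q' and
  q'' are those for which one, two or three further factors complete an n-th power.\<close>

locale state_problem = elliptic_form D A \<kappa> CA n
  for D :: "'a::euclidean_space set" and A \<kappa> CA n +
  fixes b :: "('a, real) L2 \<Rightarrow> real" and g :: "'a \<Rightarrow> real" and B :: "('a, real) L2 \<Rightarrow> ('a, real) L2 \<Rightarrow> real"
    and q q' q'' Q :: "real \<Rightarrow> real" and bmax s Ks Cq Cq' Cq'' :: real
  assumes b_add: "\<And>u v. u \<in> H10 D \<Longrightarrow> v \<in> H10 D \<Longrightarrow> b (u + v) = b u + b v"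
    and b_scale: "\<And>c u. u \<in> H10 D \<Longrightarrow> b (c *\<^sub>R u) = c * b u"
    and b_bound: "\<And>u. u \<in> H10 D \<Longrightarrow> \<bar>b u\<bar> \<le> bmax * H10_norm D u"
    and g_cont: "continuous_on D g" and g_bound: "\<And>x. x \<in> D \<Longrightarrow> \<bar>g x\<bar> \<le> s" and s: "s \<ge> 0"
    and B_eq: "\<And>u v. u \<in> L2_on D \<Longrightarrow> v \<in> H10 D \<Longrightarrow> B u v = (LINT x:D|lborel. (g x * rep_L2 u x) * rep_L2 v x)"
    and Sobolev_bound: "\<And>v. v \<in> H10 D \<Longrightarrow> (\<integral>x. \<bar>rep_L2 v x\<bar> ^ n \<partial>lborel) \<le> Ks * H10_norm D v ^ n"
    and q_deriv: "\<And>t. (q has_field_derivative q' t) (at t)" and q'_deriv: "\<And>t. (q' has_field_derivative q'' t) (at t)"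
    and q_0: "q 0 = 0" and q_mono: "mono q" and Q_deriv: "\<And>t. (Q has_field_derivative q t) (at t)" and Q_0: "Q 0 = 0"
    and n3: "n > 3" and q_growth: "\<And>t. \<bar>q t\<bar> \<le> Cq * (1 + \<bar>t\<bar>) ^ (n - 1)"
    and q'_growth: "\<And>t. \<bar>q' t\<bar> \<le> Cq' * (1 + \<bar>t\<bar>) ^ (n - 2)"
    and q''_growth: "\<And>t. \<bar>q'' t\<bar> \<le> Cq'' * (1 + \<bar>t\<bar>) ^ (n - 3)"
begin

abbreviation N where "N \<equiv> H10_norm D"
abbreviation CD where "CD \<equiv> embedding_const D"
abbreviation gm where "gm \<equiv> mult_on D g"

lemma gm_inner: "gm u \<bullet> v = (\<integral>x. indicator D x * g x * rep_L2 u x * rep_L2 v x \<partial>lborel)"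
  by (rule mult_on_inner[OF D_open g_cont g_bound])

lemma gm_sym: "gm u \<bullet> v = u \<bullet> gm v"
  by (rule mult_on_sym[OF D_open g_cont g_bound])

lemma norm_gm: "norm (gm u) \<le> s * norm u"
proof -
  have "norm (gm u) \<le> \<bar>s\<bar> * norm u" by (rule norm_mult_on[OF D_open g_cont g_bound])
  with s show ?thesis by simp
qed

lemma B_gm: "u \<in> L2_on D \<Longrightarrow> v \<in> H10 D \<Longrightarrow> B u v = gm u \<bullet> v"
  unfolding gm_inner by (simp add: B_eq set_lebesgue_integral_def mult_ac)

lemma CD: "v \<in> H10 D \<Longrightarrow> norm v \<le> CD * N v" "0 \<le> CD"
  using embedding_const[OF D_open D_bounded] by auto

lemma D_indicator_Lp: "Lp_fun n (indicator D)"
proof -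
  have "(\<lambda>x. \<bar>indicat_real D x\<bar> ^ n) = indicat_real D"
    using n by (auto simp: indicator_def fun_eq_iff)
  moreover have "integrable lborel (indicat_real D)"
    using D_open emeasure_bounded_finite[OF D_bounded] by (intro integrable_real_indicator) auto
  ultimately show ?thesis using D_open by (simp add: Lp_fun_def)
qed

lemma q_measurable [measurable]: "q \<in> borel_measurable borel" "q' \<in> borel_measurable borel" "Q \<in> borel_measurable borel"
  using DERIV_isCont[OF q_deriv] DERIV_isCont[OF q'_deriv] DERIV_isCont[OF Q_deriv]
  by (auto intro!: borel_measurable_continuous_onI continuous_at_imp_continuous_on)

lemma D_measurable [measurable]: "D \<in> sets borel" using D_open by simp

lemma q'_nonneg: "0 \<le> q' t"
  by (rule mono_on_imp_deriv_nonneg[OF q_mono q_deriv]) simp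

lemma growth_constants_nonneg: "0 \<le> Cq" "0 \<le> Cq'" "0 \<le> Cq''"
  using q_growth[of 0] q'_growth[of 0] q''_growth[of 0] by (auto intro: order_trans[OF abs_ge_zero])

text \<open>The constant 1 in the growth bound of \<open>q\<close> becomes the indicator of
  \<open>D\<close>, which is integrable to the n-th power because \<open>D\<close> is
  bounded.\<close>

sublocale state: semilinear D A \<kappa> CA n "\<lambda>x t. indicator D x * q t" "\<lambda>x t. indicator D x * Q t" "indicator D" Cq
proof
  fix x :: 'a and t :: real
  show "((\<lambda>t. indicator D x * Q t) has_field_derivative indicator D x * q t) (at t)"
    by (rule DERIV_cmult[OF Q_deriv])
  show "isCont (\<lambda>t. indicator D x * q t) t"
    by (intro continuous_intros DERIV_isCont[OF q_deriv])
  show "\<bar>indicator D x * q t\<bar> \<le> Cq * (indicator D x + \<bar>t\<bar>) ^ (n - 1)"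
    using q_growth[of t] growth_constants_nonneg by (auto simp: indicator_def)
  show "indicator D x * q r \<le> indicator D x * q t" if "r \<le> t" for r
    using q_mono that by (auto simp: indicator_def monoD)
qed (auto simp: q_0 Q_0 growth_constants_nonneg D_indicator_Lp)

abbreviation solves where "solves u y \<equiv> solves_state_eq D A q b B u y"

lemma superposition_eq: "superposition_op D q y v = (\<integral>x. indicator D x * q (rep_L2 y x) * rep_L2 v x \<partial>lborel)"
  by (simp add: superposition_op_def set_lebesgue_integral_def mult_ac)

lemma solvesD:
  assumes "solves u y" "u \<in> L2_on D" "v \<in> H10 D"
  shows "A y v + (\<integral>x. indicator D x * q (rep_L2 y x) * rep_L2 v x \<partial>lborel) = b v + gm u \<bullet> v"
  using assms by (auto simp: solves_state_eq_def superposition_eq B_gm)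

lemma solves_H10: "solves u y \<Longrightarrow> y \<in> H10 D"
  by (simp add: solves_state_eq_def)

lemma solves_exists:
  assumes u: "u \<in> L2_on D"
  shows "\<exists>y. solves u y"
proof -
  have "\<bar>b v + gm u \<bullet> v\<bar> \<le> (bmax + norm (gm u) * CD) * N v" if v: "v \<in> H10 D" for v
  proof -
    have "\<bar>gm u \<bullet> v\<bar> \<le> norm (gm u) * norm v" by (rule Cauchy_Schwarz_ineq2)
    also have "\<dots> \<le> norm (gm u) * (CD * N v)" by (intro mult_left_mono CD v) simp
    finally show ?thesis using b_bound[OF v] by (simp add: algebra_simps)
  qed
  from state.solution_exists[of "\<lambda>v. b v + gm u \<bullet> v", OF _ _ this]
  obtain y where y: "y \<in> H10 D"
    "\<And>v. v \<in> H10 D \<Longrightarrow> A y v + (\<integral>x. indicator D x * q (rep_L2 y x) * rep_L2 v x \<partial>lborel) = b v + gm u \<bullet> v"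
    by (auto simp: b_add b_scale inner_add_right algebra_simps)
  then have "solves u y"
    by (auto simp: solves_state_eq_def superposition_eq B_gm[OF u])
  then show ?thesis by blast
qed

text \<open>The multiplication by \<open>g\<close> is moved from the controls to the test function.
  With the adjoint state as test function, the right-hand side is therefore the directional term of
  the gradient.\<close>

lemma solution_difference:
  assumes y: "solves u y" and y': "solves u' y'" and u: "u \<in> L2_on D" "u' \<in> L2_on D" and v: "v \<in> H10 D"
  shows "A (y' - y) v + (\<integral>x. indicator D x * (q (rep_L2 y' x) - q (rep_L2 y x)) * rep_L2 v x \<partial>lborel) = gm v \<bullet> (u' - u)"
proof -
  note yH = solves_H10[OF y] and yH' = solves_H10[OF y']
  have "(\<integral>x. indicator D x * (q (rep_L2 y' x) - q (rep_L2 y x)) * rep_L2 v x \<partial>lborel)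
    = (\<integral>x. indicator D x * q (rep_L2 y' x) * rep_L2 v x - indicator D x * q (rep_L2 y x) * rep_L2 v x \<partial>lborel)"
    by (simp add: algebra_simps)
  also have "\<dots> = (\<integral>x. indicator D x * q (rep_L2 y' x) * rep_L2 v x \<partial>lborel) - (\<integral>x. indicator D x * q (rep_L2 y x) * rep_L2 v x \<partial>lborel)"
    by (intro Bochner_Integration.integral_diff state.a_integrable yH yH' v)
  also have "A (y' - y) v + \<dots> = gm u' \<bullet> v - gm u \<bullet> v"
    using solvesD[OF y u(1) v] solvesD[OF y' u(2) v] by (simp add: A_diff[OF yH' yH v])
  also have "\<dots> = gm v \<bullet> (u' - u)"
    unfolding gm_sym[of u' v] gm_sym[of u v] by (simp add: inner_commute[of "gm v"] inner_diff_left)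
  finally show ?thesis .
qed

text \<open>Test with the difference of the states: the nonlinear term is nonnegative because
  \<open>q\<close> is monotone, and coercivity does the rest.\<close>

lemma solution_Lipschitz:
  assumes y: "solves u y" and y': "solves u' y'" and u: "u \<in> L2_on D" "u' \<in> L2_on D"
  shows "N (y' - y) \<le> s * CD / \<kappa> * norm (u' - u)"
proof -
  let ?w = "y' - y"
  have w: "?w \<in> H10 D" by (intro H10_diff D_open solves_H10[OF y] solves_H10[OF y'])
  have "0 \<le> (\<integral>x. indicator D x * (q (rep_L2 y' x) - q (rep_L2 y x)) * rep_L2 ?w x \<partial>lborel)"
  proof (rule integral_nonneg_AE)
    show "AE x in lborel. 0 \<le> indicator D x * (q (rep_L2 y' x) - q (rep_L2 y x)) * rep_L2 ?w x"
      using rep_minus_L2[of y' y]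
    proof eventually_elim
      case (elim x)
      have "0 \<le> (q t' - q t) * (t' - t)" for t' t
        using monoD[OF q_mono, of t t'] monoD[OF q_mono, of t' t]
        by (cases "t \<le> t'") (auto simp: mult_nonneg_nonneg mult_nonpos_nonpos)
      then show ?case using elim by (simp add: indicator_def)
    qed
  qed
  then have "\<kappa> * (N ?w)\<^sup>2 \<le> gm ?w \<bullet> (u' - u)"
    using solution_difference[OF y y' u w] A_coercive[OF w] by linarith
  also have "\<dots> \<le> norm (gm ?w) * norm (u' - u)"
    by (rule norm_cauchy_schwarz)
  also have "\<dots> \<le> (s * (CD * N ?w)) * norm (u' - u)"
    by (intro mult_right_mono order_trans[OF norm_gm] mult_left_mono CD w s) simp
  finally have "N ?w * (\<kappa> * N ?w) \<le> N ?w * (s * CD * norm (u' - u))"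
    by (simp add: power2_eq_square mult_ac)
  moreover have "0 \<le> s * CD * norm (u' - u)" using s CD(2) by simp
  ultimately have "\<kappa> * N ?w \<le> s * CD * norm (u' - u)"
    using H10_norm_nonneg[of D ?w] \<kappa> by (cases "N ?w = 0") (auto simp: mult_le_cancel_left)
  then show ?thesis using \<kappa> by (simp add: field_simps)
qed

lemma solves_unique:
  assumes "solves u y" "solves u y'" "u \<in> L2_on D"
  shows "y' = y"
proof -
  have "y' - y \<in> H10 D"
    by (rule H10_diff[OF D_open solves_H10[OF assms(2)] solves_H10[OF assms(1)]])
  moreover have "N (y' - y) \<le> 0" using solution_Lipschitz[OF assms(1,2,3,3)] by simp
  ultimately have "norm (y' - y) \<le> 0"
    using CD(1)[of "y' - y"] H10_norm_nonneg[of D "y' - y"] by simp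
  then show ?thesis by simp
qed

definition S where "S u = (THE y. solves u y)"

lemma solves_S: "u \<in> L2_on D \<Longrightarrow> solves u (S u)"
  unfolding S_def using solves_exists solves_unique by (metis theI')

lemma S_H10: "u \<in> L2_on D \<Longrightarrow> S u \<in> H10 D"
  using solves_S solves_H10 by blast

text \<open>Test with the state itself; \<open>q t * t \<ge> 0\<close> follows from monotonicity and
  \<open>q 0 = 0\<close>.\<close>

lemma S_bound:
  assumes u: "u \<in> L2_on D" and bm: "0 \<le> bmax"
  shows "N (S u) \<le> bmax / \<kappa> + CD / \<kappa> * s * norm u"
proof -
  let ?y = "S u"
  note y = S_H10[OF u]
  have "0 \<le> (\<integral>x. indicator D x * q (rep_L2 ?y x) * rep_L2 ?y x \<partial>lborel)"
  proof (rule Bochner_Integration.integral_nonneg)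
    fix x
    have "0 \<le> q t * t" for t
      using monoD[OF q_mono, of t 0] monoD[OF q_mono, of 0 t] q_0
      by (cases "t \<le> 0") (auto simp: mult_nonneg_nonneg mult_nonpos_nonpos)
    then show "0 \<le> indicator D x * q (rep_L2 ?y x) * rep_L2 ?y x" by (simp add: indicator_def)
  qed
  then have "\<kappa> * (N ?y)\<^sup>2 \<le> b ?y + gm u \<bullet> ?y"
    using solvesD[OF solves_S[OF u] u y] A_coercive[OF y] by linarith
  also have "\<dots> \<le> bmax * N ?y + (s * norm u) * (CD * N ?y)"
  proof (rule add_mono)
    show "b ?y \<le> bmax * N ?y" using b_bound[OF y] by simp
    have "gm u \<bullet> ?y \<le> norm (gm u) * norm ?y" by (rule norm_cauchy_schwarz)
    also have "\<dots> \<le> (s * norm u) * (CD * N ?y)"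
      by (intro mult_mono norm_gm CD y) (use s in auto)
    finally show "gm u \<bullet> ?y \<le> (s * norm u) * (CD * N ?y)" .
  qed
  finally have "N ?y * (\<kappa> * N ?y) \<le> N ?y * (bmax + CD * s * norm u)"
    by (simp add: power2_eq_square algebra_simps)
  moreover have "0 \<le> bmax + CD * s * norm u" using s CD(2) bm by simp
  ultimately have "\<kappa> * N ?y \<le> bmax + CD * s * norm u"
    using H10_norm_nonneg[of D ?y] \<kappa> by (cases "N ?y = 0") (auto simp: mult_le_cancel_left)
  then show ?thesis using \<kappa> by (simp add: field_simps)
qed

text \<open>The linear equation is treated as a semilinear one with potential q'(y) t^2 / 2, convex
  because q' is nonnegative. The growth of order n - 2 in y and 1 in t fits the locale once
  \<open>\<bar>y\<bar>\<close> is put into \<open>\<rho>\<close>. Integrability is exported so that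
  integrals can be subtracted later.\<close>

lemma adjoint_exists:
  assumes y: "y \<in> H10 D"
  obtains z where "z \<in> H10 D" "N z \<le> CD / \<kappa> * norm f"
    "\<And>v. v \<in> H10 D \<Longrightarrow> integrable lborel (\<lambda>x. indicator D x * (q' (rep_L2 y x) * rep_L2 z x) * rep_L2 v x)"
    "\<And>v. v \<in> H10 D \<Longrightarrow> A z v + (\<integral>x. indicator D x * (q' (rep_L2 y x) * rep_L2 z x) * rep_L2 v x \<partial>lborel) = f \<bullet> v"
proof -
  interpret adj: semilinear D A \<kappa> CA n "\<lambda>x t. indicator D x * (q' (rep_L2 y x) * t)"
    "\<lambda>x t. indicator D x * (q' (rep_L2 y x) * (t\<^sup>2 / 2))" "\<lambda>x. indicator D x + \<bar>rep_L2 y x\<bar>" Cq'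
  proof
    fix x :: 'a and t :: real
    let ?c = "q' (rep_L2 y x)"
    show "((\<lambda>t. indicator D x * (?c * (t\<^sup>2 / 2))) has_field_derivative indicator D x * (?c * t)) (at t)"
      by (auto intro!: derivative_eq_intros)
    show "isCont (\<lambda>t. indicator D x * (?c * t)) t"
      by (intro continuous_intros)
    show "\<bar>indicator D x * (?c * t)\<bar> \<le> Cq' * (indicator D x + \<bar>rep_L2 y x\<bar> + \<bar>t\<bar>) ^ (n - 1)"
    proof (cases "x \<in> D")
      case True
      let ?r = "1 + \<bar>rep_L2 y x\<bar> + \<bar>t\<bar>"
      have "\<bar>?c * t\<bar> \<le> Cq' * (1 + \<bar>rep_L2 y x\<bar>) ^ (n - 2) * \<bar>t\<bar>"
        unfolding abs_mult by (intro mult_right_mono q'_growth) simp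
      also have "\<dots> \<le> Cq' * ?r ^ (n - 2) * \<bar>t\<bar>"
        by (intro mult_right_mono mult_left_mono power_mono growth_constants_nonneg) auto
      also have "\<dots> \<le> Cq' * ?r ^ (n - 1)"
        using power_pred_mult_le[of "\<bar>t\<bar>" ?r "n - 1" Cq'] n3 growth_constants_nonneg by (simp add: numeral_2_eq_2)
      finally show ?thesis using True by simp
    qed (simp add: growth_constants_nonneg)
    show "indicator D x * (?c * r) \<le> indicator D x * (?c * t)" if "r \<le> t" for r
      using that q'_nonneg[of "rep_L2 y x"] by (auto simp: indicator_def intro: mult_left_mono)
  next
    show "Lp_fun n (\<lambda>x. indicator D x + \<bar>rep_L2 y x\<bar>)"
      using Lp_fun_add_abs[OF D_indicator_Lp H10_Lp[OF y]] by simp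
  qed (auto simp: growth_constants_nonneg)
  have "\<bar>f \<bullet> v\<bar> \<le> (norm f * CD) * N v" if "v \<in> H10 D" for v
    using Cauchy_Schwarz_ineq2[of f v] mult_left_mono[OF CD(1)[OF that], of "norm f"] by (simp add: mult_ac)
  from adj.solution_exists[of "\<lambda>v. f \<bullet> v", OF _ _ this]
  obtain z where z: "z \<in> H10 D"
    "\<And>v. v \<in> H10 D \<Longrightarrow> A z v + (\<integral>x. indicator D x * (q' (rep_L2 y x) * rep_L2 z x) * rep_L2 v x \<partial>lborel) = f \<bullet> v"
    by (auto simp: inner_add_right)
  have "0 \<le> (\<integral>x. indicator D x * (q' (rep_L2 y x) * rep_L2 z x) * rep_L2 z x \<partial>lborel)"
  proof (rule Bochner_Integration.integral_nonneg)
    fix x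
    have "0 \<le> q' (rep_L2 y x) * (rep_L2 z x * rep_L2 z x)"
      by (intro mult_nonneg_nonneg q'_nonneg zero_le_square)
    then show "0 \<le> indicator D x * (q' (rep_L2 y x) * rep_L2 z x) * rep_L2 z x"
      by (simp add: indicator_def mult.assoc)
  qed
  then have "\<kappa> * (N z)\<^sup>2 \<le> f \<bullet> z"
    using z(2)[OF z(1)] A_coercive[OF z(1)] by linarith
  also have "\<dots> \<le> norm f * norm z" by (rule norm_cauchy_schwarz)
  also have "\<dots> \<le> norm f * (CD * N z)" by (intro mult_left_mono CD z) simp
  finally have "N z * (\<kappa> * N z) \<le> N z * (CD * norm f)"
    by (simp add: power2_eq_square mult_ac)
  moreover have "0 \<le> CD * norm f" using CD(2) by simp
  ultimately have "\<kappa> * N z \<le> CD * norm f"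
    using H10_norm_nonneg[of D z] \<kappa> by (cases "N z = 0") (auto simp: mult_le_cancel_left)
  then have "N z \<le> CD / \<kappa> * norm f" using \<kappa> by (simp add: field_simps)
  with z show ?thesis by (intro that adj.a_integrable)
qed

text \<open>The mean value inequality is used twice on the interval around \<open>t\<close> of
  radius \<open>\<bar>r - t\<bar>\<close>: for q', and then for q minus its linear part. The factor
  1/2 of Taylor's formula is given away.\<close>

lemma q_Taylor: "\<bar>q r - q t - q' t * (r - t)\<bar> \<le> Cq'' * (1 + \<bar>t\<bar> + \<bar>r - t\<bar>) ^ (n - 3) * (r - t)\<^sup>2"
proof -
  let ?S = "cball t \<bar>r - t\<bar>" and ?M = "Cq'' * (1 + \<bar>t\<bar> + \<bar>r - t\<bar>) ^ (n - 3)"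
  have b: "norm (q'' z) \<le> ?M" if "z \<in> ?S" for z
  proof -
    have "\<bar>z\<bar> \<le> \<bar>t\<bar> + \<bar>r - t\<bar>" using that by (auto simp: dist_real_def)
    then have "Cq'' * (1 + \<bar>z\<bar>) ^ (n - 3) \<le> ?M"
      by (intro mult_left_mono power_mono growth_constants_nonneg) auto
    with q''_growth[of z] show ?thesis by simp
  qed
  have d: "norm (q' z - q' t) \<le> ?M * \<bar>r - t\<bar>" if z: "z \<in> ?S" for z
  proof -
    have "norm (q' z - q' t) \<le> ?M * norm (z - t)"
      by (rule field_differentiable_bound[of ?S q' q'']) (use z q'_deriv b in \<open>auto intro: has_field_derivative_at_within\<close>)
    also have "\<dots> \<le> ?M * \<bar>r - t\<bar>"
      using z growth_constants_nonneg by (intro mult_left_mono) (auto simp: dist_real_def abs_minus_commute)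
    finally show ?thesis .
  qed
  have "norm ((q r - q' t * r) - (q t - q' t * t)) \<le> ?M * \<bar>r - t\<bar> * norm (r - t)"
  proof (rule field_differentiable_bound[of ?S "\<lambda>z. q z - q' t * z" "\<lambda>z. q' z - q' t"])
    fix z show "((\<lambda>z. q z - q' t * z) has_field_derivative q' z - q' t) (at z within ?S)"
      by (rule has_field_derivative_at_within) (auto intro!: derivative_eq_intros q_deriv)
  qed (use d in \<open>auto simp: dist_real_def\<close>)
  moreover have "(q r - q' t * r) - (q t - q' t * t) = q r - q t - q' t * (r - t)"
    by (simp add: algebra_simps)
  ultimately show ?thesis
    by (simp only: real_norm_def mult.assoc abs_mult_self_eq power2_eq_square)
qed

text \<open>Scaling \<open>y' - y\<close> to unit norm leaves a bounded power of one \<open>L\<^sup>n\<close> function under the integral, which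
  replaces Hoelder's inequality.\<close>

lemma remainder_integral_bound:
  assumes y: "y \<in> H10 D" and z: "z \<in> H10 D"
  obtains K where "K \<ge> 0" "\<And>y'. y' \<in> H10 D \<Longrightarrow> N (y' - y) \<le> 1 \<Longrightarrow>
    \<bar>\<integral>x. indicator D x * (q (rep_L2 y' x) - q (rep_L2 y x) - q' (rep_L2 y x) * rep_L2 (y' - y) x) * rep_L2 z x \<partial>lborel\<bar>
      \<le> K * (N (y' - y))\<^sup>2"
proof -
  define \<sigma> where "\<sigma> x = indicator D x + (\<bar>rep_L2 y x\<bar> + \<bar>rep_L2 z x\<bar>)" for x
  have \<sigma>: "Lp_fun n \<sigma>" "0 \<le> \<sigma> x" for x
    unfolding \<sigma>_def using state.Lp_dominating[OF y z] by auto
  define I where "I = (\<integral>x. \<bar>\<sigma> x\<bar> ^ n \<partial>lborel)"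
  define K where "K = Cq'' * (2 ^ n * (I + \<bar>Ks\<bar>))"
  have I: "0 \<le> I" unfolding I_def by simp
  show ?thesis
  proof (rule that[of K])
    show "K \<ge> 0" unfolding K_def using I growth_constants_nonneg by simp
    fix y' assume y': "y' \<in> H10 D" and le: "N (y' - y) \<le> 1"
    define w where "w = y' - y"
    define l where "l = N w"
    have w: "w \<in> H10 D" unfolding w_def by (intro H10_diff D_open y y')
    have l: "0 \<le> l" "l \<le> 1" using le H10_norm_nonneg by (auto simp: l_def w_def)
    \<comment> \<open>If \<open>l = 0\<close>, division by zero makes \<open>v\<close> the zero
      vector, and \<open>w\<close> vanishes by the embedding. So \<open>w = l *\<^sub>R v\<close>
      holds in every case.\<close>
    define v where "v = (1 / l) *\<^sub>R w"
    have v: "v \<in> H10 D" unfolding v_def by (intro H10_scaleR D_open w)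
    have wv: "w = l *\<^sub>R v"
    proof (cases "l = 0")
      case True
      then have "norm w \<le> 0" using CD(1)[OF w] by (simp add: l_def)
      then show ?thesis using True by simp
    qed (simp add: v_def)
    have Nv: "N v \<le> 1"
      unfolding v_def using H10_norm_scaleR[OF D_open w, of "1 / l"] l by (simp add: l_def[symmetric])
    have Lv: "Lp_fun n (rep_L2 v)" by (rule H10_Lp[OF v])
    define h where "h x = indicator D x * (q (rep_L2 y' x) - q (rep_L2 y x) - q' (rep_L2 y x) * rep_L2 w x) * rep_L2 z x" for x
    define P where "P x = Cq'' * (2 ^ n * (\<bar>\<sigma> x\<bar> ^ n + \<bar>rep_L2 v x\<bar> ^ n))" for x
    have P_int: "integrable lborel P"
      unfolding P_def using \<sigma>(1) Lv by (simp add: Lp_fun_def)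
    have bound: "AE x in lborel. norm (h x) \<le> l\<^sup>2 * P x"
      using rep_minus_L2[of y' y] rep_scaleR_L2[of l v]
    proof eventually_elim
      case (elim x)
      have P0: "0 \<le> P x" unfolding P_def using growth_constants_nonneg by simp
      show ?case
      proof (cases "x \<in> D")
        case True
        let ?t = "rep_L2 y x" and ?r = "rep_L2 y' x" and ?v = "rep_L2 v x" and ?z = "rep_L2 z x"
        define T where "T = \<sigma> x + \<bar>?v\<bar>"
        have rt: "?r - ?t = l * ?v" "rep_L2 w x = ?r - ?t"
          using elim unfolding w_def[symmetric] wv[symmetric] by (auto simp: w_def)
        have T: "1 + \<bar>?t\<bar> + \<bar>?v\<bar> \<le> T" "\<bar>?v\<bar> \<le> T" "\<bar>?z\<bar> \<le> T" "0 \<le> T"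
          using True by (auto simp: T_def \<sigma>_def)
        have "\<bar>?r - ?t\<bar> \<le> \<bar>?v\<bar>" using l unfolding rt by (simp add: abs_mult mult_left_le_one_le)
        then have "1 + \<bar>?t\<bar> + \<bar>?r - ?t\<bar> \<le> T" using T(1) by linarith
        then have "(1 + \<bar>?t\<bar> + \<bar>?r - ?t\<bar>) ^ (n - 3) \<le> T ^ (n - 3)"
          by (intro power_mono) auto
        then have "Cq'' * (1 + \<bar>?t\<bar> + \<bar>?r - ?t\<bar>) ^ (n - 3) * (?r - ?t)\<^sup>2 \<le> Cq'' * T ^ (n - 3) * (?r - ?t)\<^sup>2"
          by (intro mult_right_mono mult_left_mono growth_constants_nonneg) auto
        with q_Taylor[of ?r ?t] have "\<bar>q ?r - q ?t - q' ?t * (?r - ?t)\<bar> \<le> Cq'' * T ^ (n - 3) * (?r - ?t)\<^sup>2"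
          by linarith
        then have "\<bar>q ?r - q ?t - q' ?t * (?r - ?t)\<bar> * \<bar>?z\<bar> \<le> Cq'' * T ^ (n - 3) * (?r - ?t)\<^sup>2 * T"
          using T growth_constants_nonneg by (intro mult_mono) auto
        also have "\<dots> = l\<^sup>2 * (Cq'' * (T ^ (n - 3) * \<bar>?v\<bar>\<^sup>2 * T))"
          unfolding rt by (simp add: power_mult_distrib mult_ac)
        also have "\<dots> \<le> l\<^sup>2 * (Cq'' * (T ^ (n - 3) * T\<^sup>2 * T))"
          using T by (intro mult_left_mono mult_right_mono power_mono growth_constants_nonneg) auto
        \<comment> \<open>The powers add up to n: n - 3 from the growth of q'', 2 from the squared
          increment and 1 from the adjoint state.\<close>
        also have "T ^ (n - 3) * T\<^sup>2 * T = T ^ n"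
        proof -
          have "n = (n - 3) + 2 + 1" using n3 by simp
          then have "T ^ n = T ^ ((n - 3) + 2 + 1)" by simp
          then show ?thesis by (simp only: power_add power_one_right)
        qed
        also have "l\<^sup>2 * (Cq'' * T ^ n) \<le> l\<^sup>2 * P x"
          unfolding P_def T_def using \<sigma>(2)[of x]
          by (intro mult_left_mono growth_constants_nonneg) (use power_add_le[of "\<sigma> x" "\<bar>?v\<bar>" n] in auto)
        finally show ?thesis using True by (simp add: h_def abs_mult rt(2))
      qed (use P0 in \<open>simp add: h_def\<close>)
    qed
    have h_int: "integrable lborel h"
    proof (rule Bochner_Integration.integrable_bound)
      show "integrable lborel (\<lambda>x. l\<^sup>2 * P x)" by (intro integrable_mult_right P_int)
      show "AE x in lborel. norm (h x) \<le> norm (l\<^sup>2 * P x)"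
        using bound by eventually_elim simp
      show "h \<in> borel_measurable lborel" unfolding h_def by measurable
    qed
    have "\<bar>\<integral>x. h x \<partial>lborel\<bar> \<le> (\<integral>x. \<bar>h x\<bar> \<partial>lborel)" by (rule integral_abs_bound)
    also have "\<dots> \<le> (\<integral>x. l\<^sup>2 * P x \<partial>lborel)"
      by (rule integral_mono_AE) (use h_int P_int bound in auto)
    also have "\<dots> = l\<^sup>2 * (Cq'' * (2 ^ n * (I + (\<integral>x. \<bar>rep_L2 v x\<bar> ^ n \<partial>lborel))))"
      unfolding P_def I_def using \<sigma>(1) Lv by (simp add: Lp_fun_def)
    also have "\<dots> \<le> l\<^sup>2 * K"
    proof -
      have "N v ^ n \<le> 1" using Nv H10_norm_nonneg by (intro power_le_one) auto
      then have "Ks * N v ^ n \<le> \<bar>Ks\<bar>"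
        using H10_norm_nonneg[of D v] by (smt (verit) mult_left_le zero_le_power mult_nonneg_nonneg mult_nonpos_nonneg abs_ge_self)
      then have "(\<integral>x. \<bar>rep_L2 v x\<bar> ^ n \<partial>lborel) \<le> \<bar>Ks\<bar>" using Sobolev_bound[OF v] by linarith
      then show ?thesis unfolding K_def by (intro mult_left_mono growth_constants_nonneg add_left_mono) auto
    qed
    finally show "\<bar>\<integral>x. indicator D x * (q (rep_L2 y' x) - q (rep_L2 y x) - q' (rep_L2 y x) * rep_L2 (y' - y) x) * rep_L2 z x \<partial>lborel\<bar>
      \<le> K * (N (y' - y))\<^sup>2"
      by (simp add: h_def w_def l_def mult.commute)
  qed
qed

text \<open>The adjoint state \<open>z\<close> lets one expand the objective to second order directly, without
  differentiating the solution operator.\<close>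

lemma objective_expansion:
  assumes u: "u \<in> L2_on D"
  obtains z K \<delta> where "z \<in> H10 D" "N z \<le> CD / \<kappa> * norm (S u - yd)" "\<delta> > 0"
    "\<And>u'. u' \<in> L2_on D \<Longrightarrow> norm (u' - u) \<le> \<delta> \<Longrightarrow>
      \<bar>(norm (S u' - yd))\<^sup>2 / 2 - (norm (S u - yd))\<^sup>2 / 2 - gm z \<bullet> (u' - u)\<bar> \<le> K * (norm (u' - u))\<^sup>2"
proof -
  let ?y = "S u" and ?f = "S u - yd"
  note y = S_H10[OF u]
  obtain z where z: "z \<in> H10 D" "N z \<le> CD / \<kappa> * norm ?f"
    "\<And>v. v \<in> H10 D \<Longrightarrow> integrable lborel (\<lambda>x. indicator D x * (q' (rep_L2 ?y x) * rep_L2 z x) * rep_L2 v x)"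
    "\<And>v. v \<in> H10 D \<Longrightarrow> A z v + (\<integral>x. indicator D x * (q' (rep_L2 ?y x) * rep_L2 z x) * rep_L2 v x \<partial>lborel) = ?f \<bullet> v"
    by (rule adjoint_exists[OF y, of ?f]) (rule that)
  obtain K where K: "K \<ge> 0" "\<And>y'. y' \<in> H10 D \<Longrightarrow> N (y' - ?y) \<le> 1 \<Longrightarrow>
    \<bar>\<integral>x. indicator D x * (q (rep_L2 y' x) - q (rep_L2 ?y x) - q' (rep_L2 ?y x) * rep_L2 (y' - ?y) x) * rep_L2 z x \<partial>lborel\<bar>
      \<le> K * (N (y' - ?y))\<^sup>2"
    by (rule remainder_integral_bound[OF y z(1)]) (rule that)
  define c where "c = s * CD / \<kappa>"
  have c: "0 \<le> c" using s CD(2) \<kappa> by (simp add: c_def)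
  show ?thesis
  \<comment> \<open>The radius ensures that the states differ by at most 1, as the remainder bound
    requires. In the constant, \<open>K\<close> stems from the Taylor remainder,
    \<open>CD\<^sup>2 / 2\<close> from the quadratic part of the objective, and
    \<open>c\<^sup>2\<close> from the Lipschitz estimate of the states.\<close>
  proof (rule that[OF z(1,2), of "1 / (c + 1)" "(K + CD\<^sup>2 / 2) * c\<^sup>2"])
    show "1 / (c + 1) > 0" using c by simp
    fix u' assume u': "u' \<in> L2_on D" and le: "norm (u' - u) \<le> 1 / (c + 1)"
    let ?y' = "S u'"
    define w where "w = ?y' - ?y"
    note y' = S_H10[OF u']
    have w: "w \<in> H10 D" unfolding w_def by (intro H10_diff D_open y y')
    have Nw: "N w \<le> c * norm (u' - u)"
      unfolding w_def c_def by (rule solution_Lipschitz[OF solves_S[OF u] solves_S[OF u'] u u'])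
    also have "\<dots> \<le> c * (1 / (c + 1))" using le c by (intro mult_left_mono) auto
    also have "\<dots> \<le> 1" using c by simp
    finally have Nw1: "N w \<le> 1" .
    define R where "R = (\<integral>x. indicator D x * (q (rep_L2 ?y' x) - q (rep_L2 ?y x) - q' (rep_L2 ?y x) * rep_L2 w x) * rep_L2 z x \<partial>lborel)"
    have R: "\<bar>R\<bar> \<le> K * (N w)\<^sup>2"
      using K(2)[OF y'] Nw1 by (simp add: R_def w_def)
    have "(\<integral>x. indicator D x * (q (rep_L2 ?y' x) - q (rep_L2 ?y x)) * rep_L2 z x \<partial>lborel)
        - (\<integral>x. indicator D x * (q' (rep_L2 ?y x) * rep_L2 z x) * rep_L2 w x \<partial>lborel)
      = (\<integral>x. indicator D x * (q (rep_L2 ?y' x) - q (rep_L2 ?y x)) * rep_L2 z x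
          - indicator D x * (q' (rep_L2 ?y x) * rep_L2 z x) * rep_L2 w x \<partial>lborel)"
    proof (rule Bochner_Integration.integral_diff[symmetric])
      have "integrable lborel (\<lambda>x. indicator D x * q (rep_L2 ?y' x) * rep_L2 z x - indicator D x * q (rep_L2 ?y x) * rep_L2 z x)"
        by (intro Bochner_Integration.integrable_diff state.a_integrable y y' z)
      then show "integrable lborel (\<lambda>x. indicator D x * (q (rep_L2 ?y' x) - q (rep_L2 ?y x)) * rep_L2 z x)"
        by (simp add: algebra_simps)
    qed (rule z(3)[OF w])
    also have "\<dots> = R"
      unfolding R_def by (rule Bochner_Integration.integral_cong) (simp_all add: algebra_simps)
    \<comment> \<open>The two terms with \<open>A\<close> cancel by symmetry, so that only the
      Taylor remainder is left.\<close>
    finally have "?f \<bullet> w - gm z \<bullet> (u' - u) = - R"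
      using z(4)[OF w] solution_difference[OF solves_S[OF u] solves_S[OF u'] u u' z(1)] A_sym[OF w z(1)]
      by (simp add: w_def[symmetric])
    moreover have "(norm (?y' - yd))\<^sup>2 / 2 - (norm ?f)\<^sup>2 / 2 = ?f \<bullet> w + (norm w)\<^sup>2 / 2"
      unfolding w_def power2_norm_eq_inner by (simp add: inner_simps inner_commute field_simps)
    moreover have "\<bar>a - c - g\<bar> \<le> \<bar>r\<bar> + e" if "f - g = - r" "a - c = f + e" "0 \<le> e" for a c e f g r :: real
      using that by linarith
    ultimately have "\<bar>(norm (?y' - yd))\<^sup>2 / 2 - (norm ?f)\<^sup>2 / 2 - gm z \<bullet> (u' - u)\<bar> \<le> \<bar>R\<bar> + (norm w)\<^sup>2 / 2"
      by simp
    also have "\<dots> \<le> K * (N w)\<^sup>2 + (CD * N w)\<^sup>2 / 2"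
      using R CD(1)[OF w] by (intro add_mono divide_right_mono power_mono) auto
    also have "\<dots> = (K + CD\<^sup>2 / 2) * (N w)\<^sup>2"
      by (simp add: power_mult_distrib algebra_simps)
    also have "\<dots> \<le> (K + CD\<^sup>2 / 2) * (c * norm (u' - u))\<^sup>2"
      using Nw K(1) H10_norm_nonneg by (intro mult_left_mono power_mono) auto
    finally show "\<bar>(norm (?y' - yd))\<^sup>2 / 2 - (norm ?f)\<^sup>2 / 2 - gm z \<bullet> (u' - u)\<bar> \<le> (K + CD\<^sup>2 / 2) * c\<^sup>2 * (norm (u' - u))\<^sup>2"
      by (simp add: power_mult_distrib mult.assoc)
  qed
qed

end

section \<open>Products with Lipschitz functions\<close>

lemma sq_int_translate:
  assumes "sq_int (f :: 'a::euclidean_space \<Rightarrow> real)"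
  shows "sq_int (\<lambda>x. f (c + x))"
proof -
  have [measurable]: "f \<in> borel_measurable borel" using assms by (simp add: sq_int_def)
  have "integrable lborel (\<lambda>x. (norm (f (c + x)))\<^sup>2)"
    using assms by (intro lborel_integrable_translate[of "\<lambda>x. (norm (f x))\<^sup>2"]) (simp add: sq_int_def)
  then show ?thesis by (simp add: sq_int_def)
qed

lemma sq_int_abs: "sq_int f \<Longrightarrow> sq_int (\<lambda>x. \<bar>f x\<bar>)" for f :: "'a::euclidean_space \<Rightarrow> real"
  by (rule sq_int_bound[where C = 1]) (auto simp: sq_int_def intro: borel_measurable_abs)

text \<open>Working with difference quotients avoids the almost everywhere derivative of the Lipschitz
  function \<open>g\<close>.\<close>

lemma product_difference_bound:
  fixes D :: "'a::euclidean_space set"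
  assumes D: "open D" and gL: "L-lipschitz_on D g" and gb: "\<And>x. x \<in> D \<Longrightarrow> \<bar>g x\<bar> \<le> s" and s: "s \<ge> 0"
    and p: "\<phi> \<in> test_functions D" and q: "\<psi> \<in> test_functions D" and e: "norm e = 1"
  shows "\<bar>\<integral>x. indicator D x * g x * \<phi> x * frechet_derivative \<psi> (at x) e \<partial>lborel\<bar>
    \<le> s * (\<integral>x. \<bar>\<psi> x\<bar> * \<bar>frechet_derivative \<phi> (at x) e\<bar> \<partial>lborel) + L * (\<integral>x. \<bar>\<psi> x\<bar> * \<bar>\<phi> x\<bar> \<partial>lborel)"
proof -
  define G where "G x = indicator D x * g x" for x
  define f where "f x = G x * \<phi> x" for x
  have gc: "continuous_on D g" by (rule lipschitz_on_continuous_on[OF gL])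
  have [measurable]: "G \<in> borel_measurable borel"
    unfolding G_def by (rule mult_on_measurable[OF D gc gb])
  note [measurable] = test_functions_measurable[OF p] test_functions_measurable[OF q]
    test_functions_measurable[OF test_functions_deriv[OF p]]
  have L: "L \<ge> 0" using gL by (simp add: lipschitz_on_nonneg)
  have Gs: "\<bar>G x\<bar> \<le> s" for x using gb s by (simp add: G_def indicator_def)
  note sp = test_functions_sq_int[OF p] and sq = test_functions_sq_int[OF q]
  have f_meas [measurable]: "f \<in> borel_measurable borel" unfolding f_def by measurable
  have sf: "sq_int f"
    by (rule sq_int_bound[OF sp f_meas, where C = s]) (auto simp: f_def abs_mult intro!: mult_right_mono Gs)
  obtain K where K: "compact K" "K \<subseteq> D" "\<And>x. x \<notin> K \<Longrightarrow> \<phi> x = 0" using test_functionsE[OF p] by metis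
  \<comment> \<open>Shifts shorter than \<epsilon> keep the support of \<phi> inside
    \<open>D\<close>, where the Lipschitz estimate for \<open>g\<close> is available; hence the
    bound on \<open>h n\<close>.\<close>
  obtain \<epsilon> where \<epsilon>: "\<epsilon> > 0" "(\<Union>x\<in>K. ball x \<epsilon>) \<subseteq> D"
    using compact_subset_open_imp_ball_epsilon_subset[OF K(1) D K(2)] by blast
  define h where "h n = min 1 (\<epsilon> / 2) * (1 / real (Suc n))" for n
  have h: "0 < h n" "h n \<le> 1" "h n < \<epsilon>" for n
  proof -
    have m: "0 < min 1 (\<epsilon> / 2)" using \<epsilon>(1) by simp
    then show "0 < h n" by (simp add: h_def)
    have "h n \<le> min 1 (\<epsilon> / 2) * 1" unfolding h_def using m by (intro mult_left_mono) auto
    then show "h n \<le> 1" "h n < \<epsilon>" using \<epsilon>(1) by auto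
  qed
  have h0: "h \<longlonglongrightarrow> 0"
    unfolding h_def using tendsto_mult_left[OF LIMSEQ_Suc[OF lim_1_over_n], of "min 1 (\<epsilon> / 2)"] by simp
  have lim1: "(\<lambda>n. \<integral>x. f x * ((\<psi> (h n *\<^sub>R e + x) - \<psi> x) / h n) \<partial>lborel)
     \<longlonglongrightarrow> (\<integral>x. f x * frechet_derivative \<psi> (at x) e \<partial>lborel)"
  proof (rule difference_quotient_integral[OF q h0])
    show "h n \<noteq> 0" "\<bar>h n\<bar> \<le> 1" for n using h[of n] by auto
    show "integrable lborel (\<lambda>x. f x * indicator (cball 0 R) x)" for R
      using sq_int_inner[OF sf sq_int_indicator[of "cball 0 R"]] emeasure_lborel_cball_finite[of "0::'a" R] by simp
  qed measurable
  have lim2: "(\<lambda>n. \<integral>x. \<bar>\<psi> x\<bar> * \<bar>(\<phi> ((- h n) *\<^sub>R e + x) - \<phi> x) / (- h n)\<bar> \<partial>lborel)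
     \<longlonglongrightarrow> (\<integral>x. \<bar>\<psi> x\<bar> * \<bar>frechet_derivative \<phi> (at x) e\<bar> \<partial>lborel)"
    and int2: "integrable lborel (\<lambda>x. \<bar>\<psi> x\<bar> * \<bar>(\<phi> ((- h n) *\<^sub>R e + x) - \<phi> x) / (- h n)\<bar>)" for n
  proof -
    obtain M R where M: "M \<ge> 0"
      "\<And>x h. \<bar>h\<bar> \<le> 1 \<Longrightarrow> h \<noteq> 0 \<Longrightarrow> \<bar>(\<phi> (h *\<^sub>R e + x) - \<phi> x) / h\<bar> \<le> M * indicator (cball 0 R) x"
      using difference_quotient_bound[OF p] by metis
    have i: "integrable lborel (\<lambda>x. M * \<bar>\<psi> x\<bar>)"
      using test_functions_integrable[OF q] by simp
    have b: "\<bar>\<psi> x\<bar> * \<bar>(\<phi> ((- h n) *\<^sub>R e + x) - \<phi> x) / (- h n)\<bar> \<le> M * \<bar>\<psi> x\<bar>" for n x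
    proof -
      have "\<bar>(\<phi> ((- h n) *\<^sub>R e + x) - \<phi> x) / (- h n)\<bar> \<le> M * indicator (cball 0 R) x"
        using h[of n] by (intro M(2)) auto
      also have "\<dots> \<le> M" using M(1) by (simp add: indicator_def)
      finally show ?thesis
        unfolding mult.commute[of M] by (rule mult_left_mono) simp
    qed
    show "(\<lambda>n. \<integral>x. \<bar>\<psi> x\<bar> * \<bar>(\<phi> ((- h n) *\<^sub>R e + x) - \<phi> x) / (- h n)\<bar> \<partial>lborel)
     \<longlonglongrightarrow> (\<integral>x. \<bar>\<psi> x\<bar> * \<bar>frechet_derivative \<phi> (at x) e\<bar> \<partial>lborel)"
    proof (rule integral_dominated_convergence[OF _ _ i])
      have mh: "(\<lambda>n. - h n) \<longlonglongrightarrow> 0" using tendsto_minus[OF h0] by simp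
      have "(\<lambda>n. (\<phi> ((- h n) *\<^sub>R e + x) - \<phi> x) / (- h n)) \<longlonglongrightarrow> frechet_derivative \<phi> (at x) e" for x
        by (rule difference_quotient_tendsto[OF test_functionsD(2)[OF p] mh]) (use h in \<open>simp add: less_imp_neq[symmetric]\<close>)
      then show "AE x in lborel. (\<lambda>n. \<bar>\<psi> x\<bar> * \<bar>(\<phi> ((- h n) *\<^sub>R e + x) - \<phi> x) / (- h n)\<bar>) \<longlonglongrightarrow> \<bar>\<psi> x\<bar> * \<bar>frechet_derivative \<phi> (at x) e\<bar>"
        by (intro AE_I2 tendsto_mult tendsto_const tendsto_rabs)
      show "AE x in lborel. norm (\<bar>\<psi> x\<bar> * \<bar>(\<phi> ((- h n) *\<^sub>R e + x) - \<phi> x) / (- h n)\<bar>) \<le> M * \<bar>\<psi> x\<bar>" for n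
        using b[of _ n] by (intro AE_I2) simp
    qed measurable
    show "integrable lborel (\<lambda>x. \<bar>\<psi> x\<bar> * \<bar>(\<phi> ((- h n) *\<^sub>R e + x) - \<phi> x) / (- h n)\<bar>)"
    proof (rule Bochner_Integration.integrable_bound[OF i])
      show "AE x in lborel. norm (\<bar>\<psi> x\<bar> * \<bar>(\<phi> ((- h n) *\<^sub>R e + x) - \<phi> x) / (- h n)\<bar>) \<le> norm (M * \<bar>\<psi> x\<bar>)"
        using b[of _ n] M(1) by (intro AE_I2) (simp add: abs_mult)
    qed measurable
  qed
  have int3: "integrable lborel (\<lambda>x. \<bar>\<psi> x\<bar> * \<bar>\<phi> x\<bar>)"
    using sq_int_inner[OF sq_int_abs[OF sq] sq_int_abs[OF sp]] by simp
  have le: "\<bar>\<integral>x. f x * ((\<psi> (h n *\<^sub>R e + x) - \<psi> x) / h n) \<partial>lborel\<bar>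
     \<le> s * (\<integral>x. \<bar>\<psi> x\<bar> * \<bar>(\<phi> ((- h n) *\<^sub>R e + x) - \<phi> x) / (- h n)\<bar> \<partial>lborel) + L * (\<integral>x. \<bar>\<psi> x\<bar> * \<bar>\<phi> x\<bar> \<partial>lborel)" for n
  proof -
    let ?c = "h n *\<^sub>R e"
    have i1: "integrable lborel (\<lambda>x. f x * \<psi> (?c + x))" and i2: "integrable lborel (\<lambda>x. f x * \<psi> x)"
      and i3: "integrable lborel (\<lambda>x. f (- ?c + x) * \<psi> x)"
      using sq_int_inner[OF sf sq_int_translate[OF sq, of ?c]] sq_int_inner[OF sf sq]
        sq_int_inner[OF sq_int_translate[OF sf, of "- ?c"] sq] by simp_all
    have "(\<integral>x. f x * ((\<psi> (?c + x) - \<psi> x) / h n) \<partial>lborel)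
      = ((\<integral>x. f x * \<psi> (?c + x) \<partial>lborel) - (\<integral>x. f x * \<psi> x \<partial>lborel)) / h n"
      using i1 i2 by (simp add: right_diff_distrib diff_divide_distrib)
    \<comment> \<open>Translation invariance moves the difference quotient from \<psi> to the
      product \<open>f\<close>, a discrete integration by parts.\<close>
    also have "(\<integral>x. f x * \<psi> (?c + x) \<partial>lborel) = (\<integral>x. f (- ?c + x) * \<psi> x \<partial>lborel)"
      using lborel_integral_translate[of "\<lambda>x. f (- ?c + x) * \<psi> x" ?c] by simp
    also have "((\<integral>x. f (- ?c + x) * \<psi> x \<partial>lborel) - (\<integral>x. f x * \<psi> x \<partial>lborel)) / h n
       = (\<integral>x. (f (- ?c + x) - f x) / h n * \<psi> x \<partial>lborel)"
      using i2 i3 by (simp add: left_diff_distrib diff_divide_distrib)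
    also have "\<bar>\<dots>\<bar> \<le> (\<integral>x. \<bar>(f (- ?c + x) - f x) / h n * \<psi> x\<bar> \<partial>lborel)"
      by (rule integral_abs_bound)
    also have "\<dots> \<le> (\<integral>x. s * (\<bar>\<psi> x\<bar> * \<bar>(\<phi> ((- h n) *\<^sub>R e + x) - \<phi> x) / (- h n)\<bar>) + L * (\<bar>\<psi> x\<bar> * \<bar>\<phi> x\<bar>) \<partial>lborel)"
    proof (rule integral_mono)
      have "integrable lborel (\<lambda>x. (f (- ?c + x) - f x) / h n * \<psi> x)"
        using i2 i3 by (simp add: left_diff_distrib diff_divide_distrib)
      then show "integrable lborel (\<lambda>x. \<bar>(f (- ?c + x) - f x) / h n * \<psi> x\<bar>)" by (rule integrable_abs)
      show "integrable lborel (\<lambda>x. s * (\<bar>\<psi> x\<bar> * \<bar>(\<phi> ((- h n) *\<^sub>R e + x) - \<phi> x) / (- h n)\<bar>) + L * (\<bar>\<psi> x\<bar> * \<bar>\<phi> x\<bar>))"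
        by (intro Bochner_Integration.integrable_add integrable_mult_right int2 int3)
      fix x
      let ?x = "- ?c + x"
      have "\<bar>f ?x - f x\<bar> \<le> s * \<bar>\<phi> ?x - \<phi> x\<bar> + L * h n * \<bar>\<phi> x\<bar>"
      proof -
        \<comment> \<open>A discrete product rule. The increment of \<open>G\<close> is multiplied
          by \<phi> at the unshifted point, so it matters only for \<open>x\<close> in the support,
          where both points lie in \<open>D\<close>.\<close>
        have "f ?x - f x = G ?x * (\<phi> ?x - \<phi> x) + \<phi> x * (G ?x - G x)"
          by (simp add: f_def algebra_simps)
        also have "\<bar>\<dots>\<bar> \<le> \<bar>G ?x\<bar> * \<bar>\<phi> ?x - \<phi> x\<bar> + \<bar>\<phi> x\<bar> * \<bar>G ?x - G x\<bar>"
          by (metis abs_mult abs_triangle_ineq)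
        also have "\<dots> \<le> s * \<bar>\<phi> ?x - \<phi> x\<bar> + \<bar>\<phi> x\<bar> * (L * h n)"
        proof (intro add_mono mult_right_mono Gs)
          show "\<bar>\<phi> x\<bar> * \<bar>G ?x - G x\<bar> \<le> \<bar>\<phi> x\<bar> * (L * h n)"
          proof (cases "x \<in> K")
            case True
            have d: "dist ?x x = h n" using e h(1)[of n] by (simp add: dist_norm)
            then have xb: "?x \<in> ball x \<epsilon>" unfolding mem_ball using h(3)[of n] by (subst dist_commute) simp
            have "?x \<in> D" by (rule subsetD[OF \<epsilon>(2)]) (use True xb in blast)
            moreover have "x \<in> D" using True K(2) by blast
            ultimately have "\<bar>G ?x - G x\<bar> \<le> L * h n"
              using lipschitz_onD[OF gL, of ?x x] d by (simp add: G_def dist_real_def)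
            then show ?thesis by (intro mult_left_mono) auto
          qed (simp add: K(3))
        qed auto
        finally show ?thesis by (simp add: mult_ac)
      qed
      then have "\<bar>f ?x - f x\<bar> / h n \<le> (s * \<bar>\<phi> ?x - \<phi> x\<bar> + L * h n * \<bar>\<phi> x\<bar>) / h n"
        using h(1)[of n] by (intro divide_right_mono) auto
      also have "\<dots> = s * (\<bar>\<phi> ?x - \<phi> x\<bar> / h n) + L * \<bar>\<phi> x\<bar>"
        using h(1)[of n] by (simp add: add_divide_distrib)
      finally have "\<bar>f ?x - f x\<bar> / h n * \<bar>\<psi> x\<bar> \<le> (s * (\<bar>\<phi> ?x - \<phi> x\<bar> / h n) + L * \<bar>\<phi> x\<bar>) * \<bar>\<psi> x\<bar>"
        by (rule mult_right_mono) simp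
      then show "\<bar>(f ?x - f x) / h n * \<psi> x\<bar>
         \<le> s * (\<bar>\<psi> x\<bar> * \<bar>(\<phi> ((- h n) *\<^sub>R e + x) - \<phi> x) / (- h n)\<bar>) + L * (\<bar>\<psi> x\<bar> * \<bar>\<phi> x\<bar>)"
      proof -
        assume *: "\<bar>f ?x - f x\<bar> / h n * \<bar>\<psi> x\<bar> \<le> (s * (\<bar>\<phi> ?x - \<phi> x\<bar> / h n) + L * \<bar>\<phi> x\<bar>) * \<bar>\<psi> x\<bar>"
        have "\<bar>(f ?x - f x) / h n * \<psi> x\<bar> = \<bar>f ?x - f x\<bar> / h n * \<bar>\<psi> x\<bar>"
          unfolding abs_mult abs_divide using h(1)[of n] by simp
        moreover have "\<bar>(\<phi> ((- h n) *\<^sub>R e + x) - \<phi> x) / (- h n)\<bar> = \<bar>\<phi> ?x - \<phi> x\<bar> / h n"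
          unfolding abs_divide using h(1)[of n] by simp
        ultimately show ?thesis
          using * by (simp only: distrib_right distrib_left mult_ac)
      qed
    qed
    also have "\<dots> = s * (\<integral>x. \<bar>\<psi> x\<bar> * \<bar>(\<phi> ((- h n) *\<^sub>R e + x) - \<phi> x) / (- h n)\<bar> \<partial>lborel) + L * (\<integral>x. \<bar>\<psi> x\<bar> * \<bar>\<phi> x\<bar> \<partial>lborel)"
      using int2[of n] int3 by (subst Bochner_Integration.integral_add) (auto simp del: abs_divide times_divide_eq_right)
    finally show ?thesis .
  qed
  have "\<bar>\<integral>x. f x * frechet_derivative \<psi> (at x) e \<partial>lborel\<bar>
    \<le> s * (\<integral>x. \<bar>\<psi> x\<bar> * \<bar>frechet_derivative \<phi> (at x) e\<bar> \<partial>lborel) + L * (\<integral>x. \<bar>\<psi> x\<bar> * \<bar>\<phi> x\<bar> \<partial>lborel)"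
    by (rule LIMSEQ_le[OF tendsto_rabs[OF lim1] tendsto_add[OF tendsto_mult_left[OF lim2] tendsto_const]])
       (use le in blast)
  then show ?thesis by (simp add: f_def G_def)
qed

text \<open>Vector fields are used as test objects instead of single components, so that the Riesz
  bound controls the norm of the whole gradient at once.\<close>

definition test_fields :: "'a::euclidean_space set \<Rightarrow> ('a \<Rightarrow> 'a) set" where
  "test_fields D = {\<Psi>. \<forall>i\<in>Basis. (\<lambda>x. \<Psi> x \<bullet> i) \<in> test_functions D}"

definition div_field :: "('a::euclidean_space \<Rightarrow> 'a) \<Rightarrow> 'a \<Rightarrow> real" where
  "div_field \<Psi> x = (\<Sum>i\<in>Basis. frechet_derivative (\<lambda>x. \<Psi> x \<bullet> i) (at x) i)"

lemma test_fields_component: "\<Psi> \<in> test_fields D \<Longrightarrow> i \<in> Basis \<Longrightarrow> (\<lambda>x. \<Psi> x \<bullet> i) \<in> test_functions D"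
  by (simp add: test_fields_def)

lemma test_fields_sq_int:
  assumes "\<Psi> \<in> test_fields D"
  shows "sq_int \<Psi>"
proof -
  have "sq_int (\<lambda>x. \<Sum>i\<in>Basis. (\<Psi> x \<bullet> i) *\<^sub>R i)"
    by (intro sq_int_sum sq_int_times_vector test_functions_sq_int[OF test_fields_component[OF assms]])
  then show ?thesis by (simp add: euclidean_representation)
qed

lemma test_fields_in_L2_on:
  assumes "\<Psi> \<in> test_fields D"
  shows "abs_L2 \<Psi> \<in> L2_on D"
  using test_functions_zero_outside(1)[OF test_fields_component[OF assms]]
  by (intro abs_in_L2_on test_fields_sq_int[OF assms]) (auto simp: euclidean_eq_iff[where 'a = 'a])

lemma div_field_sq_int: "\<Psi> \<in> test_fields D \<Longrightarrow> sq_int (div_field \<Psi>)"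
  unfolding div_field_def[abs_def]
  by (intro sq_int_sum test_functions_sq_int[OF test_functions_deriv] test_fields_component)

lemma test_fields_add:
  assumes "\<Psi> \<in> test_fields D" "\<Theta> \<in> test_fields D"
  shows "(\<lambda>x. \<Psi> x + \<Theta> x) \<in> test_fields D" "div_field (\<lambda>x. \<Psi> x + \<Theta> x) = (\<lambda>x. div_field \<Psi> x + div_field \<Theta> x)"
proof -
  show "(\<lambda>x. \<Psi> x + \<Theta> x) \<in> test_fields D"
    using assms by (simp add: test_fields_def inner_add_left test_functions_add)
  have "frechet_derivative (\<lambda>x. (\<Psi> x + \<Theta> x) \<bullet> i) (at x)
      = (\<lambda>h. frechet_derivative (\<lambda>x. \<Psi> x \<bullet> i) (at x) h + frechet_derivative (\<lambda>x. \<Theta> x \<bullet> i) (at x) h)"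
    if "i \<in> Basis" for i x
    unfolding inner_add_left
    by (rule frechet_derivative_at[symmetric])
       (intro has_derivative_add test_functionsD(2)[OF test_fields_component[OF assms(1) that]]
          test_functionsD(2)[OF test_fields_component[OF assms(2) that]])
  then show "div_field (\<lambda>x. \<Psi> x + \<Theta> x) = (\<lambda>x. div_field \<Psi> x + div_field \<Theta> x)"
    by (simp add: div_field_def fun_eq_iff sum.distrib)
qed

lemma test_fields_scale:
  assumes "\<Psi> \<in> test_fields D"
  shows "(\<lambda>x. c *\<^sub>R \<Psi> x) \<in> test_fields D" "div_field (\<lambda>x. c *\<^sub>R \<Psi> x) = (\<lambda>x. c *\<^sub>R div_field \<Psi> x)"
proof -
  show "(\<lambda>x. c *\<^sub>R \<Psi> x) \<in> test_fields D"
    using assms by (simp add: test_fields_def test_functions_scale)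
  have "frechet_derivative (\<lambda>x. (c *\<^sub>R \<Psi> x) \<bullet> i) (at x)
      = (\<lambda>h. c * frechet_derivative (\<lambda>x. \<Psi> x \<bullet> i) (at x) h)"
    if "i \<in> Basis" for i x
    unfolding inner_scaleR_left
    by (rule frechet_derivative_at[symmetric])
       (intro has_derivative_mult_right test_functionsD(2)[OF test_fields_component[OF assms(1) that]])
  then show "div_field (\<lambda>x. c *\<^sub>R \<Psi> x) = (\<lambda>x. c *\<^sub>R div_field \<Psi> x)"
    by (simp add: div_field_def fun_eq_iff sum_distrib_left)
qed

lemma test_fields_single:
  assumes "\<phi> \<in> test_functions D" "i \<in> Basis"
  shows "(\<lambda>x. \<phi> x *\<^sub>R i) \<in> test_fields D" "div_field (\<lambda>x. \<phi> x *\<^sub>R i) = (\<lambda>x. frechet_derivative \<phi> (at x) i)"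
proof -
  have z: "(\<lambda>_. 0) \<in> test_functions D" using test_functions_scale[OF assms(1), of 0] by simp
  have e: "(\<lambda>x. (\<phi> x *\<^sub>R i) \<bullet> j) = (if j = i then \<phi> else (\<lambda>_. 0))" if "j \<in> Basis" for j
    using assms(2) that by (auto simp: inner_Basis)
  show "(\<lambda>x. \<phi> x *\<^sub>R i) \<in> test_fields D"
    using assms(1) z by (auto simp: test_fields_def e simp del: inner_scaleR_left)
  have "div_field (\<lambda>x. \<phi> x *\<^sub>R i) x = (\<Sum>j\<in>Basis. if j = i then frechet_derivative \<phi> (at x) i else 0)" for x
    unfolding div_field_def
    by (intro sum.cong refl) (auto simp: e simp del: inner_scaleR_left)
  then show "div_field (\<lambda>x. \<phi> x *\<^sub>R i) = (\<lambda>x. frechet_derivative \<phi> (at x) i)"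
    using assms(2) by (auto simp: fun_eq_iff)
qed

lemma norm_eq_L2_set: "norm x = L2_set (\<lambda>i. x \<bullet> i) Basis" for x :: "'a::euclidean_space"
  unfolding L2_set_def norm_eq_sqrt_inner by (subst euclidean_inner) (simp add: power2_eq_square)

text \<open>The factor 2 bounds the square root of the dimension, which is lost because \<open>g\<close> is only differenced
  along the coordinate axes.\<close>

lemma product_field_bound_test:
  fixes D :: "'a::euclidean_space set"
  assumes D: "open D" and dim: "DIM('a) \<le> 4" and gL: "L-lipschitz_on D g" and gb: "\<And>x. x \<in> D \<Longrightarrow> \<bar>g x\<bar> \<le> s" and s: "s \<ge> 0"
    and p: "\<phi> \<in> test_functions D" and q: "\<Psi> \<in> test_fields D"
  shows "\<bar>mult_on D g (abs_L2 \<phi>) \<bullet> abs_L2 (div_field \<Psi>)\<bar>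
    \<le> (s * norm (abs_L2 (grad \<phi>)) + 2 * L * norm (abs_L2 \<phi>)) * norm (abs_L2 \<Psi>)"
proof -
  have gc: "continuous_on D g" by (rule lipschitz_on_continuous_on[OF gL])
  have L: "L \<ge> 0" using gL by (simp add: lipschitz_on_nonneg)
  have [measurable]: "(\<lambda>x. indicator D x * g x) \<in> borel_measurable borel"
    by (rule mult_on_measurable[OF D gc gb])
  note [measurable] = test_functions_measurable[OF p]
  have sp: "sq_int \<phi>" by (rule test_functions_sq_int[OF p])
  have sf: "sq_int (\<lambda>x. indicator D x * g x * \<phi> x)"
  proof (rule sq_int_bound[OF sp, where C = "\<bar>s\<bar>"])
    show "norm (indicator D x * g x * \<phi> x) \<le> \<bar>s\<bar> * norm (\<phi> x)" for x
      using mult_on_bound[OF D gc gb, of x "\<phi> x"] by simp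
  qed measurable
  have m: "mult_on D g (abs_L2 \<phi>) = abs_L2 (\<lambda>x. indicator D x * g x * \<phi> x)"
    unfolding mult_on_def
  proof (subst abs_L2_eq_iff[OF mult_on_sq_int[OF D gc gb] sf])
    show "AE x in lborel. indicator D x * g x * rep_L2 (abs_L2 \<phi>) x = indicator D x * g x * \<phi> x"
      using rep_abs_L2[OF sp] by eventually_elim simp
  qed
  have sqi: "sq_int (\<lambda>x. frechet_derivative (\<lambda>x. \<Psi> x \<bullet> i) (at x) i)" if "i \<in> Basis" for i
    by (rule test_functions_sq_int[OF test_functions_deriv[OF test_fields_component[OF q that]]])
  have "mult_on D g (abs_L2 \<phi>) \<bullet> abs_L2 (div_field \<Psi>)
    = (\<integral>x. (\<Sum>i\<in>Basis. indicator D x * g x * \<phi> x * frechet_derivative (\<lambda>x. \<Psi> x \<bullet> i) (at x) i) \<partial>lborel)"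
    unfolding m inner_abs_L2[OF sf div_field_sq_int[OF q]] by (simp add: div_field_def sum_distrib_left)
  also have "\<dots> = (\<Sum>i\<in>Basis. \<integral>x. indicator D x * g x * \<phi> x * frechet_derivative (\<lambda>x. \<Psi> x \<bullet> i) (at x) i \<partial>lborel)"
    using sq_int_inner[OF sf sqi] by (intro Bochner_Integration.integral_sum) simp
  also have "\<bar>\<dots>\<bar> \<le> (\<Sum>i\<in>Basis. \<bar>\<integral>x. indicator D x * g x * \<phi> x * frechet_derivative (\<lambda>x. \<Psi> x \<bullet> i) (at x) i \<partial>lborel\<bar>)"
    by (rule sum_abs)
  also have "\<dots> \<le> (\<Sum>i\<in>Basis. s * (\<integral>x. \<bar>\<Psi> x \<bullet> i\<bar> * \<bar>frechet_derivative \<phi> (at x) i\<bar> \<partial>lborel) + L * (\<integral>x. \<bar>\<Psi> x \<bullet> i\<bar> * \<bar>\<phi> x\<bar> \<partial>lborel))"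
    by (intro sum_mono product_difference_bound[OF D gL gb s p] test_fields_component[OF q]) auto
  also have "\<dots> = s * (\<integral>x. (\<Sum>i\<in>Basis. \<bar>\<Psi> x \<bullet> i\<bar> * \<bar>grad \<phi> x \<bullet> i\<bar>) \<partial>lborel) + L * (\<integral>x. (\<Sum>i\<in>Basis. \<bar>\<Psi> x \<bullet> i\<bar> * \<bar>\<phi> x\<bar>) \<partial>lborel)"
  proof -
    have "integrable lborel (\<lambda>x. \<bar>\<Psi> x \<bullet> i\<bar> * \<bar>grad \<phi> x \<bullet> i\<bar>)" "integrable lborel (\<lambda>x. \<bar>\<Psi> x \<bullet> i\<bar> * \<bar>\<phi> x\<bar>)" if i: "i \<in> Basis" for i
      using sq_int_inner[OF sq_int_abs[OF test_functions_sq_int[OF test_fields_component[OF q i]]] sq_int_abs[OF test_functions_sq_int[OF test_functions_deriv[OF p, of i]]]]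
       sq_int_inner[OF sq_int_abs[OF test_functions_sq_int[OF test_fields_component[OF q i]]] sq_int_abs[OF sp]]
      by (simp_all add: grad_inner_Basis[OF i])
    then show ?thesis
      by (simp add: Bochner_Integration.integral_sum sum.distrib sum_distrib_left grad_inner_Basis)
  qed
  also have "\<dots> \<le> s * (norm (abs_L2 (grad \<phi>)) * norm (abs_L2 \<Psi>)) + L * (2 * norm (abs_L2 \<phi>) * norm (abs_L2 \<Psi>))"
  proof -
    define P where "P x = norm (\<Psi> x)" for x
    define R where "R x = norm (grad \<phi> x)" for x
    define T where "T x = \<bar>\<phi> x\<bar>" for x
    have sP: "sq_int P" and sR: "sq_int R" and sT: "sq_int T"
      using test_fields_sq_int[OF q] sq_int_grad[OF p] sp by (auto simp: sq_int_def P_def[abs_def] R_def[abs_def] T_def[abs_def])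
    have nP: "norm (abs_L2 P) = norm (abs_L2 \<Psi>)"
      by (rule power2_eq_imp_eq) (simp_all add: norm_abs_L2_sq sP test_fields_sq_int[OF q], simp add: P_def)
    have nR: "norm (abs_L2 R) = norm (abs_L2 (grad \<phi>))"
      by (rule power2_eq_imp_eq) (simp_all add: norm_abs_L2_sq sR sq_int_grad[OF p], simp add: R_def)
    have nT: "norm (abs_L2 T) = norm (abs_L2 \<phi>)"
      by (rule power2_eq_imp_eq) (simp_all add: norm_abs_L2_sq sT sp, simp add: T_def)
    have si: "sq_int (\<lambda>x. \<bar>\<Psi> x \<bullet> i\<bar>)" "sq_int (\<lambda>x. \<bar>grad \<phi> x \<bullet> i\<bar>)" if i: "i \<in> Basis" for i
      using sq_int_abs[OF test_functions_sq_int[OF test_fields_component[OF q i]]] sq_int_abs[OF test_functions_sq_int[OF test_functions_deriv[OF p, of i]]]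
      by (simp_all add: grad_inner_Basis[OF i])
    have "(\<integral>x. (\<Sum>i\<in>Basis. \<bar>\<Psi> x \<bullet> i\<bar> * \<bar>grad \<phi> x \<bullet> i\<bar>) \<partial>lborel) \<le> (\<integral>x. R x \<bullet> P x \<partial>lborel)"
    proof (rule integral_mono)
      show "integrable lborel (\<lambda>x. \<Sum>i\<in>Basis. \<bar>\<Psi> x \<bullet> i\<bar> * \<bar>grad \<phi> x \<bullet> i\<bar>)"
        using sq_int_inner[OF si] by (intro Bochner_Integration.integrable_sum) simp
      show "integrable lborel (\<lambda>x. R x \<bullet> P x)" by (rule sq_int_inner[OF sR sP])
      show "(\<Sum>i\<in>Basis. \<bar>\<Psi> x \<bullet> i\<bar> * \<bar>grad \<phi> x \<bullet> i\<bar>) \<le> R x \<bullet> P x" for x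
        using L2_set_mult_ineq[of "\<lambda>i. \<Psi> x \<bullet> i" "\<lambda>i. grad \<phi> x \<bullet> i" Basis]
        by (simp add: R_def P_def norm_eq_L2_set mult.commute)
    qed
    also have "\<dots> = abs_L2 R \<bullet> abs_L2 P" by (rule inner_abs_L2[OF sR sP, symmetric])
    also have "\<dots> \<le> norm (abs_L2 R) * norm (abs_L2 P)" by (rule norm_cauchy_schwarz)
    finally have 1: "(\<integral>x. (\<Sum>i\<in>Basis. \<bar>\<Psi> x \<bullet> i\<bar> * \<bar>grad \<phi> x \<bullet> i\<bar>) \<partial>lborel) \<le> norm (abs_L2 (grad \<phi>)) * norm (abs_L2 \<Psi>)"
      by (simp add: nP nR)
    have "(\<integral>x. (\<Sum>i\<in>Basis. \<bar>\<Psi> x \<bullet> i\<bar> * \<bar>\<phi> x\<bar>) \<partial>lborel) \<le> (\<integral>x. 2 * (T x \<bullet> P x) \<partial>lborel)"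
    proof (rule integral_mono)
      show "integrable lborel (\<lambda>x. \<Sum>i\<in>Basis. \<bar>\<Psi> x \<bullet> i\<bar> * \<bar>\<phi> x\<bar>)"
        using sq_int_inner[OF si(1) sT] by (intro Bochner_Integration.integrable_sum) (simp add: T_def)
      show "integrable lborel (\<lambda>x. 2 * (T x \<bullet> P x))" by (intro integrable_mult_right sq_int_inner[OF sT sP])
      fix x
      have "(\<Sum>i\<in>Basis. \<bar>\<Psi> x \<bullet> i\<bar>) \<le> P x * L2_set (\<lambda>_. 1) (Basis :: 'a set)"
        using L2_set_mult_ineq[of "\<lambda>i. \<Psi> x \<bullet> i" "\<lambda>_. 1" Basis]
        by (simp add: P_def norm_eq_L2_set)
      also have "L2_set (\<lambda>_. 1) (Basis :: 'a set) \<le> 2"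
        using dim by (simp add: L2_set_def real_le_lsqrt)
      finally have "(\<Sum>i\<in>Basis. \<bar>\<Psi> x \<bullet> i\<bar>) \<le> P x * 2" by (simp add: P_def mult_left_mono)
      then have "(\<Sum>i\<in>Basis. \<bar>\<Psi> x \<bullet> i\<bar>) * \<bar>\<phi> x\<bar> \<le> P x * 2 * \<bar>\<phi> x\<bar>" by (rule mult_right_mono) simp
      then show "(\<Sum>i\<in>Basis. \<bar>\<Psi> x \<bullet> i\<bar> * \<bar>\<phi> x\<bar>) \<le> 2 * (T x \<bullet> P x)"
        unfolding sum_distrib_right by (simp add: T_def mult_ac)
    qed
    also have "\<dots> = 2 * (abs_L2 T \<bullet> abs_L2 P)" by (simp add: inner_abs_L2[OF sT sP])
    also have "\<dots> \<le> 2 * (norm (abs_L2 T) * norm (abs_L2 P))" by (intro mult_left_mono norm_cauchy_schwarz) simp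
    finally have 2: "(\<integral>x. (\<Sum>i\<in>Basis. \<bar>\<Psi> x \<bullet> i\<bar> * \<bar>\<phi> x\<bar>) \<partial>lborel) \<le> 2 * norm (abs_L2 \<phi>) * norm (abs_L2 \<Psi>)"
      by (simp add: nP nT)
    show ?thesis
      by (intro add_mono mult_left_mono 1 2 s L)
  qed
  finally show ?thesis by (simp add: algebra_simps)
qed

text \<open>The functional sending \<Psi> to minus the pairing of the product with div \<Psi> is
  bounded for the L^2 norm of \<Psi>, so it is represented by some \<open>G\<close>. Testing with
  fields that have one nonzero component shows that \<open>G\<close> is the weak gradient, and the
  bound of the functional is the bound of its norm.\<close>

lemma product_in_H1:
  fixes D :: "'a::euclidean_space set"
  assumes D: "open D" and dim: "DIM('a) \<le> 4" and gL: "L-lipschitz_on D g" and gb: "\<And>x. x \<in> D \<Longrightarrow> \<bar>g x\<bar> \<le> s" and s: "s \<ge> 0"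
    and z: "z \<in> H10 D"
  shows "mult_on D g z \<in> H1 D" "norm (weak_gradient D (mult_on D g z)) \<le> s * H10_norm D z + 2 * L * norm z"
proof -
  have gc: "continuous_on D g" by (rule lipschitz_on_continuous_on[OF gL])
  have L: "L \<ge> 0" using gL by (simp add: lipschitz_on_nonneg)
  let ?w = "mult_on D g z"
  define C where "C = s * H10_norm D z + 2 * L * norm z"
  have C: "C \<ge> 0" using s L H10_norm_nonneg[of D z] by (simp add: C_def)
  have sym: "mult_on D g u \<bullet> v = u \<bullet> mult_on D g v" for u v
    by (rule mult_on_sym[OF D gc gb])
  have bound: "\<bar>?w \<bullet> abs_L2 (div_field \<Psi>)\<bar> \<le> C * norm (abs_L2 \<Psi>)" if q: "\<Psi> \<in> test_fields D" for \<Psi>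
  proof -
    obtain \<phi> where p: "\<And>n::nat. \<phi> n \<in> test_functions D"
      "(\<lambda>n. abs_L2 (\<phi> n)) \<longlonglongrightarrow> z" "(\<lambda>n. abs_L2 (grad (\<phi> n))) \<longlonglongrightarrow> weak_gradient D z"
      using H10_approx[OF D z] by blast
    show ?thesis
    proof (rule LIMSEQ_le)
      \<comment> \<open>By symmetry the factor \<open>g\<close> is moved to the fixed divergence, so
        L^2 convergence of the approximating functions is enough.\<close>
      show "(\<lambda>n. \<bar>mult_on D g (abs_L2 (\<phi> n)) \<bullet> abs_L2 (div_field \<Psi>)\<bar>) \<longlonglongrightarrow> \<bar>?w \<bullet> abs_L2 (div_field \<Psi>)\<bar>"
        unfolding sym by (intro tendsto_intros p)
      show "(\<lambda>n. (s * norm (abs_L2 (grad (\<phi> n))) + 2 * L * norm (abs_L2 (\<phi> n))) * norm (abs_L2 \<Psi>)) \<longlonglongrightarrow> C * norm (abs_L2 \<Psi>)"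
        unfolding C_def H10_norm_def by (intro tendsto_intros p)
      show "\<exists>N. \<forall>n\<ge>N. \<bar>mult_on D g (abs_L2 (\<phi> n)) \<bullet> abs_L2 (div_field \<Psi>)\<bar>
         \<le> (s * norm (abs_L2 (grad (\<phi> n))) + 2 * L * norm (abs_L2 (\<phi> n))) * norm (abs_L2 \<Psi>)"
        using product_field_bound_test[OF D dim gL gb s p(1) q] by blast
    qed
  qed
  define T where "T = abs_L2 ` test_fields D"
  \<comment> \<open>The functional has to act on classes, whereas the divergence is formed from a
    field. A representative is chosen here; independence of the choice follows next, since a test
    field of class 0 has zero pairing by \<open>bound\<close>.\<close>
  define rf where "rf V = (SOME \<Psi>. \<Psi> \<in> test_fields D \<and> abs_L2 \<Psi> = V)" for V :: "('a, 'a) L2"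
  have rf: "rf V \<in> test_fields D \<and> abs_L2 (rf V) = V" if V: "V \<in> T" for V
  proof -
    obtain \<Psi> where "\<Psi> \<in> test_fields D \<and> abs_L2 \<Psi> = V" using V unfolding T_def by blast
    then show ?thesis unfolding rf_def by (rule someI[where P = "\<lambda>\<Psi>. \<Psi> \<in> test_fields D \<and> abs_L2 \<Psi> = V"])
  qed
  define l where "l V = - (?w \<bullet> abs_L2 (div_field (rf V)))" for V
  have l: "l (abs_L2 \<Psi>) = - (?w \<bullet> abs_L2 (div_field \<Psi>))" if q: "\<Psi> \<in> test_fields D" for \<Psi>
  proof -
    let ?R = "rf (abs_L2 \<Psi>)"
    have R: "?R \<in> test_fields D" "abs_L2 ?R = abs_L2 \<Psi>" using rf[of "abs_L2 \<Psi>"] q by (auto simp: T_def)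
    define \<Theta> where "\<Theta> x = ?R x + (-1) *\<^sub>R \<Psi> x" for x
    note sc = test_fields_scale[OF q, of "-1"]
    have t: "\<Theta> \<in> test_fields D" unfolding \<Theta>_def by (rule test_fields_add(1)[OF R(1) sc(1)])
    have a: "abs_L2 \<Theta> = 0"
    proof -
      have "abs_L2 \<Theta> = abs_L2 ?R + abs_L2 (\<lambda>x. (-1) *\<^sub>R \<Psi> x)"
        unfolding \<Theta>_def by (rule plus_abs_L2[symmetric, OF test_fields_sq_int[OF R(1)] test_fields_sq_int[OF sc(1)]])
      also have "abs_L2 (\<lambda>x. (-1) *\<^sub>R \<Psi> x) = (-1) *\<^sub>R abs_L2 \<Psi>"
        by (rule scaleR_abs_L2[symmetric, OF test_fields_sq_int[OF q]])
      finally show ?thesis by (simp add: R(2))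
    qed
    have d: "abs_L2 (div_field \<Theta>) = abs_L2 (div_field ?R) - abs_L2 (div_field \<Psi>)"
      unfolding \<Theta>_def test_fields_add(2)[OF R(1) sc(1)] sc(2)
      by (simp add: minus_abs_L2 div_field_sq_int[OF R(1)] div_field_sq_int[OF q])
    have "?w \<bullet> abs_L2 (div_field \<Theta>) = 0" using bound[OF t] by (simp add: a)
    then show ?thesis by (simp add: l_def d inner_diff_right)
  qed
  obtain G X where G: "\<And>n::nat. X n \<in> T" "X \<longlonglongrightarrow> G" "norm G \<le> C" "\<And>V. V \<in> T \<Longrightarrow> l V = G \<bullet> V"
  proof (rule Riesz_dense[of T l C])
    have "(\<lambda>_. 0) \<in> test_fields D"
      using test_functionsI[of "\<lambda>_. 0" "{}" D] by (simp add: test_fields_def C_k_const)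
    then show "0 \<in> T" by (auto simp: T_def zero_L2.abs_eq)
    show "V + W \<in> T" "l (V + W) = l V + l W" if VW: "V \<in> T" "W \<in> T" for V W
    proof -
      obtain \<Psi> \<Theta> where q: "\<Psi> \<in> test_fields D" "\<Theta> \<in> test_fields D" and e: "V = abs_L2 \<Psi>" "W = abs_L2 \<Theta>"
        using VW by (auto simp: T_def)
      have s: "V + W = abs_L2 (\<lambda>x. \<Psi> x + \<Theta> x)"
        unfolding e by (rule plus_abs_L2[OF test_fields_sq_int[OF q(1)] test_fields_sq_int[OF q(2)]])
      show "V + W \<in> T" unfolding s T_def using test_fields_add(1)[OF q] by blast
      show "l (V + W) = l V + l W"
        unfolding s l[OF test_fields_add(1)[OF q]] unfolding e l[OF q(1)] l[OF q(2)]
        by (simp add: test_fields_add(2)[OF q] plus_abs_L2[symmetric] div_field_sq_int[OF q(1)] div_field_sq_int[OF q(2)] inner_add_right)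
    qed
    show "c *\<^sub>R V \<in> T" "l (c *\<^sub>R V) = c * l V" if V: "V \<in> T" for c V
    proof -
      obtain \<Psi> where q: "\<Psi> \<in> test_fields D" and e: "V = abs_L2 \<Psi>"
        using V by (auto simp: T_def)
      have s: "c *\<^sub>R V = abs_L2 (\<lambda>x. c *\<^sub>R \<Psi> x)"
        unfolding e by (rule scaleR_abs_L2[OF test_fields_sq_int[OF q]])
      show "c *\<^sub>R V \<in> T" unfolding s T_def using test_fields_scale(1)[OF q] by blast
      show "l (c *\<^sub>R V) = c * l V"
        unfolding s l[OF test_fields_scale(1)[OF q]] unfolding e l[OF q] test_fields_scale(2)[OF q]
        by (simp only: scaleR_abs_L2[OF div_field_sq_int[OF q], symmetric] inner_scaleR_right mult_minus_right)
    qed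
    show "\<bar>l V\<bar> \<le> C * norm V" if "V \<in> T" for V
      using that bound l by (auto simp: T_def)
  qed (use C that in auto)
  have "is_weak_gradient D ?w G"
    unfolding is_weak_gradient_iff
  proof (intro conjI ballI)
    show "G \<in> L2_on D"
    proof (rule L2_on_limit[OF _ G(2)])
      show "X n \<in> L2_on D" for n using G(1)[of n] test_fields_in_L2_on by (auto simp: T_def)
    qed
    fix \<phi> and i :: 'a assume a: "\<phi> \<in> test_functions D" "i \<in> Basis"
    note si = test_fields_single[OF a]
    have "l (abs_L2 (\<lambda>x. \<phi> x *\<^sub>R i)) = G \<bullet> abs_L2 (\<lambda>x. \<phi> x *\<^sub>R i)"
      by (rule G(4)) (use si(1) in \<open>auto simp: T_def\<close>)
    then show "?w \<bullet> abs_L2 (\<lambda>x. frechet_derivative \<phi> (at x) i) = - (G \<bullet> abs_L2 (\<lambda>x. \<phi> x *\<^sub>R i))"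
      using l[OF si(1)] by (simp add: si(2))
  qed
  then show "?w \<in> H1 D" "norm (weak_gradient D ?w) \<le> s * H10_norm D z + 2 * L * norm z"
    using weak_gradient_eqI[OF D] mult_on_in_L2_on[OF D gc gb] G(3) by (auto simp: H1_def C_def)
qed

lemma sqrt_sum_squares_le: "0 \<le> x \<Longrightarrow> 0 \<le> y \<Longrightarrow> sqrt (x\<^sup>2 + y\<^sup>2) \<le> x + y"
  by (rule real_le_lsqrt) (auto simp: power2_sum)

lemma product_H1_norm:
  fixes D :: "'a::euclidean_space set"
  assumes D: "open D" "bounded D" and dim: "DIM('a) \<le> 4" and gL: "L-lipschitz_on D g"
    and gb: "\<And>x. x \<in> D \<Longrightarrow> \<bar>g x\<bar> \<le> s" and s: "s \<ge> 0" and z: "z \<in> H10 D"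
  shows "H1_norm D (mult_on D g z) \<le> (embedding_const D + 1)\<^sup>2 * (s + L) * H10_norm D z"
proof -
  let ?C = "embedding_const D" and ?N = "H10_norm D z"
  have gc: "continuous_on D g" by (rule lipschitz_on_continuous_on[OF gL])
  have L: "L \<ge> 0" using gL by (simp add: lipschitz_on_nonneg)
  note C = embedding_const(1)[OF D z] embedding_const(2)[OF D]
  have N: "0 \<le> ?N" by (rule H10_norm_nonneg)
  have "H1_norm D (mult_on D g z) \<le> norm (mult_on D g z) + norm (weak_gradient D (mult_on D g z))"
    unfolding H1_norm_def by (rule sqrt_sum_squares_le) auto
  also have "\<dots> \<le> s * norm z + (s * ?N + 2 * L * norm z)"
    using norm_mult_on[OF D(1) gc gb, of z] product_in_H1(2)[OF D(1) dim gL gb s z] s by simp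
  also have "\<dots> \<le> s * (?C * ?N) + (s * ?N + 2 * L * (?C * ?N))"
    using C s L by (intro add_mono mult_left_mono) auto
  \<comment> \<open>The added nonnegative amount is exactly what is missing to the product of (C_D +
    1)^2 and s + L. Here the factor 2 in front of \<open>L\<close> is absorbed.\<close>
  also have "\<dots> \<le> s * (?C * ?N) + (s * ?N + 2 * L * (?C * ?N)) + (?C\<^sup>2 * (s + L) + ?C * s + L) * ?N"
    using C(2) s L N by simp
  also have "\<dots> = (?C + 1)\<^sup>2 * (s + L) * ?N"
    by (simp add: power2_eq_square algebra_simps)
  finally show ?thesis .
qed

section \<open>Gradient of the sample average objective\<close>

text \<open>As for \<open>embedding_const\<close>: the supremum is a bound because a member of
  \<open>Hm1\<close> comes with some constant, and that constant also settles vectors of gradient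
  norm 0.\<close>

lemma Hm1_bound:
  assumes "l \<in> Hm1 D" "v \<in> H10 D"
  shows "\<bar>l v\<bar> \<le> Hm1_norm D l * H10_norm D v"
proof -
  obtain C where C: "\<And>v. v \<in> H10 D \<Longrightarrow> \<bar>l v\<bar> \<le> C * H10_norm D v"
    using assms(1) unfolding Hm1_def by blast
  have "\<bar>l v\<bar> / H10_norm D v \<le> \<bar>C\<bar>" if "v \<in> H10 D" for v
    using C[OF that] H10_norm_nonneg[of D v]
    by (cases "H10_norm D v = 0") (auto simp: divide_simps intro: order_trans[OF _ mult_right_mono[OF abs_ge_self]])
  then have bdd: "bdd_above ((\<lambda>v. \<bar>l v\<bar> / H10_norm D v) ` H10 D)"
    by (auto intro!: bdd_aboveI2)
  have "\<bar>l v\<bar> / H10_norm D v \<le> Hm1_norm D l"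
    unfolding Hm1_norm_def onorm_on_def by (rule cSUP_upper[OF assms(2) bdd])
  then show ?thesis
    using C[OF assms(2)] H10_norm_nonneg[of D v]
    by (cases "H10_norm D v = 0") (auto simp: divide_simps)
qed

text \<open>The bound and the Lipschitz constant are kept separate, because the estimate for
  products is linear in s + L and it is this sum that \<open>gmax\<close> dominates.\<close>

lemma C01_constants:
  fixes D :: "'a::euclidean_space set"
  assumes D: "open D" "bounded D" "D \<noteq> {}" and g: "g \<in> C01 (closure D)" and le: "C01_norm (closure D) g \<le> gmax"
  obtains s L where "s \<ge> 0" "s + L \<le> gmax" "\<And>x. x \<in> D \<Longrightarrow> \<bar>g x\<bar> \<le> s" "L-lipschitz_on D g"
proof -
  let ?K = "closure D" and ?P = "{(x, y). x \<in> closure D \<and> y \<in> closure D \<and> x \<noteq> y}"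
  obtain L0 where L0: "L0-lipschitz_on ?K g" using g by (auto simp: C01_def)
  define s where "s = (SUP x\<in>?K. \<bar>g x\<bar>)"
  define L where "L = (SUP (x, y)\<in>?P. \<bar>g x - g y\<bar> / norm (x - y))"
  have "compact ?K" using D(2) by (simp add: compact_closure)
  moreover have "continuous_on ?K (\<lambda>x. \<bar>g x\<bar>)"
    using lipschitz_on_continuous_on[OF L0] by (intro continuous_intros)
  ultimately have bdd1: "bdd_above ((\<lambda>x. \<bar>g x\<bar>) ` ?K)"
    by (meson bounded_imp_bdd_above compact_continuous_image compact_imp_bounded)
  have q: "\<bar>g x - g y\<bar> / norm (x - y) \<le> L0" if "(x, y) \<in> ?P" for x y
    using lipschitz_onD[OF L0, of x y] that by (auto simp: dist_norm dist_real_def divide_simps)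
  then have bdd2: "bdd_above ((\<lambda>(x, y). \<bar>g x - g y\<bar> / norm (x - y)) ` ?P)"
    by (intro bdd_aboveI2[where M = L0]) auto
  have up: "\<bar>g x - g y\<bar> / norm (x - y) \<le> L" if "(x, y) \<in> ?P" for x y
    using cSUP_upper[OF that bdd2] by (simp add: L_def)
  \<comment> \<open>Nonnegativity of the supremum \<open>L\<close> requires a pair of distinct
    points, found in a ball inside \<open>D\<close>.\<close>
  obtain x where x: "x \<in> D" using D(3) by blast
  obtain r where r: "r > 0" "cball x r \<subseteq> D" using D(1) x open_contains_cball by blast
  obtain e :: 'a where e: "e \<in> Basis" using nonempty_Basis by blast
  have "x + r *\<^sub>R e \<in> D" "x + r *\<^sub>R e \<noteq> x" using r e by (auto simp: dist_norm subset_iff)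
  then have "(x, x + r *\<^sub>R e) \<in> ?P" using x closure_subset[of D] by auto
  from up[OF this] have L: "0 \<le> L" by (rule order_trans[rotated]) simp
  show ?thesis
  proof (rule that[of s L])
    show gs: "\<bar>g y\<bar> \<le> s" if "y \<in> D" for y
      unfolding s_def using that closure_subset[of D] by (intro cSUP_upper bdd1) auto
    show "0 \<le> s" using gs[OF x] by linarith
    show "s + L \<le> gmax" using le by (simp add: C01_norm_def s_def L_def)
    show "L-lipschitz_on D g"
    proof (rule lipschitz_onI[OF _ L])
      fix a b assume "a \<in> D" "b \<in> D"
      then show "dist (g a) (g b) \<le> L * dist a b"
        using up[of a b] closure_subset[of D]
        by (cases "a = b") (auto simp: dist_norm dist_real_def divide_simps subset_iff)
    qed
  qed
qed

section \<open>From admissible data to the problem at one sample\<close>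

lemma polynomial_growth_antiderivative:
  fixes f f' :: "real \<Rightarrow> real"
  assumes d: "\<And>t. (f has_field_derivative f' t) (at t)" and b: "\<And>t. \<bar>f' t\<bar> \<le> C * (1 + \<bar>t\<bar>) ^ m"
  shows "\<bar>f t\<bar> \<le> (\<bar>f 0\<bar> + C) * (1 + \<bar>t\<bar>) ^ Suc m"
proof -
  have C: "0 \<le> C" using b[of 0] by simp
  let ?B = "C * (1 + \<bar>t\<bar>) ^ m"
  have "norm (f t - f 0) \<le> ?B * norm (t - 0)"
  proof (rule field_differentiable_bound[of "cball 0 \<bar>t\<bar>" f f'])
    fix z :: real assume z: "z \<in> cball 0 \<bar>t\<bar>"
    show "(f has_field_derivative f' z) (at z within cball 0 \<bar>t\<bar>)" by (rule has_field_derivative_at_within[OF d])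
    have "C * (1 + \<bar>z\<bar>) ^ m \<le> ?B" using z C by (intro mult_left_mono power_mono) auto
    with b[of z] show "norm (f' z) \<le> ?B" by simp
  qed auto
  then have "\<bar>f t\<bar> \<le> \<bar>f 0\<bar> * 1 + ?B * \<bar>t\<bar>" by simp
  also have "\<dots> \<le> \<bar>f 0\<bar> * (1 + \<bar>t\<bar>) ^ Suc m + ?B * (1 + \<bar>t\<bar>)"
    using C by (intro add_mono mult_left_mono one_le_power) auto
  also have "\<dots> = (\<bar>f 0\<bar> + C) * (1 + \<bar>t\<bar>) ^ Suc m" by (simp add: algebra_simps)
  finally show ?thesis .
qed

text \<open>The real exponent p is replaced by the integer 2k. In space k = 3 works since p \<le> 6;
  in the plane k is p rounded up, so k \<ge> 4 and 2k - 3 \<ge> k \<ge> p. Replacing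
  \<open>\<bar>t\<bar>\<close> by \<open>1 + \<bar>t\<bar>\<close> makes the powers monotone in the
  exponent.\<close>

lemma admissible_nonlinearity_growth:
  assumes q: "admissible_nonlinearity d q" and d: "d = 2 \<or> d = 3"
  obtains k C Q where "k > 1" "d = 2 \<or> d = 3 \<and> k = 3"
    "\<And>t. (q has_field_derivative deriv q t) (at t)"
    "\<And>t. (deriv q has_field_derivative deriv (deriv q) t) (at t)"
    "\<And>t. (Q has_field_derivative q t) (at t)" "Q 0 = 0"
    "\<And>t. \<bar>deriv (deriv q) t\<bar> \<le> C * (1 + \<bar>t\<bar>) ^ (2 * k - 3)"
proof -
  have dq: "(q has_field_derivative deriv q t) (at t)" "(deriv q has_field_derivative deriv (deriv q) t) (at t)" for t
    using q by (auto simp: admissible_nonlinearity_def differentiable_on_def real_differentiable_def DERIV_deriv_iff_real_differentiable)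
  obtain c p e where c: "0 \<le> c" "0 \<le> e" "3 < p" "d = 3 \<Longrightarrow> p \<le> 6"
    "\<And>t. \<bar>deriv (deriv q) t\<bar> \<le> c + e * \<bar>t\<bar> powr (p - 3)"
    using q unfolding admissible_nonlinearity_def by blast
  define k where "k = (if d = 3 then 3 else nat \<lceil>p\<rceil>)"
  have pk: "p - 3 \<le> real (2 * k - 3)" and k1: "k > 1"
  proof -
    have "p \<le> real k + 3" "real k \<ge> 3"
      using c(3,4) by (auto simp: k_def) linarith+
    then have "2 * k - 3 \<ge> k" by linarith
    then have "real k \<le> real (2 * k - 3)" by simp
    then show "p - 3 \<le> real (2 * k - 3)" using \<open>p \<le> real k + 3\<close> by linarith
    show "k > 1" using \<open>real k \<ge> 3\<close> by linarith
  qed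
  have grow: "\<bar>deriv (deriv q) t\<bar> \<le> (c + e) * (1 + \<bar>t\<bar>) ^ (2 * k - 3)" for t
  proof -
    have "\<bar>t\<bar> powr (p - 3) \<le> (1 + \<bar>t\<bar>) powr (p - 3)" using c(3) by (intro powr_mono2) auto
    also have "\<dots> \<le> (1 + \<bar>t\<bar>) powr real (2 * k - 3)" using pk by (intro powr_mono) auto
    also have "\<dots> = (1 + \<bar>t\<bar>) ^ (2 * k - 3)" by (rule powr_realpow) linarith
    finally have "c * 1 + e * \<bar>t\<bar> powr (p - 3) \<le> c * (1 + \<bar>t\<bar>) ^ (2 * k - 3) + e * (1 + \<bar>t\<bar>) ^ (2 * k - 3)"
      using c(1,2) by (intro add_mono mult_left_mono one_le_power) auto
    then show ?thesis using c(5)[of t] by (simp add: algebra_simps)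
  qed
  have "\<exists>F. \<forall>x. - \<infinity> < ereal x \<longrightarrow> ereal x < \<infinity> \<longrightarrow> (F has_vector_derivative q x) (at x)"
    by (rule einterval_antiderivative) (use dq in \<open>auto intro: DERIV_isCont\<close>)
  then obtain Q0 where Q0: "\<And>x. (Q0 has_field_derivative q x) (at x)"
    by (auto simp: has_real_derivative_iff_has_vector_derivative)
  show ?thesis
  proof (rule that[OF k1 _ dq, of "\<lambda>t. Q0 t - Q0 0" "c + e"])
    show "d = 2 \<or> d = 3 \<and> k = 3" using d by (auto simp: k_def)
    show "((\<lambda>t. Q0 t - Q0 0) has_field_derivative q t) (at t)" for t
      by (auto intro!: derivative_eq_intros Q0)
  qed (use grow in auto)
qed

lemma state_problem_of_data:
  fixes D :: "'a::euclidean_space set"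
  assumes data: "admissible_pde_data D M A \<kappa> b bmax g gmax B q" and x: "x \<in> space M"
  obtains CA n Q s L Ks Cq Cq' Cq'' where
    "state_problem D (A x) \<kappa> CA n (b x) (g x) (B x) q (deriv q) (deriv (deriv q)) Q bmax s Ks Cq Cq' Cq''"
    "s + L \<le> gmax" "L-lipschitz_on D (g x)"
proof -
  have dim: "DIM('a) = 2 \<or> DIM('a) = 3" and D: "open D" "bounded D" "D \<noteq> {}"
    using data by (auto simp: admissible_pde_data_def bounded_Lipschitz_domain_def)
  have A: "A x \<in> bounded_ops_Hm1 (H10 D) (H10_norm D) D"
    "\<And>y v. y \<in> H10 D \<Longrightarrow> v \<in> H10 D \<Longrightarrow> A x y v = A x v y" "0 < \<kappa>"
    "\<And>y. y \<in> H10 D \<Longrightarrow> \<kappa> * (H10_norm D y)\<^sup>2 \<le> A x y y"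
    using data x unfolding admissible_pde_data_def by blast+
  have b: "b x \<in> Hm1 D" "Hm1_norm D (b x) \<le> bmax" and g: "g x \<in> C01 (closure D)" "C01_norm (closure D) (g x) \<le> gmax"
    using data x unfolding admissible_pde_data_def by blast+
  have B: "\<And>u v. u \<in> L2_on D \<Longrightarrow> v \<in> H10 D \<Longrightarrow> B x u v = (LINT y:D|lborel. (g x y * rep_L2 u y) * rep_L2 v y)"
    and q: "admissible_nonlinearity DIM('a) q"
    using data x unfolding admissible_pde_data_def by blast+
  obtain s L where s: "s \<ge> 0" "s + L \<le> gmax" "\<And>y. y \<in> D \<Longrightarrow> \<bar>g x y\<bar> \<le> s" "L-lipschitz_on D (g x)"
    using C01_constants[OF D g] by blast
  obtain k C Q where k: "k > 1" "DIM('a) = 2 \<or> DIM('a) = 3 \<and> k = 3"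
    and dq: "\<And>t. (q has_field_derivative deriv q t) (at t)"
    "\<And>t. (deriv q has_field_derivative deriv (deriv q) t) (at t)"
    and Q: "\<And>t. (Q has_field_derivative q t) (at t)" "Q 0 = 0"
    and grow: "\<And>t. \<bar>deriv (deriv q) t\<bar> \<le> C * (1 + \<bar>t\<bar>) ^ (2 * k - 3)"
    by (rule admissible_nonlinearity_growth[OF q dim]) (rule that)
  \<comment> \<open>Two integrations raise the exponent 2k - 3 of q'' to 2k - 2 for q' and 2k - 1
    for q, as \<open>state_problem\<close> demands for n = 2k.\<close>
  define C' where "C' = \<bar>deriv q 0\<bar> + C"
  have e: "2 * k - 2 = Suc (2 * k - 3)" "2 * k - 1 = Suc (2 * k - 2)" using k(1) by auto
  have grow': "\<bar>deriv q t\<bar> \<le> C' * (1 + \<bar>t\<bar>) ^ (2 * k - 2)" for t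
    unfolding C'_def e(1) by (rule polynomial_growth_antiderivative[OF dq(2) grow])
  have grow'': "\<bar>q t\<bar> \<le> (\<bar>q 0\<bar> + C') * (1 + \<bar>t\<bar>) ^ (2 * k - 1)" for t
    unfolding e(2) by (rule polynomial_growth_antiderivative[OF dq(1) grow'])
  have k0: "k > 0" using k(1) by simp
  obtain Ks where Ks: "Ks \<ge> 0" "\<And>v. v \<in> H10 D \<Longrightarrow> integrable lborel (\<lambda>y. rep_L2 v y ^ (2 * k))"
    "\<And>v. v \<in> H10 D \<Longrightarrow> (\<integral>y. rep_L2 v y ^ (2 * k) \<partial>lborel) \<le> Ks * H10_norm D v ^ (2 * k)"
    by (rule Sobolev[OF D(1,2) k0 k(2)]) (rule that)
  obtain CA where CA: "\<And>y. y \<in> H10 D \<Longrightarrow> Hm1_norm D (A x y) \<le> CA * H10_norm D y"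
    using A(1) unfolding bounded_ops_Hm1_def by blast
  have "state_problem D (A x) \<kappa> CA (2 * k) (b x) (g x) (B x) q (deriv q) (deriv (deriv q)) Q bmax s Ks (\<bar>q 0\<bar> + C') C' C"
  proof
    show "open D" "bounded D" "0 < \<kappa>" "0 < 2 * k" "3 < 2 * k" "0 \<le> s" "Q 0 = 0"
      using D A(3) k(1) s(1) Q(2) by auto
    show "Lp_fun (2 * k) (rep_L2 v)" if "v \<in> H10 D" for v
      using Ks(2)[OF that] by (simp add: Lp_fun_def power_even_abs)
    show "A x (u + v) w = A x u w + A x v w" if "u \<in> H10 D" "v \<in> H10 D" "w \<in> H10 D" for u v w
      using A(1) that unfolding bounded_ops_Hm1_def by blast
    show "A x (c *\<^sub>R u) w = c * A x u w" if "u \<in> H10 D" "w \<in> H10 D" for c u w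
      using A(1) that unfolding bounded_ops_Hm1_def by blast
    show "A x u w = A x w u" if "u \<in> H10 D" "w \<in> H10 D" for u w by (rule A(2)[OF that])
    show "\<bar>A x u w\<bar> \<le> CA * H10_norm D u * H10_norm D w" if u: "u \<in> H10 D" and w: "w \<in> H10 D" for u w
    proof -
      have "A x u \<in> Hm1 D" using A(1) u unfolding bounded_ops_Hm1_def by blast
      from Hm1_bound[OF this w] show ?thesis
        using mult_right_mono[OF CA[OF u] H10_norm_nonneg[of D w]] by linarith
    qed
    show "\<kappa> * (H10_norm D u)\<^sup>2 \<le> A x u u" if "u \<in> H10 D" for u by (rule A(4)[OF that])
    show "b x (u + v) = b x u + b x v" if "u \<in> H10 D" "v \<in> H10 D" for u v
      using b(1) that by (auto simp: Hm1_def)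
    show "b x (c *\<^sub>R u) = c * b x u" if "u \<in> H10 D" for c u
      using b(1) that by (auto simp: Hm1_def)
    show "\<bar>b x u\<bar> \<le> bmax * H10_norm D u" if u: "u \<in> H10 D" for u
      using Hm1_bound[OF b(1) u] mult_right_mono[OF b(2) H10_norm_nonneg[of D u]] by linarith
    show "continuous_on D (g x)" by (rule lipschitz_on_continuous_on[OF s(4)])
    show "\<bar>g x y\<bar> \<le> s" if "y \<in> D" for y by (rule s(3)[OF that])
    show "B x u v = (LINT y:D|lborel. (g x y * rep_L2 u y) * rep_L2 v y)" if "u \<in> L2_on D" "v \<in> H10 D" for u v
      by (rule B[OF that])
    show "(\<integral>y. \<bar>rep_L2 v y\<bar> ^ (2 * k) \<partial>lborel) \<le> Ks * H10_norm D v ^ (2 * k)" if "v \<in> H10 D" for v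
      using Ks(3)[OF that] by (simp add: power_even_abs)
    show "q 0 = 0" "mono q" using q by (auto simp: admissible_nonlinearity_def)
  qed (fact dq Q grow grow' grow'')+
  then show ?thesis using s(2,4) by (rule that)
qed

text \<open>The bound has three factors: multiplication by \<open>g\<close>, the estimate of the
  adjoint state by the residual, and the bound on the residual from \<open>S_bound\<close> and the
  embedding. A quadratic expansion is kept instead of a derivative because expansions can be
  averaged directly.\<close>

lemma sample_gradient:
  fixes D :: "'a::euclidean_space set"
  assumes data: "admissible_pde_data D M A \<kappa> b bmax g gmax B q" and x: "x \<in> space M"
    and u: "u \<in> L2_on D" "norm u \<le> r"
  obtains G K \<delta> where "G \<in> H1 D" "\<delta> > 0"
    "H1_norm D G \<le> (embedding_const D + 1)\<^sup>2 * (embedding_const D / \<kappa>) * gmax *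
       (embedding_const D / \<kappa> * bmax + (embedding_const D)\<^sup>2 / \<kappa> * gmax * r + norm yd)"
    "\<And>u'. u' \<in> L2_on D \<Longrightarrow> norm (u' - u) \<le> \<delta> \<Longrightarrow>
      \<bar>(norm (solution_op D A q b B u' x - yd))\<^sup>2 / 2 - (norm (solution_op D A q b B u x - yd))\<^sup>2 / 2 - G \<bullet> (u' - u)\<bar>
        \<le> K * (norm (u' - u))\<^sup>2"
proof -
  obtain CA n Q s L Ks Cq Cq' Cq'' where sp:
    "state_problem D (A x) \<kappa> CA n (b x) (g x) (B x) q (deriv q) (deriv (deriv q)) Q bmax s Ks Cq Cq' Cq''"
    and sL: "s + L \<le> gmax" and gL: "L-lipschitz_on D (g x)"
    by (rule state_problem_of_data[OF data x]) (rule that)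
  interpret state_problem D "A x" \<kappa> CA n "b x" "g x" "B x" q "deriv q" "deriv (deriv q)" Q bmax s Ks Cq Cq' Cq''
    by (rule sp)
  have dim: "DIM('a) \<le> 4" and bm: "0 \<le> bmax" and gm: "0 \<le> gmax"
    using data by (auto simp: admissible_pde_data_def)
  have S: "solution_op D A q b B v x = S v" for v by (simp add: S_def solution_op_def)
  have L: "0 \<le> L" using gL by (rule lipschitz_on_nonneg)
  obtain z K \<delta> where z: "z \<in> H10 D" "N z \<le> CD / \<kappa> * norm (S u - yd)" "\<delta> > 0"
    "\<And>u'. u' \<in> L2_on D \<Longrightarrow> norm (u' - u) \<le> \<delta> \<Longrightarrow>
      \<bar>(norm (S u' - yd))\<^sup>2 / 2 - (norm (S u - yd))\<^sup>2 / 2 - mult_on D (g x) z \<bullet> (u' - u)\<bar> \<le> K * (norm (u' - u))\<^sup>2"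
    by (rule objective_expansion[OF u(1), of yd]) (rule that)
  define DD where "DD = CD / \<kappa> * bmax + CD\<^sup>2 / \<kappa> * gmax * r + norm yd"
  have "norm (S u - yd) \<le> norm (S u) + norm yd" by (rule norm_triangle_ineq4)
  also have "\<dots> \<le> CD * (bmax / \<kappa> + CD / \<kappa> * s * norm u) + norm yd"
    using CD(1)[OF S_H10[OF u(1)]] mult_left_mono[OF S_bound[OF u(1) bm] CD(2)] by linarith
  also have "\<dots> \<le> CD * (bmax / \<kappa> + CD / \<kappa> * gmax * r) + norm yd"
    using CD(2) \<kappa> s sL L u(2) gm by (intro add_mono mult_left_mono mult_mono) auto
  also have "\<dots> = DD"
    by (simp add: DD_def algebra_simps power2_eq_square)
  finally have SD: "norm (S u - yd) \<le> DD" .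
  show ?thesis
  proof (rule that[of "mult_on D (g x) z" \<delta> K])
    show "mult_on D (g x) z \<in> H1 D"
      by (rule product_in_H1(1)[OF D_open dim gL g_bound s z(1)])
    have "H1_norm D (mult_on D (g x) z) \<le> (CD + 1)\<^sup>2 * (s + L) * N z"
      by (rule product_H1_norm[OF D_open D_bounded dim gL g_bound s z(1)])
    also have "\<dots> \<le> (CD + 1)\<^sup>2 * gmax * (CD / \<kappa> * DD)"
    proof (rule mult_mono)
      show "(CD + 1)\<^sup>2 * (s + L) \<le> (CD + 1)\<^sup>2 * gmax" using sL by (intro mult_left_mono) auto
      have "CD / \<kappa> * norm (S u - yd) \<le> CD / \<kappa> * DD"
        using SD CD(2) \<kappa> by (intro mult_left_mono) auto
      then show "N z \<le> CD / \<kappa> * DD" using z(2) by linarith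
    qed (use gm H10_norm_nonneg in auto)
    also have "\<dots> = (CD + 1)\<^sup>2 * (CD / \<kappa>) * gmax * DD" by (simp add: mult_ac)
    finally show "H1_norm D (mult_on D (g x) z) \<le> (CD + 1)\<^sup>2 * (CD / \<kappa>) * gmax * (CD / \<kappa> * bmax + CD\<^sup>2 / \<kappa> * gmax * r + norm yd)"
      by (simp only: DD_def)
  qed (use z(3,4) in \<open>auto simp: S\<close>)
qed

section \<open>Identification of the gradient and the sample average\<close>

lemma L2_gradient_eqI:
  fixes F :: "('a::euclidean_space, real) L2 \<Rightarrow> real"
  assumes u: "u \<in> L2_on D" and G: "G \<in> L2_on D" and \<delta>: "\<delta> > 0"
    and b: "\<And>u'. u' \<in> L2_on D \<Longrightarrow> norm (u' - u) \<le> \<delta> \<Longrightarrow> \<bar>F u' - F u - G \<bullet> (u' - u)\<bar> \<le> K * (norm (u' - u))\<^sup>2"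
  shows "L2_gradient D F u = G"
  unfolding L2_gradient_def
proof (rule the_equality, intro conjI G)
  show d: "(F has_derivative (\<lambda>h. G \<bullet> h)) (at u within L2_on D)"
    unfolding has_derivative_within_alt
  proof (intro conjI allI impI bounded_linear_inner_right)
    fix e :: real assume e: "e > 0"
    show "\<exists>d>0. \<forall>y\<in>L2_on D. norm (y - u) < d \<longrightarrow> norm (F y - F u - G \<bullet> (y - u)) \<le> e * norm (y - u)"
    proof (intro exI[of _ "min \<delta> (e / (\<bar>K\<bar> + 1))"] conjI ballI impI)
      fix y assume y: "y \<in> L2_on D" "norm (y - u) < min \<delta> (e / (\<bar>K\<bar> + 1))"
      have "\<bar>K\<bar> * norm (y - u) \<le> (\<bar>K\<bar> + 1) * norm (y - u)" by (intro mult_right_mono) auto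
      also have "\<dots> \<le> e" using y(2) by (simp add: field_simps)
      finally have "\<bar>K\<bar> * norm (y - u) * norm (y - u) \<le> e * norm (y - u)" by (rule mult_right_mono) simp
      moreover have "K * (norm (y - u))\<^sup>2 \<le> \<bar>K\<bar> * norm (y - u) * norm (y - u)"
        by (simp add: power2_eq_square mult.assoc mult_right_mono)
      ultimately show "norm (F y - F u - G \<bullet> (y - u)) \<le> e * norm (y - u)"
        using b[OF y(1)] y(2) by simp
    qed (use \<delta> e in auto)
  qed
  fix H assume "H \<in> L2_on D \<and> (F has_derivative (\<lambda>h. H \<bullet> h)) (at u within L2_on D)"
  then have H: "H \<in> L2_on D" "(F has_derivative (\<lambda>h. H \<bullet> h)) (at u within L2_on D)" by auto
  \<comment> \<open>For uniqueness both derivatives are restricted to the line through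
    \<open>u\<close> in direction \<open>H - G\<close>. This line stays in the subspace, and
    derivatives of a function of one real variable are unique.\<close>
  let ?d = "H - G"
  have "((\<lambda>t. u + t *\<^sub>R ?d) has_derivative (\<lambda>t. t *\<^sub>R ?d)) (at 0)"
    by (auto intro!: derivative_eq_intros)
  moreover have "(\<lambda>t. u + t *\<^sub>R ?d) ` UNIV \<subseteq> L2_on D"
    using u H(1) G by (auto intro!: add_in_L2_on scaleR_in_L2_on diff_in_L2_on)
  ultimately have c: "((\<lambda>t. F (u + t *\<^sub>R ?d)) has_derivative (\<lambda>t. X \<bullet> (t *\<^sub>R ?d))) (at 0)"
    if "(F has_derivative (\<lambda>h. X \<bullet> h)) (at u within L2_on D)" for X
    using has_derivative_in_compose2[of "L2_on D" F "\<lambda>u h. X \<bullet> h" "\<lambda>t. u + t *\<^sub>R ?d" UNIV 0 "\<lambda>t. t *\<^sub>R ?d"]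
      has_derivative_in_compose[of "\<lambda>t. u + t *\<^sub>R ?d" "\<lambda>t. t *\<^sub>R ?d" 0 UNIV F "\<lambda>h. X \<bullet> h"]
      has_derivative_subset[OF that] that by simp
  have "(\<lambda>t. H \<bullet> (t *\<^sub>R ?d)) = (\<lambda>t. G \<bullet> (t *\<^sub>R ?d))"
    by (rule has_derivative_unique[OF c[OF H(2)] c[OF d]])
  from fun_cong[OF this, of 1] have "?d \<bullet> ?d = 0" by (simp add: inner_diff_left)
  then show "H = G" by simp
qed

lemma H1_norm_scaleR: "open D \<Longrightarrow> u \<in> H1 D \<Longrightarrow> H1_norm D (c *\<^sub>R u) = \<bar>c\<bar> * H1_norm D u"
  using norm_scaleR[of c "(u, weak_gradient D u)"] by (simp add: H1_norm_Pair H1_scaleR del: norm_scaleR)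

lemma H1_sum:
  assumes D: "open D" and "finite I" "\<And>i. i \<in> I \<Longrightarrow> G i \<in> H1 D"
  shows "(\<Sum>i\<in>I. G i) \<in> H1 D \<and> H1_norm D (\<Sum>i\<in>I. G i) \<le> (\<Sum>i\<in>I. H1_norm D (G i))"
  using assms(2,3)
proof (induction I rule: finite_induct)
  case empty
  have z: "0 \<in> H1 D" using H10_zero[OF D] by (rule H10_D(1))
  then show ?case using H1_norm_scaleR[OF D z, of 0] by simp
next
  case (insert j I)
  let ?s = "\<Sum>i\<in>I. G i"
  have s: "?s \<in> H1 D" "H1_norm D ?s \<le> (\<Sum>i\<in>I. H1_norm D (G i))" and j: "G j \<in> H1 D" using insert by auto
  have "H1_norm D (G j + ?s) \<le> H1_norm D (G j) + H1_norm D ?s"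
    using norm_triangle_ineq[of "(G j, weak_gradient D (G j))" "(?s, weak_gradient D ?s)"]
    by (simp add: H1_norm_Pair H1_add(2)[OF D j s(1)])
  then show ?case using insert(1,2) H1_add(1)[OF D j s(1)] s(2) by simp
qed

theorem proposition4p1:
  fixes D :: "'a::euclidean_space set"
    and M :: "'x::polish_space measure"
    and A :: "'x \<Rightarrow> ('a, real) L2 \<Rightarrow> ('a, real) L2 \<Rightarrow> real"
    and b :: "'x \<Rightarrow> ('a, real) L2 \<Rightarrow> real"
    and g :: "'x \<Rightarrow> 'a \<Rightarrow> real"
    and B :: "'x \<Rightarrow> ('a, real) L2 \<Rightarrow> ('a, real) L2 \<Rightarrow> real"
    and q :: "real \<Rightarrow> real"
    and \<kappa>min bmax gmax \<alpha> r_ad :: real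
    and P0 :: "'o0 measure" and \<xi>0 :: "'o0 \<Rightarrow> 'x"
    and P :: "'o measure" and \<xi> :: "nat \<Rightarrow> 'o \<Rightarrow> 'x"
    and yd :: "('a, real) L2" and \<psi> :: "('a, real) L2 \<Rightarrow> ereal"
  assumes "prob_space M" and "complete_measure M" and "space M = UNIV"
    and "sets borel \<subseteq> sets M"
    and "prob_space P0" and "\<xi>0 \<in> measurable P0 borel"
    and "prob_space P" and "complete_measure P"
    and "\<And>i. i \<ge> 1 \<Longrightarrow> \<xi> i \<in> measurable P borel"
    and "prob_space.indep_vars P (\<lambda>_. borel) \<xi> {1..}"
    and "\<And>i. i \<ge> 1 \<Longrightarrow> distr P borel (\<xi> i) = distr P0 borel \<xi>0"
    and "admissible_pde_data D M A \<kappa>min b bmax g gmax B q"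
    and "yd \<in> L2_on D" and "\<alpha> > 0"
    and "proper_on (L2_on D) \<psi>" and "convex_ereal_on (L2_on D) \<psi>" and "lsc_on (L2_on D) \<psi>"
    and "r_ad > 0" and "\<And>u. u \<in> L2_on D \<Longrightarrow> \<psi> u < \<infinity> \<Longrightarrow> norm u \<le> r_ad"
  defines "C_D \<equiv> embedding_const D"
  defines "DD \<equiv> C_D / \<kappa>min * bmax + C_D\<^sup>2 / \<kappa>min * gmax * r_ad + norm yd"
  defines "R_ad \<equiv> (C_D + 1)\<^sup>2 * (C_D / \<kappa>min) * gmax * DD"
  defines "V_ad \<equiv> {u \<in> H1 D. H1_norm D u \<le> 1 / \<alpha> * R_ad}"
  defines "F \<equiv> \<lambda>\<omega> N. sample_objective (solution_op D A q b B) yd (\<lambda>i. \<xi> i \<omega>) N"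
  defines "D_N \<equiv> \<lambda>\<omega> N. {v \<in> L2_on D.
      v = - (1 / \<alpha>) *\<^sub>R L2_gradient D (F \<omega> N) (prox_on (L2_on D) \<psi> \<alpha> v)}"
  shows "\<forall>N\<ge>1. \<forall>\<omega>\<in>space P. D_N \<omega> N \<subseteq> V_ad"
proof (intro allI impI ballI subsetI)
  fix N :: nat and \<omega> v assume N: "N \<ge> 1" and \<omega>: "\<omega> \<in> space P" and v: "v \<in> D_N \<omega> N"
  note data = \<open>admissible_pde_data D M A \<kappa>min b bmax g gmax B q\<close>
  have D: "open D" using data by (auto simp: admissible_pde_data_def bounded_Lipschitz_domain_def)
  let ?S = "solution_op D A q b B" and ?I = "{1..N}"
  define u where "u = prox_on (L2_on D) \<psi> \<alpha> v"
  have u: "u \<in> L2_on D" "norm u \<le> r_ad"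
    using prox_exists[OF assms(15,16,17,14,19)] assms(19) unfolding u_def by blast+
  have "\<exists>G K \<delta>. G \<in> H1 D \<and> \<delta> > 0 \<and> H1_norm D G \<le> R_ad \<and>
    (\<forall>u'. u' \<in> L2_on D \<longrightarrow> norm (u' - u) \<le> \<delta> \<longrightarrow>
      \<bar>(norm (?S u' (\<xi> i \<omega>) - yd))\<^sup>2 / 2 - (norm (?S u (\<xi> i \<omega>) - yd))\<^sup>2 / 2 - G \<bullet> (u' - u)\<bar> \<le> K * (norm (u' - u))\<^sup>2)" for i
  proof -
    have x: "\<xi> i \<omega> \<in> space M" using assms(3) by simp
    show ?thesis
      unfolding R_ad_def DD_def C_D_def
      by (rule sample_gradient[OF data x u, of yd]) blast
  qed
  then obtain G K \<delta> where G: "\<And>i. G i \<in> H1 D" "\<And>i. \<delta> i > 0" "\<And>i. H1_norm D (G i) \<le> R_ad"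
    "\<And>i u'. u' \<in> L2_on D \<Longrightarrow> norm (u' - u) \<le> \<delta> i \<Longrightarrow>
      \<bar>(norm (?S u' (\<xi> i \<omega>) - yd))\<^sup>2 / 2 - (norm (?S u (\<xi> i \<omega>) - yd))\<^sup>2 / 2 - G i \<bullet> (u' - u)\<bar> \<le> K i * (norm (u' - u))\<^sup>2"
    by metis
  \<comment> \<open>An average of elements of norm at most \<open>R_ad\<close>, so its bound does
    not depend on the number of samples.\<close>
  define H where "H = (1 / real N) *\<^sub>R (\<Sum>i\<in>?I. G i)"
  have sum: "(\<Sum>i\<in>?I. G i) \<in> H1 D" "H1_norm D (\<Sum>i\<in>?I. G i) \<le> real N * R_ad"
    using H1_sum[OF D, of ?I G] G(1) sum_mono[of ?I "\<lambda>i. H1_norm D (G i)" "\<lambda>_. R_ad"] G(3) by auto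
  have H: "H \<in> H1 D" unfolding H_def by (rule H1_scaleR(1)[OF D sum(1)])
  have HR: "H1_norm D H \<le> R_ad"
  proof -
    have "H1_norm D H = 1 / real N * H1_norm D (\<Sum>i\<in>?I. G i)"
      unfolding H_def H1_norm_scaleR[OF D sum(1)] by simp
    also have "\<dots> \<le> 1 / real N * (real N * R_ad)" using sum(2) by (intro mult_left_mono) auto
    finally show ?thesis using N by simp
  qed
  have "L2_gradient D (F \<omega> N) u = H"
  proof (rule L2_gradient_eqI[OF u(1)])
    show "H \<in> L2_on D" using H by (simp add: H1_def)
    \<comment> \<open>A common radius for all samples; the index set is nonempty because N is at
      least 1.\<close>
    show "0 < Min (\<delta> ` ?I)" using N G(2) by simp
    fix u' assume u': "u' \<in> L2_on D" "norm (u' - u) \<le> Min (\<delta> ` ?I)"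
    define E where "E w i = (norm (?S w (\<xi> i \<omega>) - yd))\<^sup>2 / 2" for w i
    have F: "F \<omega> N w = 1 / real N * (\<Sum>i\<in>?I. E w i)" for w
      by (simp add: F_def sample_objective_def E_def sum_divide_distrib[symmetric])
    have "F \<omega> N u' - F \<omega> N u - H \<bullet> (u' - u) = 1 / real N * (\<Sum>i\<in>?I. E u' i - E u i - G i \<bullet> (u' - u))"
      unfolding F H_def by (simp add: inner_sum_left sum_subtractf right_diff_distrib diff_divide_distrib)
    then have "\<bar>F \<omega> N u' - F \<omega> N u - H \<bullet> (u' - u)\<bar> = 1 / real N * \<bar>\<Sum>i\<in>?I. E u' i - E u i - G i \<bullet> (u' - u)\<bar>"
      by (simp add: abs_mult)
    also have "\<dots> \<le> 1 / real N * (\<Sum>i\<in>?I. K i * (norm (u' - u))\<^sup>2)"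
    proof (intro mult_left_mono order_trans[OF sum_abs sum_mono])
      fix i assume "i \<in> ?I"
      then have "norm (u' - u) \<le> \<delta> i" using u'(2) by (auto intro: order_trans)
      from G(4)[OF u'(1) this] show "\<bar>E u' i - E u i - G i \<bullet> (u' - u)\<bar> \<le> K i * (norm (u' - u))\<^sup>2"
        by (simp add: E_def)
    qed simp
    finally show "\<bar>F \<omega> N u' - F \<omega> N u - H \<bullet> (u' - u)\<bar> \<le> (1 / real N * (\<Sum>i\<in>?I. K i)) * (norm (u' - u))\<^sup>2"
      by (simp add: sum_distrib_right)
  qed
  then have ve: "v = (- (1 / \<alpha>)) *\<^sub>R H" using v by (simp add: D_N_def u_def)
  have "H1_norm D v = 1 / \<alpha> * H1_norm D H"
    unfolding ve H1_norm_scaleR[OF D H] using \<open>\<alpha> > 0\<close> by simp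
  also have "\<dots> \<le> 1 / \<alpha> * R_ad" using HR \<open>\<alpha> > 0\<close> by (intro mult_left_mono) auto
  finally show "v \<in> V_ad" using H1_scaleR(1)[OF D H, of "- (1 / \<alpha>)"] by (simp add: V_ad_def ve)
qed

end
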